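(* Let $(A,\omega)$ be a noncommutative symplectic manifold, i.e. $A$ is an associative unital $k$-algebra and $\omega\in \mathrm{DR}^2(A)$ satisfies $d\omega=0$ in $\mathrm{DR}^3(A)$ and is nondegenerate. For $f\in \mathsf{R}(A)=A/[A,A]$ let $\theta_f\in\mathrm{Der}(A)$ be the unique derivation with $i_{\theta_f}\omega=df$, and put $\{f,g\}:=i_{\theta_f}(dg)\in\mathsf{R}(A)$. Then: (i) $\{-,-\}$ makes $\mathsf{R}(A)$ a Lie algebra. (ii) The map $f\mapsto\theta_f$ is a Lie algebra homomorphism from $\mathsf{R}(A)$ to $\mathrm{Der}_\omega(A)$.
   Context: $k$ is an algebraically closed field of characteristic zero. Noncommutative forms. $\Omega^1_{nc}(A)=\ker(A\otimes A\xrightarrow{\text{mult}}A)$, $\Omega^\bullet_{nc}(A)=T_A\Omega^1_{nc}(A)$ (tensor algebra of this $A$-bimodule), a differential graded algebra with $d(a_0\,da_1\cdots da_n)=da_0\,da_1\cdots da_n$, where $da=a\otimes1-1\otimes a$ (up to an overall sign convention). De Rham complex. $\mathrm{DR}^\bullet(A)=\Omega^\bullet_{nc}(A)/[\Omega^\bullet_{nc}(A),\Omega^\bullet_{nc}(A)]$, the quotient by the $k$-span of all super-commutators, with differential induced by $d$. In particular $\mathrm{DR}^0(A)=A/[A,A]=\mathsf{R}(A)$. Contraction and Lie derivative. For $\theta\in\mathrm{Der}(A)$, $i_\theta$ is the degree $-1$ super-derivation of $\Omega^\bullet_{nc}(A)$ with $i_\theta(a)=0$, $i_\theta(da)=\theta(a)$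 for $a\in A$, and $L_\theta=d\circ i_\theta+i_\theta\circ d$. Both descend to $\mathrm{DR}^\bullet(A)$. The form $\omega$ is nondegenerate if the map $\mathrm{Der}(A)\to \mathrm{DR}^1(A)$, $\theta\mapsto i_\theta\omega$, is a bijection. $\mathrm{Der}_\omega(A)=\{\theta\in\mathrm{Der}(A): L_\theta\omega=0 \text{ in } \mathrm{DR}^2(A)\}$, with the commutator bracket. *)

theory Defs
  imports "HOL-Algebra.Algebra"
begin

section \<open>Associative unital algebras, quotients and Lie algebras\<close>

(* The library's locale "algebra" is restricted to commutative algebras.  As usual in HOL-Algebra,
   "ring" means associative and unital, not necessarily commutative; the zero ring is allowed. *)
locale assoc_algebra = module K A + K?: field K + A?: ring A for K (structure) and A (structure) +
  assumes smult_mult_left: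
      "\<lbrakk>c \<in> carrier K; x \<in> carrier A; y \<in> carrier A\<rbrakk>
        \<Longrightarrow> (c \<odot>\<^bsub>A\<^esub> x) \<otimes>\<^bsub>A\<^esub> y = c \<odot>\<^bsub>A\<^esub> (x \<otimes>\<^bsub>A\<^esub> y)"
    and smult_mult_right:
      "\<lbrakk>c \<in> carrier K; x \<in> carrier A; y \<in> carrier A\<rbrakk>
        \<Longrightarrow> x \<otimes>\<^bsub>A\<^esub> (c \<odot>\<^bsub>A\<^esub> y) = c \<odot>\<^bsub>A\<^esub> (x \<otimes>\<^bsub>A\<^esub> y)"

definition kspan :: "('k, 'r) ring_scheme \<Rightarrow> ('k, 'v, 'm) module_scheme \<Rightarrow> 'v set \<Rightarrow> 'v set" where
  "kspan K V S = generate (add_monoid V) {c \<odot>\<^bsub>V\<^esub> s | c s. c \<in> carrier K \<and> s \<in> S}"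

(* Maps on quotients are throughout induced from representatives: if h is constant on the coset P
   then the_elem (h ` P) is its value there. *)

(* The quotient vector space V/S.  Only its module structure is meaningful: the ring fields
   mult and one of the record carry no information. *)
definition quotient_space :: "('k, 'v, 'm) module_scheme \<Rightarrow> 'v set \<Rightarrow> ('k, 'v set) module" where
  "quotient_space V S =
    \<lparr>carrier = a_rcosets\<^bsub>V\<^esub> S, monoid.mult = undefined, monoid.one = undefined,
     ring.zero = S, ring.add = set_add V,
     module.smult = (\<lambda>c P. the_elem ((\<lambda>x. S +>\<^bsub>V\<^esub> (c \<odot>\<^bsub>V\<^esub> x)) ` P))\<rparr>"

locale lie_algebra = module K L + K?: field K for K (structure) and L (structure) +
  fixes br
  assumes br_closed: "\<lbrakk>x \<in> carrier L; y \<in> carrier L\<rbrakk> \<Longrightarrow> br x y \<in> carrier L"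
    and br_add_left: "\<lbrakk>x \<in> carrier L; y \<in> carrier L; z \<in> carrier L\<rbrakk>
      \<Longrightarrow> br (x \<oplus>\<^bsub>L\<^esub> y) z = br x z \<oplus>\<^bsub>L\<^esub> br y z"
    and br_add_right: "\<lbrakk>x \<in> carrier L; y \<in> carrier L; z \<in> carrier L\<rbrakk>
      \<Longrightarrow> br x (y \<oplus>\<^bsub>L\<^esub> z) = br x y \<oplus>\<^bsub>L\<^esub> br x z"
    and br_smult_left: "\<lbrakk>c \<in> carrier K; x \<in> carrier L; y \<in> carrier L\<rbrakk>
      \<Longrightarrow> br (c \<odot>\<^bsub>L\<^esub> x) y = c \<odot>\<^bsub>L\<^esub> br x y"
    and br_smult_right: "\<lbrakk>c \<in> carrier K; x \<in> carrier L; y \<in> carrier L\<rbrakk>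
      \<Longrightarrow> br x (c \<odot>\<^bsub>L\<^esub> y) = c \<odot>\<^bsub>L\<^esub> br x y"
    and br_alternating: "x \<in> carrier L \<Longrightarrow> br x x = \<zero>\<^bsub>L\<^esub>"
    and br_jacobi: "\<lbrakk>x \<in> carrier L; y \<in> carrier L; z \<in> carrier L\<rbrakk>
      \<Longrightarrow> br x (br y z) \<oplus>\<^bsub>L\<^esub> br y (br z x) \<oplus>\<^bsub>L\<^esub> br z (br x y) = \<zero>\<^bsub>L\<^esub>"

locale lie_algebra_hom = L1: lie_algebra K L brL + L2: lie_algebra K M brM
  for K (structure) and L and brL and M and brM +
  fixes \<phi>
  assumes hom_closed: "x \<in> carrier L \<Longrightarrow> \<phi> x \<in> carrier M"
    and hom_add: "\<lbrakk>x \<in> carrier L; y \<in> carrier L\<rbrakk> \<Longrightarrow> \<phi> (x \<oplus>\<^bsub>L\<^esub> y) = \<phi> x \<oplus>\<^bsub>M\<^esub> \<phi> y"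
    and hom_smult: "\<lbrakk>c \<in> carrier K; x \<in> carrier L\<rbrakk> \<Longrightarrow> \<phi> (c \<odot>\<^bsub>L\<^esub> x) = c \<odot>\<^bsub>M\<^esub> \<phi> x"
    and hom_br: "\<lbrakk>x \<in> carrier L; y \<in> carrier L\<rbrakk> \<Longrightarrow> \<phi> (brL x y) = brM (\<phi> x) (\<phi> y)"

section \<open>The tensor square of A over k and its bimodule of one-forms\<close>

definition tensor_relations ::
  "('k, 'r) ring_scheme \<Rightarrow> ('k, 'a, 'm) module_scheme \<Rightarrow> (('a \<times> 'a) \<Rightarrow>\<^sub>0 int) set" where
  "tensor_relations K A =
     {frag_of (a \<oplus>\<^bsub>A\<^esub> a', b) - frag_of (a, b) - frag_of (a', b) | a a' b.
        a \<in> carrier A \<and> a' \<in> carrier A \<and> b \<in> carrier A}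
   \<union> {frag_of (a, b \<oplus>\<^bsub>A\<^esub> b') - frag_of (a, b) - frag_of (a, b') | a b b'.
        a \<in> carrier A \<and> b \<in> carrier A \<and> b' \<in> carrier A}
   \<union> {frag_of (c \<odot>\<^bsub>A\<^esub> a, b) - frag_of (a, c \<odot>\<^bsub>A\<^esub> b) | c a b.
        c \<in> carrier K \<and> a \<in> carrier A \<and> b \<in> carrier A}"

abbreviation tensor_free :: "('k, 'a, 'm) module_scheme \<Rightarrow> (('a \<times> 'a) \<Rightarrow>\<^sub>0 int) monoid" where
  "tensor_free A \<equiv> free_Abelian_group (carrier A \<times> carrier A)"

definition tensor_null ::
  "('k, 'r) ring_scheme \<Rightarrow> ('k, 'a, 'm) module_scheme \<Rightarrow> (('a \<times> 'a) \<Rightarrow>\<^sub>0 int) set" where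
  "tensor_null K A = generate (tensor_free A) (tensor_relations K A)"

definition tensor_class ::
  "('k, 'r) ring_scheme \<Rightarrow> ('k, 'a, 'm) module_scheme \<Rightarrow> (('a \<times> 'a) \<Rightarrow>\<^sub>0 int) \<Rightarrow>
    (('a \<times> 'a) \<Rightarrow>\<^sub>0 int) set" where
  "tensor_class K A r = tensor_null K A #>\<^bsub>tensor_free A\<^esub> r"

(* The underlying abelian group of A \<otimes>\<^sub>k A; the group operation is written as
   multiplication of the record. *)
definition tensor_square ::
  "('k, 'r) ring_scheme \<Rightarrow> ('k, 'a, 'm) module_scheme \<Rightarrow> (('a \<times> 'a) \<Rightarrow>\<^sub>0 int) set monoid" where
  "tensor_square K A = tensor_free A Mod tensor_null K A"

definition mult_map ::
  "('k, 'a, 'm) module_scheme \<Rightarrow> (('a \<times> 'a) \<Rightarrow>\<^sub>0 int) set \<Rightarrow> 'a" where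
  "mult_map A P = the_elem
     ((\<lambda>r. \<Oplus>\<^bsub>A\<^esub>u\<in>Poly_Mapping.keys r.
        add_pow A (Poly_Mapping.lookup r u) (fst u \<otimes>\<^bsub>A\<^esub> snd u)) ` P)"

record ('a, 'b) bimodule = "'b partial_object" +
  badd :: "'b \<Rightarrow> 'b \<Rightarrow> 'b"
  lact :: "'a \<Rightarrow> 'b \<Rightarrow> 'b"
  ract :: "'b \<Rightarrow> 'a \<Rightarrow> 'b"

definition one_forms ::
  "('k, 'r) ring_scheme \<Rightarrow> ('k, 'a, 'm) module_scheme \<Rightarrow>
    ('a, (('a \<times> 'a) \<Rightarrow>\<^sub>0 int) set) bimodule" where
  "one_forms K A =
    \<lparr>carrier = {P \<in> carrier (tensor_square K A). mult_map A P = \<zero>\<^bsub>A\<^esub>},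
     badd = monoid.mult (tensor_square K A),
     lact = (\<lambda>a P. the_elem
       ((\<lambda>r. tensor_class K A (frag_extend (\<lambda>(x, y). frag_of (a \<otimes>\<^bsub>A\<^esub> x, y)) r)) ` P)),
     ract = (\<lambda>P a. the_elem
       ((\<lambda>r. tensor_class K A (frag_extend (\<lambda>(x, y). frag_of (x, y \<otimes>\<^bsub>A\<^esub> a)) r)) ` P))\<rparr>"

(* da = a \<otimes> 1 - 1 \<otimes> a *)
definition exact_one_form ::
  "('k, 'r) ring_scheme \<Rightarrow> ('k, 'a, 'm) module_scheme \<Rightarrow> 'a \<Rightarrow> (('a \<times> 'a) \<Rightarrow>\<^sub>0 int) set" where
  "exact_one_form K A a = tensor_class K A (frag_of (a, \<one>\<^bsub>A\<^esub>) - frag_of (\<one>\<^bsub>A\<^esub>, a))"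

section \<open>The tensor algebra of a bimodule\<close>

(* T_A(M) is the direct sum over n of A \<otimes>\<^sub>A M \<otimes>\<^sub>A ... \<otimes>\<^sub>A M with n factors M.  The leading factor A is
   harmless for n \<ge> 1, and makes the summand for n = 0 equal to A.  The word (a, [m1, ..., mn])
   stands for the pure tensor a \<otimes> m1 \<otimes> ... \<otimes> mn. *)

definition ta_words ::
  "('k, 'a, 'm) module_scheme \<Rightarrow> ('a, 'b, 'n) bimodule_scheme \<Rightarrow> ('a \<times> 'b list) set" where
  "ta_words A M = carrier A \<times> lists (carrier M)"

abbreviation ta_free ::
  "('k, 'a, 'm) module_scheme \<Rightarrow> ('a, 'b, 'n) bimodule_scheme \<Rightarrow>
    (('a \<times> 'b list) \<Rightarrow>\<^sub>0 int) monoid" where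
  "ta_free A M \<equiv> free_Abelian_group (ta_words A M)"

definition ta_relations ::
  "('k, 'a, 'm) module_scheme \<Rightarrow> ('a, 'b, 'n) bimodule_scheme \<Rightarrow>
    (('a \<times> 'b list) \<Rightarrow>\<^sub>0 int) set" where
  "ta_relations A M =
     {frag_of (a \<oplus>\<^bsub>A\<^esub> a', ms) - frag_of (a, ms) - frag_of (a', ms) | a a' ms.
        a \<in> carrier A \<and> a' \<in> carrier A \<and> ms \<in> lists (carrier M)}
   \<union> {frag_of (a, us @ badd M m m' # vs) - frag_of (a, us @ m # vs) - frag_of (a, us @ m' # vs)
        | a us m m' vs.
        a \<in> carrier A \<and> m \<in> carrier M \<and> m' \<in> carrier M
        \<and> us \<in> lists (carrier M) \<and> vs \<in> lists (carrier M)}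
   \<union> {frag_of (a \<otimes>\<^bsub>A\<^esub> b, m # vs) - frag_of (a, lact M b m # vs) | a b m vs.
        a \<in> carrier A \<and> b \<in> carrier A \<and> m \<in> carrier M \<and> vs \<in> lists (carrier M)}
   \<union> {frag_of (a, us @ ract M m b # m' # vs) - frag_of (a, us @ m # lact M b m' # vs)
        | a b us m m' vs.
        a \<in> carrier A \<and> b \<in> carrier A \<and> m \<in> carrier M \<and> m' \<in> carrier M
        \<and> us \<in> lists (carrier M) \<and> vs \<in> lists (carrier M)}"

definition ta_null ::
  "('k, 'a, 'm) module_scheme \<Rightarrow> ('a, 'b, 'n) bimodule_scheme \<Rightarrow>
    (('a \<times> 'b list) \<Rightarrow>\<^sub>0 int) set" where
  "ta_null A M = generate (ta_free A M) (ta_relations A M)"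

definition ta_class ::
  "('k, 'a, 'm) module_scheme \<Rightarrow> ('a, 'b, 'n) bimodule_scheme \<Rightarrow>
    (('a \<times> 'b list) \<Rightarrow>\<^sub>0 int) \<Rightarrow> (('a \<times> 'b list) \<Rightarrow>\<^sub>0 int) set" where
  "ta_class A M r = ta_null A M #>\<^bsub>ta_free A M\<^esub> r"

(* (a \<otimes> m1 \<otimes> ... \<otimes> mp)(b \<otimes> n1 \<otimes> ... \<otimes> nq) = a \<otimes> m1 \<otimes> ... \<otimes> mp b \<otimes> n1 \<otimes> ... \<otimes> nq *)
fun ta_word_mult ::
  "('k, 'a, 'm) module_scheme \<Rightarrow> ('a, 'b, 'n) bimodule_scheme \<Rightarrow>
    'a \<times> 'b list \<Rightarrow> 'a \<times> 'b list \<Rightarrow> 'a \<times> 'b list" where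
  "ta_word_mult A M (a, ms) (b, ns) =
    (if ms = [] then (a \<otimes>\<^bsub>A\<^esub> b, ns) else (a, butlast ms @ ract M (last ms) b # ns))"

definition ta_mult ::
  "('k, 'a, 'm) module_scheme \<Rightarrow> ('a, 'b, 'n) bimodule_scheme \<Rightarrow>
    (('a \<times> 'b list) \<Rightarrow>\<^sub>0 int) set \<Rightarrow> (('a \<times> 'b list) \<Rightarrow>\<^sub>0 int) set \<Rightarrow>
    (('a \<times> 'b list) \<Rightarrow>\<^sub>0 int) set" where
  "ta_mult A M P Q = the_elem
     ((\<lambda>(x, y). ta_class A M
        (frag_extend (\<lambda>u. frag_extend (\<lambda>v. frag_of (ta_word_mult A M u v)) y) x)) ` (P \<times> Q))"

definition tensor_algebra ::
  "('k, 'a, 'm) module_scheme \<Rightarrow> ('a, 'b, 'n) bimodule_scheme \<Rightarrow>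
    ('k, (('a \<times> 'b list) \<Rightarrow>\<^sub>0 int) set) module" where
  "tensor_algebra A M =
    \<lparr>carrier = carrier (ta_free A M Mod ta_null A M),
     monoid.mult = ta_mult A M,
     monoid.one = ta_class A M (frag_of (\<one>\<^bsub>A\<^esub>, [])),
     ring.zero = ta_class A M 0,
     ring.add = monoid.mult (ta_free A M Mod ta_null A M),
     module.smult = (\<lambda>c P. ta_mult A M (ta_class A M (frag_of (c \<odot>\<^bsub>A\<^esub> \<one>\<^bsub>A\<^esub>, []))) P)\<rparr>"

definition tensor_power ::
  "('k, 'a, 'm) module_scheme \<Rightarrow> ('a, 'b, 'n) bimodule_scheme \<Rightarrow> nat \<Rightarrow>
    (('a \<times> 'b list) \<Rightarrow>\<^sub>0 int) set set" where
  "tensor_power A M n =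
     ta_class A M ` carrier (free_Abelian_group {(a, ms) \<in> ta_words A M. length ms = n})"

section \<open>Noncommutative differential forms\<close>

type_synonym 'a form = "(('a \<times> (('a \<times> 'a) \<Rightarrow>\<^sub>0 int) set list) \<Rightarrow>\<^sub>0 int) set"

definition nc_forms ::
  "('k, 'r) ring_scheme \<Rightarrow> ('k, 'a, 'm) module_scheme \<Rightarrow> ('k, 'a form) module" where
  "nc_forms K A = tensor_algebra A (one_forms K A)"

definition nc_forms_deg ::
  "('k, 'r) ring_scheme \<Rightarrow> ('k, 'a, 'm) module_scheme \<Rightarrow> nat \<Rightarrow> 'a form set" where
  "nc_forms_deg K A n = tensor_power A (one_forms K A) n"

(* a0 da1 ... dan *)
definition basic_form ::
  "('k, 'r) ring_scheme \<Rightarrow> ('k, 'a, 'm) module_scheme \<Rightarrow> 'a \<Rightarrow> 'a list \<Rightarrow> 'a form" where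
  "basic_form K A a0 as =
     ta_class A (one_forms K A) (frag_of (a0, map (exact_one_form K A) as))"

abbreviation zero_form ::
  "('k, 'r) ring_scheme \<Rightarrow> ('k, 'a, 'm) module_scheme \<Rightarrow> 'a \<Rightarrow> 'a form" where
  "zero_form K A a \<equiv> basic_form K A a []"

definition additive_maps ::
  "('k, 'v, 'm) module_scheme \<Rightarrow> ('v \<Rightarrow> 'v) set" where
  "additive_maps V = hom (add_monoid V) (add_monoid V) \<inter> extensional (carrier V)"

(* The forms a0 da1 ... dan generate the additive group of forms, so the formula determines d,
   which is automatically k-linear. *)
definition ext_d ::
  "('k, 'r) ring_scheme \<Rightarrow> ('k, 'a, 'm) module_scheme \<Rightarrow> 'a form \<Rightarrow> 'a form" where
  "ext_d K A = (THE D. D \<in> additive_maps (nc_forms K A) \<and>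
     (\<forall>a0 \<in> carrier A. \<forall>as \<in> lists (carrier A).
        D (basic_form K A a0 as) = basic_form K A \<one>\<^bsub>A\<^esub> (a0 # as)))"

definition derivations ::
  "('k, 'r) ring_scheme \<Rightarrow> ('k, 'a, 'm) module_scheme \<Rightarrow> ('a \<Rightarrow> 'a) set" where
  "derivations K A = {\<theta> \<in> carrier A \<rightarrow>\<^sub>E carrier A.
     (\<forall>x \<in> carrier A. \<forall>y \<in> carrier A. \<theta> (x \<oplus>\<^bsub>A\<^esub> y) = \<theta> x \<oplus>\<^bsub>A\<^esub> \<theta> y) \<and>
     (\<forall>c \<in> carrier K. \<forall>x \<in> carrier A. \<theta> (c \<odot>\<^bsub>A\<^esub> x) = c \<odot>\<^bsub>A\<^esub> \<theta> x) \<and>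
     (\<forall>x \<in> carrier A. \<forall>y \<in> carrier A. \<theta> (x \<otimes>\<^bsub>A\<^esub> y) = \<theta> x \<otimes>\<^bsub>A\<^esub> y \<oplus>\<^bsub>A\<^esub> x \<otimes>\<^bsub>A\<^esub> \<theta> y)}"

(* Super-derivations of degree -1.  An additive one that vanishes on A, as in the definition of
   contraction below, is automatically k-linear. *)
definition superderivations_m1 ::
  "('k, 'r) ring_scheme \<Rightarrow> ('k, 'a, 'm) module_scheme \<Rightarrow> ('a form \<Rightarrow> 'a form) set" where
  "superderivations_m1 K A = {D \<in> additive_maps (nc_forms K A).
     (\<forall>x \<in> nc_forms_deg K A 0. D x = \<zero>\<^bsub>nc_forms K A\<^esub>) \<and>
     (\<forall>n. \<forall>x \<in> nc_forms_deg K A (Suc n). D x \<in> nc_forms_deg K A n) \<and>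
     (\<forall>p. \<forall>x \<in> nc_forms_deg K A p. \<forall>y \<in> carrier (nc_forms K A).
        D (x \<otimes>\<^bsub>nc_forms K A\<^esub> y) =
          D x \<otimes>\<^bsub>nc_forms K A\<^esub> y
          \<oplus>\<^bsub>nc_forms K A\<^esub> add_pow (nc_forms K A) ((-1 :: int) ^ p) (x \<otimes>\<^bsub>nc_forms K A\<^esub> D y))}"

definition contraction ::
  "('k, 'r) ring_scheme \<Rightarrow> ('k, 'a, 'm) module_scheme \<Rightarrow> ('a \<Rightarrow> 'a) \<Rightarrow> 'a form \<Rightarrow> 'a form" where
  "contraction K A \<theta> = (THE D. D \<in> superderivations_m1 K A \<and>
     (\<forall>a \<in> carrier A. D (zero_form K A a) = \<zero>\<^bsub>nc_forms K A\<^esub>) \<and>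
     (\<forall>a \<in> carrier A. D (basic_form K A \<one>\<^bsub>A\<^esub> [a]) = zero_form K A (\<theta> a)))"

definition lie_derivative ::
  "('k, 'r) ring_scheme \<Rightarrow> ('k, 'a, 'm) module_scheme \<Rightarrow> ('a \<Rightarrow> 'a) \<Rightarrow> 'a form \<Rightarrow> 'a form" where
  "lie_derivative K A \<theta> x =
     ext_d K A (contraction K A \<theta> x) \<oplus>\<^bsub>nc_forms K A\<^esub> contraction K A \<theta> (ext_d K A x)"

section \<open>The de Rham complex\<close>

definition supercommutators ::
  "('k, 'r) ring_scheme \<Rightarrow> ('k, 'a, 'm) module_scheme \<Rightarrow> 'a form set" where
  "supercommutators K A =
     {(x \<otimes>\<^bsub>nc_forms K A\<^esub> y)
        \<ominus>\<^bsub>nc_forms K A\<^esub> add_pow (nc_forms K A) ((-1 :: int) ^ (p * q)) (y \<otimes>\<^bsub>nc_forms K A\<^esub> x)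
      | p q x y. x \<in> nc_forms_deg K A p \<and> y \<in> nc_forms_deg K A q}"

definition supercommutator_space ::
  "('k, 'r) ring_scheme \<Rightarrow> ('k, 'a, 'm) module_scheme \<Rightarrow> 'a form set" where
  "supercommutator_space K A = kspan K (nc_forms K A) (supercommutators K A)"

definition deRham ::
  "('k, 'r) ring_scheme \<Rightarrow> ('k, 'a, 'm) module_scheme \<Rightarrow> ('k, 'a form set) module" where
  "deRham K A = quotient_space (nc_forms K A) (supercommutator_space K A)"

definition dr_class ::
  "('k, 'r) ring_scheme \<Rightarrow> ('k, 'a, 'm) module_scheme \<Rightarrow> 'a form \<Rightarrow> 'a form set" where
  "dr_class K A x = supercommutator_space K A +>\<^bsub>nc_forms K A\<^esub> x"

definition deRham_deg ::
  "('k, 'r) ring_scheme \<Rightarrow> ('k, 'a, 'm) module_scheme \<Rightarrow> nat \<Rightarrow> 'a form set set" where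
  "deRham_deg K A n = dr_class K A ` nc_forms_deg K A n"

definition dr_map ::
  "('k, 'r) ring_scheme \<Rightarrow> ('k, 'a, 'm) module_scheme \<Rightarrow> ('a form \<Rightarrow> 'a form) \<Rightarrow>
    'a form set \<Rightarrow> 'a form set" where
  "dr_map K A D P = the_elem ((\<lambda>x. dr_class K A (D x)) ` P)"

abbreviation dr_d ::
  "('k, 'r) ring_scheme \<Rightarrow> ('k, 'a, 'm) module_scheme \<Rightarrow> 'a form set \<Rightarrow> 'a form set" where
  "dr_d K A \<equiv> dr_map K A (ext_d K A)"

abbreviation dr_contraction ::
  "('k, 'r) ring_scheme \<Rightarrow> ('k, 'a, 'm) module_scheme \<Rightarrow> ('a \<Rightarrow> 'a) \<Rightarrow>
    'a form set \<Rightarrow> 'a form set" where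
  "dr_contraction K A \<theta> \<equiv> dr_map K A (contraction K A \<theta>)"

abbreviation dr_lie_derivative ::
  "('k, 'r) ring_scheme \<Rightarrow> ('k, 'a, 'm) module_scheme \<Rightarrow> ('a \<Rightarrow> 'a) \<Rightarrow>
    'a form set \<Rightarrow> 'a form set" where
  "dr_lie_derivative K A \<theta> \<equiv> dr_map K A (lie_derivative K A \<theta>)"

section \<open>Noncommutative symplectic manifolds\<close>

definition commutator_quotient ::
  "('k, 'r) ring_scheme \<Rightarrow> ('k, 'a, 'm) module_scheme \<Rightarrow> ('k, 'a set) module" where
  "commutator_quotient K A = quotient_space A
     (kspan K A {(a \<otimes>\<^bsub>A\<^esub> b) \<ominus>\<^bsub>A\<^esub> (b \<otimes>\<^bsub>A\<^esub> a) | a b. a \<in> carrier A \<and> b \<in> carrier A})"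

(* The canonical identification of A/[A,A] with the degree 0 part of the de Rham complex *)
definition dr_of_function ::
  "('k, 'r) ring_scheme \<Rightarrow> ('k, 'a, 'm) module_scheme \<Rightarrow> 'a set \<Rightarrow> 'a form set" where
  "dr_of_function K A f = the_elem ((\<lambda>a. dr_class K A (zero_form K A a)) ` f)"

locale nc_symplectic = assoc_algebra K A for K (structure) and A (structure) +
  fixes \<omega>
  assumes two_form: "\<omega> \<in> deRham_deg K A 2"
    and closed_form: "dr_d K A \<omega> = \<zero>\<^bsub>deRham K A\<^esub>"
    and nondegenerate:
      "bij_betw (\<lambda>\<theta>. dr_contraction K A \<theta> \<omega>) (derivations K A) (deRham_deg K A 1)"

definition hamiltonian ::
  "('k, 'r) ring_scheme \<Rightarrow> ('k, 'a, 'm) module_scheme \<Rightarrow> 'a form set \<Rightarrow> 'a set \<Rightarrow> 'a \<Rightarrow> 'a" where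
  "hamiltonian K A \<omega> f = (THE \<theta>. \<theta> \<in> derivations K A \<and>
     dr_contraction K A \<theta> \<omega> = dr_d K A (dr_of_function K A f))"

definition poisson_bracket ::
  "('k, 'r) ring_scheme \<Rightarrow> ('k, 'a, 'm) module_scheme \<Rightarrow> 'a form set \<Rightarrow>
    'a set \<Rightarrow> 'a set \<Rightarrow> 'a set" where
  "poisson_bracket K A \<omega> f g = (THE h. h \<in> carrier (commutator_quotient K A) \<and>
     dr_of_function K A h =
       dr_contraction K A (hamiltonian K A \<omega> f) (dr_d K A (dr_of_function K A g)))"

(* As for quotient_space, mult and one carry no information. *)
definition symplectic_derivations ::
  "('k, 'r) ring_scheme \<Rightarrow> ('k, 'a, 'm) module_scheme \<Rightarrow> 'a form set \<Rightarrow> ('k, 'a \<Rightarrow> 'a) module" where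
  "symplectic_derivations K A \<omega> =
    \<lparr>carrier = {\<theta> \<in> derivations K A. dr_lie_derivative K A \<theta> \<omega> = \<zero>\<^bsub>deRham K A\<^esub>},
     monoid.mult = undefined, monoid.one = undefined,
     ring.zero = (\<lambda>x\<in>carrier A. \<zero>\<^bsub>A\<^esub>),
     ring.add = (\<lambda>\<theta> \<eta>. \<lambda>x\<in>carrier A. \<theta> x \<oplus>\<^bsub>A\<^esub> \<eta> x),
     module.smult = (\<lambda>c \<theta>. \<lambda>x\<in>carrier A. c \<odot>\<^bsub>A\<^esub> \<theta> x)\<rparr>"

definition derivation_commutator ::
  "('k, 'a, 'm) module_scheme \<Rightarrow> ('a \<Rightarrow> 'a) \<Rightarrow> ('a \<Rightarrow> 'a) \<Rightarrow> ('a \<Rightarrow> 'a)" where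
  "derivation_commutator A \<theta> \<eta> = (\<lambda>x\<in>carrier A. \<theta> (\<eta> x) \<ominus>\<^bsub>A\<^esub> \<eta> (\<theta> x))"

end

theory Submission
  imports Defs
begin

text \<open>
  The argument is the Cartan calculus of noncommutative forms, applied as in classical mechanics.
  If \<open>i\<^bsub>\<theta>\<^esub>\<omega> = df\<close> and \<open>i\<^bsub>\<eta>\<^esub>\<omega> = dg\<close>, then \<open>{f,g} = i\<^bsub>\<theta>\<^esub>i\<^bsub>\<eta>\<^esub>\<omega>\<close> is alternating since
  \<open>i\<^bsub>\<theta>\<^esub>i\<^bsub>\<theta>\<^esub> = 0\<close>; \<open>L\<^bsub>\<theta>\<^esub>\<omega> = d df + i\<^bsub>\<theta>\<^esub>d\<omega> = 0\<close>; and from \<open>i\<^bsub>[\<theta>,\<eta>]\<^esub> = L\<^bsub>\<theta>\<^esub>i\<^bsub>\<eta>\<^esub> - i\<^bsub>\<eta>\<^esub>L\<^bsub>\<theta>\<^esub>\<close> one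
  gets \<open>i\<^bsub>[\<theta>,\<eta>]\<^esub>\<omega> = L\<^bsub>\<theta>\<^esub>dg = d{f,g}\<close>, that is \<open>\<theta>\<^bsub>{f,g}\<^esub> = [\<theta>\<^bsub>f\<^esub>, \<theta>\<^bsub>g\<^esub>]\<close> (\<open>H_bracket\<close>). Since \<open>{f,g}\<close> is the
  class of \<open>\<theta>\<^bsub>f\<^esub>(g)\<close> (\<open>bracket_class\<close>), this identity is the Jacobi identity as well as the
  compatibility of \<open>f \<mapsto> \<theta>\<^bsub>f\<^esub>\<close> with brackets.

  Most of the work is to show that the operators exist on the explicit quotients that define forms.
  It rests on a universal property (\<open>forms_lift\<close>): a ring homomorphism \<open>\<phi>\<close> from \<open>A\<close> to a ring \<open>B\<close>,
  together with a derivation from \<open>A\<close> to \<open>B\<close> along \<open>\<phi>\<close> that kills the scalars, extends to a ring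
  homomorphism from the algebra of forms to \<open>B\<close>. For \<open>B\<close> the ring of upper triangular two by two
  matrices over the forms and suitable data, the extension sends \<open>x\<close> to a matrix with diagonal
  \<open>(-1)\<^bsup>|x|\<^esup>x\<close>, \<open>x\<close> and corner \<open>D x\<close>, where \<open>D\<close> is a super-derivation; this gives both \<open>d\<close> and the
  contractions \<open>i\<^bsub>\<theta>\<^esub>\<close> (\<open>superderivation_exists\<close>). For \<open>B = A\<close> and the zero derivation it
  gives the projection onto degree zero, which shows that \<open>A/[A,A]\<close> embeds into the
  de Rham complex (\<open>zero_form_SC_iff\<close>), so that the bracket is determined by its image there.

  Identities between operators on forms are checked by induction along multiplication by \<open>a\<close> and by
  \<open>da\<close> from the left (\<open>additive_eq_zeroI\<close>), since the forms \<open>a\<^sub>0 da\<^sub>1 \<dots> da\<^sub>n\<close> span.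
\<close>

section \<open>Quotients of free abelian groups\<close>

lemma generate_free_incl:
  assumes "R \<subseteq> carrier (free_Abelian_group S)" "x \<in> generate (free_Abelian_group S) R"
  shows "Poly_Mapping.keys x \<subseteq> S"
  using group.generate_in_carrier[OF group_free_Abelian_group assms] by simp

lemma generate_free_zero: "0 \<in> generate (free_Abelian_group S) R"
  using generate.one[of "free_Abelian_group S" R] by simp

lemma generate_free_add:
  assumes "x \<in> generate (free_Abelian_group S) R" "y \<in> generate (free_Abelian_group S) R"
  shows "x + y \<in> generate (free_Abelian_group S) R"
  using generate.eng[OF assms] by simp

lemma generate_free_minus:
  assumes "R \<subseteq> carrier (free_Abelian_group S)" "x \<in> generate (free_Abelian_group S) R"
  shows "- x \<in> generate (free_Abelian_group S) R"
  using group.generate_m_inv_closed[OF group_free_Abelian_group assms]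
    generate_free_incl[OF assms] by simp

lemma generate_free_diff:
  assumes "R \<subseteq> carrier (free_Abelian_group S)"
    "x \<in> generate (free_Abelian_group S) R" "y \<in> generate (free_Abelian_group S) R"
  shows "x - y \<in> generate (free_Abelian_group S) R"
  using generate_free_add[OF assms(2) generate_free_minus[OF assms(1,3)]] by simp

lemma generate_free_induct [consumes 2, case_names zero base add minus]:
  assumes "x \<in> generate (free_Abelian_group S) R" "R \<subseteq> carrier (free_Abelian_group S)"
    and "P 0" "\<And>r. r \<in> R \<Longrightarrow> P r"
    and add: "\<And>x y. \<lbrakk>Poly_Mapping.keys x \<subseteq> S; Poly_Mapping.keys y \<subseteq> S; P x; P y\<rbrakk> \<Longrightarrow> P (x + y)"
    and minus: "\<And>x. \<lbrakk>Poly_Mapping.keys x \<subseteq> S; P x\<rbrakk> \<Longrightarrow> P (- x)"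
  shows "P x"
  using assms(1)
proof (induction rule: generate.induct)
  case (inv h)
  then have "Poly_Mapping.keys h \<subseteq> S"
    using inv.hyps assms(2) by (simp add: subset_iff)
  then show ?case using assms(4)[OF inv] minus by simp
next
  case (eng h1 h2)
  then show ?case using add generate_free_incl[OF assms(2)] by simp
qed (use assms in auto)

lemma free_coset: "N #>\<^bsub>free_Abelian_group S\<^esub> r = (\<lambda>n. n + r) ` N"
  by (auto simp: r_coset_def)

text \<open>No condition on the representatives is needed here, since cosets of a subgroup of a
  free abelian group are formed with the addition of all finitely supported functions.\<close>

lemma free_coset_eq_iff:
  fixes S :: "'x set" and R :: "('x \<Rightarrow>\<^sub>0 int) set"
  assumes "R \<subseteq> carrier (free_Abelian_group S)"
  defines "N \<equiv> generate (free_Abelian_group S) R"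
  shows "N #>\<^bsub>free_Abelian_group S\<^esub> r = N #>\<^bsub>free_Abelian_group S\<^esub> s \<longleftrightarrow> r - s \<in> N"
proof
  assume "N #>\<^bsub>free_Abelian_group S\<^esub> r = N #>\<^bsub>free_Abelian_group S\<^esub> s"
  then have "(\<lambda>n. n + r) ` N = (\<lambda>n. n + s) ` N" by (simp add: free_coset)
  moreover have "0 + r \<in> (\<lambda>n. n + r) ` N" unfolding N_def using generate_free_zero by blast
  ultimately obtain n where "n \<in> N" "r = n + s" by force
  then show "r - s \<in> N" by simp
next
  assume a: "r - s \<in> N"
  have "\<exists>m\<in>N. n + r = m + s" if "n \<in> N" for n
    using generate_free_add[OF that[unfolded N_def] a[unfolded N_def]]
    by (intro bexI[of _ "n + (r - s)"]) (auto simp: N_def algebra_simps)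
  moreover have "\<exists>m\<in>N. n + s = m + r" if "n \<in> N" for n
    using generate_free_diff[OF assms(1) that[unfolded N_def] a[unfolded N_def]]
    by (intro bexI[of _ "n - (r - s)"]) (auto simp: N_def algebra_simps)
  ultimately show "N #>\<^bsub>free_Abelian_group S\<^esub> r = N #>\<^bsub>free_Abelian_group S\<^esub> s"
    unfolding free_coset by (auto simp: image_iff; metis)
qed

lemma free_coset_mult:
  fixes S :: "'x set" and R :: "('x \<Rightarrow>\<^sub>0 int) set"
  defines "N \<equiv> generate (free_Abelian_group S) R"
  shows "(N #>\<^bsub>free_Abelian_group S\<^esub> r) <#>\<^bsub>free_Abelian_group S\<^esub> (N #>\<^bsub>free_Abelian_group S\<^esub> s)
    = N #>\<^bsub>free_Abelian_group S\<^esub> (r + s)"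
proof -
  have "{n + r + (m + s) |n m. n \<in> N \<and> m \<in> N} = (\<lambda>n. n + (r + s)) ` N"
  proof safe
    fix n m assume "n \<in> N" "m \<in> N"
    then show "n + r + (m + s) \<in> (\<lambda>n. n + (r + s)) ` N"
      by (intro image_eqI[of _ _ "n + m"]) (auto simp: N_def generate_free_add)
  next
    fix n assume "n \<in> N"
    then show "\<exists>n' m. n + (r + s) = n' + r + (m + s) \<and> n' \<in> N \<and> m \<in> N"
      by (intro exI[of _ n] exI[of _ 0]) (auto simp: N_def generate_free_zero)
  qed
  moreover have "(N #>\<^bsub>free_Abelian_group S\<^esub> r) <#>\<^bsub>free_Abelian_group S\<^esub> (N #>\<^bsub>free_Abelian_group S\<^esub> s)
      = {n + r + (m + s) |n m. n \<in> N \<and> m \<in> N}"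
    unfolding free_coset by (simp add: set_mult_def) blast
  ultimately show ?thesis by (simp add: free_coset)
qed

lemma the_elem_image:
  assumes "x \<in> P" "\<And>y. y \<in> P \<Longrightarrow> f y = c"
  shows "the_elem (f ` P) = c"
proof -
  have "f ` P = {c}" using assms by auto
  then show ?thesis by simp
qed

lemma the_elem_free_coset:
  assumes "0 \<in> N" "\<And>n. n \<in> N \<Longrightarrow> f (n + r) = f r"
  shows "the_elem (f ` (N #>\<^bsub>free_Abelian_group S\<^esub> r)) = f r"
  using assms unfolding free_coset by (intro the_elem_image[of "0 + r"]) auto

text \<open>The additive extension of a map \<open>f\<close> from generators to an abelian group.\<close>

definition frag_lift :: "('a, 'm) ring_scheme \<Rightarrow> ('x \<Rightarrow> 'a) \<Rightarrow> ('x \<Rightarrow>\<^sub>0 int) \<Rightarrow> 'a" where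
  "frag_lift G f r = (\<Oplus>\<^bsub>G\<^esub>u\<in>Poly_Mapping.keys r. add_pow G (Poly_Mapping.lookup r u) (f u))"

context abelian_group begin

lemma add_minus_minus_cancel: "\<lbrakk>x \<in> carrier G; y \<in> carrier G\<rbrakk> \<Longrightarrow> x \<oplus> y \<ominus> x \<ominus> y = \<zero>"
  by (metis a_comm a_minus_def add.inv_solve_right' add.m_assoc add.m_closed a_inv_closed r_neg)

lemma minus_self: "x \<in> carrier G \<Longrightarrow> x \<ominus> x = \<zero>"
  by (simp add: a_minus_def r_neg)

lemma minus_zero_right: "x \<in> carrier G \<Longrightarrow> x \<ominus> \<zero> = x"
  by (simp add: a_minus_def)

text \<open>The additive span of a set.\<close>

abbreviation "aspan \<equiv> generate (add_monoid G)"

lemma aspan_incl: "\<lbrakk>B \<subseteq> carrier G; x \<in> aspan B\<rbrakk> \<Longrightarrow> x \<in> carrier G"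
  using add.generate_in_carrier by simp

lemma aspan_zero: "\<zero> \<in> aspan B"
  using generate.one[of "add_monoid G" B] by simp

lemma aspan_add: "\<lbrakk>x \<in> aspan B; y \<in> aspan B\<rbrakk> \<Longrightarrow> x \<oplus> y \<in> aspan B"
  using generate.eng[of x "add_monoid G" B y] by simp

lemma aspan_minus: "\<lbrakk>B \<subseteq> carrier G; x \<in> aspan B\<rbrakk> \<Longrightarrow> \<ominus> x \<in> aspan B"
  using add.generate_m_inv_closed by simp

lemma aspan_diff: "\<lbrakk>B \<subseteq> carrier G; x \<in> aspan B; y \<in> aspan B\<rbrakk> \<Longrightarrow> x \<ominus> y \<in> aspan B"
  by (simp add: a_minus_def aspan_add aspan_minus)

lemma aspan_induct [consumes 2, case_names zero base add minus]:
  assumes "x \<in> aspan B" "B \<subseteq> carrier G"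
    and "P \<zero>" "\<And>x. x \<in> B \<Longrightarrow> P x"
    and add: "\<And>x y. \<lbrakk>x \<in> carrier G; y \<in> carrier G; P x; P y\<rbrakk> \<Longrightarrow> P (x \<oplus> y)"
    and minus: "\<And>x. \<lbrakk>x \<in> carrier G; P x\<rbrakk> \<Longrightarrow> P (\<ominus> x)"
  shows "P x"
  using assms(1)
proof (induction rule: generate.induct)
  case (inv h)
  then show ?case using assms(2,4) minus by (auto simp flip: a_inv_def)
next
  case (eng h1 h2)
  then show ?case using add aspan_incl[OF assms(2)] by simp
qed (use assms in auto)

lemma aspan_coset_eq_iff:
  assumes B: "B \<subseteq> carrier G" and x: "x \<in> carrier G" and y: "y \<in> carrier G"
  shows "aspan B +> x = aspan B +> y \<longleftrightarrow> x \<ominus> y \<in> aspan B"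
proof
  assume "aspan B +> x = aspan B +> y"
  moreover have "x \<in> aspan B +> x"
    using x aspan_zero[of B] by (force simp: a_r_coset_def')
  ultimately obtain h where "h \<in> aspan B" "x = h \<oplus> y" by (auto simp: a_r_coset_def')
  then show "x \<ominus> y \<in> aspan B"
    using y aspan_incl[OF B] by (simp add: a_minus_def a_assoc r_neg)
next
  assume xy: "x \<ominus> y \<in> aspan B"
  have sub: "aspan B +> u \<subseteq> aspan B +> v"
    if u: "u \<in> carrier G" and v: "v \<in> carrier G" and uv: "u \<ominus> v \<in> aspan B" for u v
  proof
    fix z assume "z \<in> aspan B +> u"
    then obtain h where h: "h \<in> aspan B" "z = h \<oplus> u" by (auto simp: a_r_coset_def')
    then have "z = (h \<oplus> (u \<ominus> v)) \<oplus> v"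
      using u v aspan_incl[OF B] by (simp add: a_minus_def a_assoc l_neg)
    then show "z \<in> aspan B +> v" using aspan_add[OF h(1) uv] by (auto simp: a_r_coset_def')
  qed
  have "y \<ominus> x = \<ominus> (x \<ominus> y)" using x y by (simp add: a_minus_def minus_add a_comm)
  then have "y \<ominus> x \<in> aspan B" using aspan_minus[OF B xy] by simp
  with xy show "aspan B +> x = aspan B +> y" using sub[OF x y] sub[OF y x] by blast
qed

lemma the_elem_coset:
  assumes "x \<in> carrier G" "\<And>h. h \<in> aspan B \<Longrightarrow> f (h \<oplus> x) = f x"
  shows "the_elem (f ` (aspan B +> x)) = f x"
proof (rule the_elem_image)
  show "x \<in> aspan B +> x" using assms(1) aspan_zero[of B] by (force simp: a_r_coset_def')
qed (use assms in \<open>auto simp: a_r_coset_def'\<close>)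

lemma frag_lift_superset:
  assumes "f \<in> S \<rightarrow> carrier G" "Poly_Mapping.keys r \<subseteq> F" "F \<subseteq> S" "finite F"
  shows "frag_lift G f r = (\<Oplus>u\<in>F. add_pow G (Poly_Mapping.lookup r u) (f u))"
  unfolding frag_lift_def
proof (rule add.finprod_mono_neutral_cong_left)
  show "[Poly_Mapping.lookup r i] \<cdot> f i = \<zero>" if "i \<in> F - Poly_Mapping.keys r" for i
    using assms that by (auto simp: in_keys_iff add_pow_def)
  show "(\<lambda>u. [Poly_Mapping.lookup r u] \<cdot> f u) \<in> F \<rightarrow> carrier G"
    using assms(1,3) by (blast intro: add.int_pow_closed)
qed (use assms in auto)

lemma frag_lift_closed:
  assumes "f \<in> S \<rightarrow> carrier G" "Poly_Mapping.keys r \<subseteq> S"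
  shows "frag_lift G f r \<in> carrier G"
  unfolding frag_lift_def using assms by (auto intro!: finsum_closed add.int_pow_closed)

lemma frag_lift_add:
  assumes f: "f \<in> S \<rightarrow> carrier G" and r: "Poly_Mapping.keys r \<subseteq> S" and s: "Poly_Mapping.keys s \<subseteq> S"
  shows "frag_lift G f (r + s) = frag_lift G f r \<oplus> frag_lift G f s"
proof -
  let ?F = "Poly_Mapping.keys r \<union> Poly_Mapping.keys s"
  have F: "?F \<subseteq> S" "finite ?F" using r s by auto
  have k: "Poly_Mapping.keys (r + s) \<subseteq> ?F" by (rule keys_add)
  show ?thesis
    unfolding frag_lift_superset[OF f k F] frag_lift_superset[OF f Un_upper1 F]
      frag_lift_superset[OF f Un_upper2 F]
    apply (subst finsum_addf[symmetric])
    subgoal using f F by (auto intro!: add.int_pow_closed)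
    subgoal using f F by (auto intro!: add.int_pow_closed)
    using f F by (intro finsum_cong') (auto intro!: add.int_pow_closed simp: lookup_add add.int_pow_mult Pi_iff subset_iff)
qed

lemma frag_lift_zero: "frag_lift G f 0 = \<zero>\<^bsub>G\<^esub>"
  by (simp add: frag_lift_def)

lemma frag_lift_minus:
  assumes f: "f \<in> S \<rightarrow> carrier G" and r: "Poly_Mapping.keys r \<subseteq> S"
  shows "frag_lift G f (- r) = \<ominus> frag_lift G f r"
proof -
  have "frag_lift G f (- r) \<oplus> frag_lift G f r = \<zero>"
    using frag_lift_add[OF f _ r, of "-r"] r by (simp add: frag_lift_zero[of f])
  then show ?thesis using frag_lift_closed[OF f] r by (metis keys_minus minus_equality)
qed

lemma frag_lift_diff:
  assumes f: "f \<in> S \<rightarrow> carrier G" and r: "Poly_Mapping.keys r \<subseteq> S" and s: "Poly_Mapping.keys s \<subseteq> S"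
  shows "frag_lift G f (r - s) = frag_lift G f r \<ominus> frag_lift G f s"
  using frag_lift_add[OF f r, of "-s"] frag_lift_minus[OF f s] s by (simp add: a_minus_def)

lemma frag_lift_of:
  assumes "f u \<in> carrier G"
  shows "frag_lift G f (frag_of u) = f u"
proof -
  have "frag_lift G f (frag_of u) = (\<Oplus>v\<in>{u}. add_pow G (1::int) (f v))"
    unfolding frag_lift_def by (intro finsum_cong') (use assms in \<open>auto intro!: add.int_pow_closed\<close>)
  also have "\<dots> = f u" using assms by (simp add: add.int_pow_1)
  finally show ?thesis .
qed

text \<open>An additive map that kills relations kills the subgroup that they generate, and hence factors
  through the quotient (\<open>frag_lift_coset\<close>).\<close>

lemma frag_lift_generate:
  assumes f: "f \<in> S \<rightarrow> carrier G" and R: "R \<subseteq> carrier (free_Abelian_group S)"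
    and rel: "\<And>r. r \<in> R \<Longrightarrow> frag_lift G f r = \<zero>" and n: "n \<in> generate (free_Abelian_group S) R"
  shows "frag_lift G f n = \<zero>"
  using n R
proof (induction rule: generate_free_induct)
  case (add x y) then show ?case using frag_lift_add[OF f] by simp
next
  case (minus x) then show ?case using frag_lift_minus[OF f] by simp
qed (auto simp: frag_lift_zero rel)

end

lemma frag_lift_coset:
  fixes S :: "'x set" and R :: "('x \<Rightarrow>\<^sub>0 int) set"
  assumes G: "abelian_group G" and f: "f \<in> S \<rightarrow> carrier G" and R: "R \<subseteq> carrier (free_Abelian_group S)"
    and rel: "\<And>r. r \<in> R \<Longrightarrow> frag_lift G f r = \<zero>\<^bsub>G\<^esub>" and r: "Poly_Mapping.keys r \<subseteq> S"
  defines "N \<equiv> generate (free_Abelian_group S) R"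
  shows "the_elem (frag_lift G f ` (N #>\<^bsub>free_Abelian_group S\<^esub> r)) = frag_lift G f r"
proof (rule the_elem_free_coset)
  interpret abelian_group G by fact
  show "0 \<in> N" by (simp add: N_def generate_free_zero)
  fix n assume n: "n \<in> N"
  then show "frag_lift G f (n + r) = frag_lift G f r"
    using frag_lift_generate[OF f R rel] frag_lift_add[OF f _ r] generate_free_incl[OF R]
      frag_lift_closed[OF f r] by (simp add: N_def)
qed

lemma frag_extend_plus: "frag_extend (\<lambda>u. f u + g u) x = frag_extend f x + frag_extend g x"
  by (simp add: frag_extend_def frag_cmul_distrib2 sum.distrib)

lemma frag_extend_keys:
  assumes "Poly_Mapping.keys x \<subseteq> S" "\<And>u. u \<in> S \<Longrightarrow> Poly_Mapping.keys (f u) \<subseteq> T"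
  shows "Poly_Mapping.keys (frag_extend f x) \<subseteq> T"
  using assms keys_frag_extend[of f x] by blast

lemma frag_extend_generate:
  fixes f :: "'x \<Rightarrow> ('y \<Rightarrow>\<^sub>0 int)"
  assumes R: "R \<subseteq> carrier (free_Abelian_group S)" and R': "R' \<subseteq> carrier (free_Abelian_group S')"
    and rel: "\<And>r. r \<in> R \<Longrightarrow> frag_extend f r \<in> generate (free_Abelian_group S') R'"
    and n: "n \<in> generate (free_Abelian_group S) R"
  shows "frag_extend f n \<in> generate (free_Abelian_group S') R'"
  using n R
proof (induction rule: generate_free_induct)
  case (add x y) then show ?case by (simp add: frag_extend_add generate_free_add)
next
  case (minus x) then show ?case by (simp add: frag_extend_minus generate_free_minus[OF R'])
qed (auto simp: generate_free_zero rel)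

lemma ring_hom_minus:
  assumes "ring R" "ring S" "h \<in> ring_hom R S" "x \<in> carrier R"
  shows "h (\<ominus>\<^bsub>R\<^esub> x) = \<ominus>\<^bsub>S\<^esub> h x"
proof -
  interpret R: ring R by fact
  interpret S: ring S by fact
  have "h (\<ominus>\<^bsub>R\<^esub> x) \<oplus>\<^bsub>S\<^esub> h x = h (\<ominus>\<^bsub>R\<^esub> x \<oplus>\<^bsub>R\<^esub> x)"
    using assms by (simp add: ring_hom_add)
  also have "\<dots> = \<zero>\<^bsub>S\<^esub>"
    using assms by (simp add: R.l_neg ring_hom_zero)
  finally show ?thesis
    using assms by (intro S.minus_equality[symmetric]) (auto simp: ring_hom_closed)
qed

section \<open>The tensor algebra of a bimodule\<close>

lemmas free_induct = free_Abelian_group_induct [consumes 1, case_names zero diff of]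

text \<open>The part of the bimodule laws that makes the tensor algebra a ring. Words multiply by a right
  action on the last letter, so no law for iterated left actions is needed, and neither are
  the group laws for \<open>badd\<close>.\<close>

locale word_bimodule = A?: ring A
  for A :: "('k, 'a, 'm) module_scheme" (structure)
    and M :: "('a, 'b, 'n) bimodule_scheme" +
  assumes badd_closed: "\<lbrakk>m \<in> carrier M; m' \<in> carrier M\<rbrakk> \<Longrightarrow> badd M m m' \<in> carrier M"
    and lact_closed: "\<lbrakk>a \<in> carrier A; m \<in> carrier M\<rbrakk> \<Longrightarrow> lact M a m \<in> carrier M"
    and ract_closed: "\<lbrakk>m \<in> carrier M; a \<in> carrier A\<rbrakk> \<Longrightarrow> ract M m a \<in> carrier M"
    and ract_one: "m \<in> carrier M \<Longrightarrow> ract M m \<one> = m"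
    and ract_ract: "\<lbrakk>m \<in> carrier M; a \<in> carrier A; b \<in> carrier A\<rbrakk>
      \<Longrightarrow> ract M (ract M m a) b = ract M m (a \<otimes> b)"
    and lact_ract: "\<lbrakk>m \<in> carrier M; a \<in> carrier A; b \<in> carrier A\<rbrakk>
      \<Longrightarrow> ract M (lact M a m) b = lact M a (ract M m b)"
    and ract_badd: "\<lbrakk>m \<in> carrier M; m' \<in> carrier M; a \<in> carrier A\<rbrakk>
      \<Longrightarrow> ract M (badd M m m') a = badd M (ract M m a) (ract M m' a)"
    and ract_add: "\<lbrakk>m \<in> carrier M; a \<in> carrier A; b \<in> carrier A\<rbrakk>
      \<Longrightarrow> ract M m (a \<oplus> b) = badd M (ract M m a) (ract M m b)"
begin

abbreviation "W \<equiv> ta_words A M"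
abbreviation "R \<equiv> ta_relations A M"
abbreviation "N \<equiv> ta_null A M"
abbreviation "cl \<equiv> ta_class A M"
abbreviation "T \<equiv> tensor_algebra A M"
abbreviation "wm \<equiv> ta_word_mult A M"

text \<open>The biadditive extension of the product of words.\<close>

definition bil :: "('a \<times> 'b list \<Rightarrow>\<^sub>0 int) \<Rightarrow> ('a \<times> 'b list \<Rightarrow>\<^sub>0 int) \<Rightarrow> ('a \<times> 'b list \<Rightarrow>\<^sub>0 int)" where
  "bil x y = frag_extend (\<lambda>u. frag_extend (\<lambda>v. frag_of (wm u v)) y) x"

lemma words_iff [simp]: "(a, ms) \<in> W \<longleftrightarrow> a \<in> carrier A \<and> ms \<in> lists (carrier M)"
  by (auto simp: ta_words_def)

lemma word_mult_nil [simp]: "wm (a, []) (b, ns) = (a \<otimes> b, ns)"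
  and word_mult_snoc [simp]: "wm (a, ms @ [m]) (b, ns) = (a, ms @ ract M m b # ns)"
  by simp_all

declare ta_word_mult.simps [simp del]

lemma word_cases:
  assumes "u \<in> W"
  obtains a where "a \<in> carrier A" "u = (a, [])"
  | a ms m where "a \<in> carrier A" "ms \<in> lists (carrier M)" "m \<in> carrier M" "u = (a, ms @ [m])"
  using assms by (cases u; cases "snd u" rule: rev_cases) auto

text \<open>The shapes of words that occur in the relations, where the last letter is not displayed as
  the end of an append.\<close>

lemma word_mult_cons [simp]:
  "wm (a, us @ m # vs @ [m']) (b, ns) = (a, us @ m # vs @ ract M m' b # ns)"
  "wm (a, m # vs @ [m']) (b, ns) = (a, m # vs @ ract M m' b # ns)"
  "wm (a, [m]) (b, ns) = (a, ract M m b # ns)"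
  "wm (a, us @ [m, m']) (b, ns) = (a, us @ m # ract M m' b # ns)"
  "wm (a, us @ m # m' # vs @ [m'']) (b, ns) = (a, us @ m # m' # vs @ ract M m'' b # ns)"
  using word_mult_snoc[of a "us @ m # vs" m' b ns] word_mult_snoc[of a "m # vs" m' b ns]
    word_mult_snoc[of a "[]" m b ns] word_mult_snoc[of a "us @ [m]" m' b ns]
    word_mult_snoc[of a "us @ m # m' # vs" m'' b ns] by simp_all

lemma word_mult_closed: "\<lbrakk>u \<in> W; v \<in> W\<rbrakk> \<Longrightarrow> wm u v \<in> W"
  by (erule word_cases; erule word_cases) (auto simp: ract_closed)

lemma word_mult_assoc: "\<lbrakk>u \<in> W; v \<in> W; w \<in> W\<rbrakk> \<Longrightarrow> wm (wm u v) w = wm u (wm v w)"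
  by (erule word_cases; erule word_cases; cases w) (auto simp: m_assoc ract_ract)

lemma word_mult_one: "u \<in> W \<Longrightarrow> wm (\<one>, []) u = u" "u \<in> W \<Longrightarrow> wm u (\<one>, []) = u"
  by (cases u; simp) (erule word_cases; simp add: ract_one)

lemma bil_add_left: "bil (x + x') y = bil x y + bil x' y"
  and bil_diff_left: "bil (x - x') y = bil x y - bil x' y"
  and bil_minus_left: "bil (- x) y = - bil x y"
  and bil_zero_left: "bil 0 y = 0"
  by (simp_all add: bil_def frag_extend_add frag_extend_diff frag_extend_minus)

lemma bil_add_right: "bil x (y + y') = bil x y + bil x y'"
  by (simp add: bil_def frag_extend_add frag_extend_plus)

lemma bil_zero_right: "bil x 0 = 0"
  by (simp add: bil_def frag_extend_eq_0)

lemma bil_minus_right: "bil x (- y) = - bil x y"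
  using bil_add_right[of x y "- y"] by (simp add: bil_zero_right eq_neg_iff_add_eq_0 add.commute)

lemma bil_diff_right: "bil x (y - y') = bil x y - bil x y'"
  using bil_add_right[of x y "- y'"] by (simp add: bil_minus_right)

lemma bil_of: "bil (frag_of u) (frag_of v) = frag_of (wm u v)"
  by (simp add: bil_def)

lemma bil_keys:
  assumes "Poly_Mapping.keys x \<subseteq> W" "Poly_Mapping.keys y \<subseteq> W"
  shows "Poly_Mapping.keys (bil x y) \<subseteq> W"
  unfolding bil_def using assms word_mult_closed by (intro frag_extend_keys[of _ W]) auto

lemma bil_assoc:
  assumes x: "Poly_Mapping.keys x \<subseteq> W" and y: "Poly_Mapping.keys y \<subseteq> W"
    and z: "Poly_Mapping.keys z \<subseteq> W"
  shows "bil (bil x y) z = bil x (bil y z)"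
  using x
proof (induction x rule: free_induct)
  case (of u)
  note u = this
  show ?case using y
  proof (induction y rule: free_induct)
    case (of v)
    note v = this
    show ?case using z
      by (induction z rule: free_induct)
         (simp_all add: bil_of bil_zero_right bil_diff_right word_mult_assoc u v)
  qed (simp_all add: bil_zero_left bil_diff_left bil_diff_right bil_zero_right)
qed (simp_all add: bil_zero_left bil_diff_left)

lemma bil_one:
  assumes x: "Poly_Mapping.keys x \<subseteq> W"
  shows "bil (frag_of (\<one>, [])) x = x" "bil x (frag_of (\<one>, [])) = x"
  using x
  by (induction x rule: free_induct)
     (simp_all add: bil_of bil_zero_right bil_zero_left bil_diff_right bil_diff_left word_mult_one)

lemma relations_carrier: "R \<subseteq> carrier (ta_free A M)"
proof
  fix r assume "r \<in> R"
  then show "r \<in> carrier (ta_free A M)"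
    unfolding ta_relations_def
    by (elim UnE CollectE exE conjE; simp; intro order.trans[OF keys_diff] Un_least)
       (auto simp: badd_closed lact_closed ract_closed)
qed

lemma relation_left:
  "\<lbrakk>a \<in> carrier A; a' \<in> carrier A; ms \<in> lists (carrier M)\<rbrakk>
    \<Longrightarrow> frag_of (a \<oplus> a', ms) - frag_of (a, ms) - frag_of (a', ms) \<in> N"
  and relation_badd:
  "\<lbrakk>a \<in> carrier A; us \<in> lists (carrier M); vs \<in> lists (carrier M); m \<in> carrier M; m' \<in> carrier M\<rbrakk>
    \<Longrightarrow> frag_of (a, us @ badd M m m' # vs) - frag_of (a, us @ m # vs) - frag_of (a, us @ m' # vs) \<in> N"
  and relation_lact:
  "\<lbrakk>a \<in> carrier A; b \<in> carrier A; m \<in> carrier M; vs \<in> lists (carrier M)\<rbrakk>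
    \<Longrightarrow> frag_of (a \<otimes> b, m # vs) - frag_of (a, lact M b m # vs) \<in> N"
  and relation_ract:
  "\<lbrakk>a \<in> carrier A; b \<in> carrier A; us \<in> lists (carrier M); vs \<in> lists (carrier M);
     m \<in> carrier M; m' \<in> carrier M\<rbrakk>
    \<Longrightarrow> frag_of (a, us @ ract M m b # m' # vs) - frag_of (a, us @ m # lact M b m' # vs) \<in> N"
  unfolding ta_null_def ta_relations_def by (rule generate.incl; blast)+

lemma relation_cases:
  assumes "r \<in> R"
  obtains (left) a a' ms where "r = frag_of (a \<oplus> a', ms) - frag_of (a, ms) - frag_of (a', ms)"
      "a \<in> carrier A" "a' \<in> carrier A" "ms \<in> lists (carrier M)"
  | (badd) a us m m' vs where
      "r = frag_of (a, us @ badd M m m' # vs) - frag_of (a, us @ m # vs) - frag_of (a, us @ m' # vs)"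
      "a \<in> carrier A" "m \<in> carrier M" "m' \<in> carrier M"
      "us \<in> lists (carrier M)" "vs \<in> lists (carrier M)"
  | (lact) a b m vs where "r = frag_of (a \<otimes> b, m # vs) - frag_of (a, lact M b m # vs)"
      "a \<in> carrier A" "b \<in> carrier A" "m \<in> carrier M" "vs \<in> lists (carrier M)"
  | (ract) a b us m m' vs where
      "r = frag_of (a, us @ ract M m b # m' # vs) - frag_of (a, us @ m # lact M b m' # vs)"
      "a \<in> carrier A" "b \<in> carrier A" "m \<in> carrier M" "m' \<in> carrier M"
      "us \<in> lists (carrier M)" "vs \<in> lists (carrier M)"
  using assms unfolding ta_relations_def by blast

lemma word_mult_relation:
  assumes "r \<in> R" "v \<in> W"
  shows "bil (frag_of v) r \<in> N"
  using assms(1)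
proof (cases r rule: relation_cases)
  case (left a a' ms)
  with assms(2) show ?thesis
    by (cases v rule: word_cases)
       (auto simp: bil_diff_right bil_of r_distr ract_add ract_closed relation_left relation_badd)
next
  case (badd a us m m' vs)
  with assms(2) show ?thesis
    using relation_badd[of _ "_ @ _ # _"]
    by (cases v rule: word_cases)
       (auto simp: bil_diff_right bil_of ract_closed relation_badd)
next
  case (lact a b m vs)
  from assms(2) show ?thesis
  proof (cases v rule: word_cases)
    case 2
    with lact show ?thesis
      by (auto simp: bil_diff_right bil_of ract_closed relation_ract simp flip: ract_ract)
  qed (use lact in \<open>auto simp: bil_diff_right bil_of relation_lact simp flip: m_assoc\<close>)
next
  case (ract a b us m m' vs)
  with assms(2) show ?thesis
    using relation_ract[of _ _ "_ @ _ # _"]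
    by (cases v rule: word_cases)
       (auto simp: bil_diff_right bil_of ract_closed relation_ract)
qed

lemma relation_word_mult:
  assumes "r \<in> R" "v \<in> W"
  shows "bil r (frag_of v) \<in> N"
proof -
  obtain c ns where v: "v = (c, ns)" "c \<in> carrier A" "ns \<in> lists (carrier M)"
    using assms(2) by (cases v) auto
  from assms(1) show ?thesis
  proof (cases r rule: relation_cases)
    case (left a a' ms)
    then show ?thesis
      using v relation_left[of _ _ "_ @ _ # _"]
      by (cases ms rule: rev_cases)
         (auto simp: bil_diff_left bil_of l_distr ract_closed relation_left)
  next
    case (badd a us m m' vs)
    then show ?thesis
      using v relation_badd[of _ _ "_ @ _ # _"]
      by (cases vs rule: rev_cases)
         (auto simp: bil_diff_left bil_of ract_closed ract_badd relation_badd)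
  next
    case (lact a b m vs)
    then show ?thesis
      using v relation_lact[of _ _ _ "_ @ _ # _"]
      by (cases vs rule: rev_cases)
         (auto simp: bil_diff_left bil_of ract_closed lact_ract relation_lact)
  next
    case (ract a b us m m' vs)
    then show ?thesis
      using v relation_ract[of _ _ _ "_ @ _ # _"]
      by (cases vs rule: rev_cases)
         (auto simp: bil_diff_left bil_of ract_closed lact_ract relation_ract)
  qed
qed

lemmas null_add = generate_free_add[where R = R and S = W, folded ta_null_def]
  and null_minus = generate_free_minus[OF relations_carrier, folded ta_null_def]
  and null_diff = generate_free_diff[OF relations_carrier, folded ta_null_def]
  and null_keys = generate_free_incl[OF relations_carrier, folded ta_null_def]

lemma null_zero: "0 \<in> N"
  unfolding ta_null_def by (rule generate_free_zero)

lemma null_bil_left: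
  assumes n: "n \<in> N" and y: "Poly_Mapping.keys y \<subseteq> W"
  shows "bil n y \<in> N"
  using y
proof (induction y rule: free_induct)
  case (of v)
  from n[unfolded ta_null_def] relations_carrier show ?case
    by (induction rule: generate_free_induct)
       (auto simp: bil_zero_left null_zero relation_word_mult of bil_add_left bil_minus_left null_add null_minus)
qed (simp_all add: bil_zero_right null_zero bil_diff_right null_diff)

lemma null_bil_right:
  assumes n: "n \<in> N" and y: "Poly_Mapping.keys y \<subseteq> W"
  shows "bil y n \<in> N"
  using y
proof (induction y rule: free_induct)
  case (of v)
  from n[unfolded ta_null_def] relations_carrier show ?case
    by (induction rule: generate_free_induct)
       (auto simp: bil_zero_right null_zero word_mult_relation of bil_add_right bil_minus_right null_add null_minus)
qed (simp_all add: bil_zero_left null_zero bil_diff_left null_diff)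

lemma class_eq_iff: "cl r = cl s \<longleftrightarrow> r - s \<in> N"
  unfolding ta_class_def ta_null_def by (rule free_coset_eq_iff[OF relations_carrier])

lemma class_iff: "s \<in> cl r \<longleftrightarrow> s - r \<in> N"
  unfolding ta_class_def free_coset by (auto intro: image_eqI[of _ _ "s - r"])

lemma T_carrier: "carrier T = cl ` {r. Poly_Mapping.keys r \<subseteq> W}"
  by (auto simp: tensor_algebra_def FactGroup_def RCOSETS_def ta_class_def free_Abelian_group_def)

lemma class_closed [simp]: "Poly_Mapping.keys r \<subseteq> W \<Longrightarrow> cl r \<in> carrier T"
  by (auto simp: T_carrier)

lemma T_cases:
  assumes "x \<in> carrier T"
  obtains r where "Poly_Mapping.keys r \<subseteq> W" "x = cl r"
  using assms by (auto simp: T_carrier)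

lemma class_add: "cl r \<oplus>\<^bsub>T\<^esub> cl s = cl (r + s)"
  using free_coset_mult[of W R r s]
  by (simp add: tensor_algebra_def FactGroup_def ta_class_def ta_null_def)

lemma class_mult:
  assumes x: "Poly_Mapping.keys x \<subseteq> W" and y: "Poly_Mapping.keys y \<subseteq> W"
  shows "cl x \<otimes>\<^bsub>T\<^esub> cl y = cl (bil x y)"
proof -
  have "the_elem ((\<lambda>(x, y). cl (bil x y)) ` (cl x \<times> cl y)) = cl (bil x y)"
  proof (rule the_elem_image)
    show "(x, y) \<in> cl x \<times> cl y" by (simp add: class_iff null_zero)
    fix p assume "p \<in> cl x \<times> cl y"
    then obtain n m where p: "p = (x + n, y + m)" "n \<in> N" "m \<in> N"
      by (cases p) (auto simp: class_iff, metis add.commute diff_add_cancel)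
    have "bil (x + n) (y + m) - bil x y = bil x m + (bil n y + bil n m)"
      by (simp add: bil_add_left bil_add_right)
    also have "\<dots> \<in> N"
      using p(2,3) by (intro null_add null_bil_right[OF _ x] null_bil_left[OF _ y] null_bil_left[OF _ null_keys])
    finally show "(case p of (x, y) \<Rightarrow> cl (bil x y)) = cl (bil x y)"
      using p by (simp add: class_eq_iff)
  qed
  then show ?thesis by (simp add: tensor_algebra_def ta_mult_def bil_def)
qed

lemma T_zero: "\<zero>\<^bsub>T\<^esub> = cl 0" and T_one: "\<one>\<^bsub>T\<^esub> = cl (frag_of (\<one>, []))"
  by (simp_all add: tensor_algebra_def)

lemma keys_add_words: "\<lbrakk>Poly_Mapping.keys r \<subseteq> W; Poly_Mapping.keys s \<subseteq> W\<rbrakk> \<Longrightarrow> Poly_Mapping.keys (r + s) \<subseteq> W"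
  using keys_add[of r s] by blast

lemma tensor_algebra_ring: "ring T"
proof (rule ringI)
  show "abelian_group T"
  proof (rule abelian_groupI)
    fix x assume "x \<in> carrier T"
    then obtain r where r: "Poly_Mapping.keys r \<subseteq> W" "x = cl r" by (rule T_cases)
    show "\<exists>y\<in>carrier T. y \<oplus>\<^bsub>T\<^esub> x = \<zero>\<^bsub>T\<^esub>"
      using r by (intro bexI[of _ "cl (- r)"]) (auto simp: class_add T_zero)
  qed (auto elim!: T_cases simp: class_add T_zero ac_simps keys_add_words)
  show "Group.monoid T"
    by (rule monoidI) (auto elim!: T_cases simp: class_mult T_one bil_keys bil_assoc bil_one)
qed (auto elim!: T_cases simp: class_mult class_add bil_add_left bil_add_right keys_add_words bil_keys)

interpretation T: ring T by (rule tensor_algebra_ring)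

lemma class_minus: "Poly_Mapping.keys r \<subseteq> W \<Longrightarrow> \<ominus>\<^bsub>T\<^esub> cl r = cl (- r)"
  by (rule T.minus_equality) (auto simp: class_add T_zero)

lemma class_diff: "\<lbrakk>Poly_Mapping.keys r \<subseteq> W; Poly_Mapping.keys s \<subseteq> W\<rbrakk> \<Longrightarrow> cl r \<ominus>\<^bsub>T\<^esub> cl s = cl (r - s)"
  by (simp add: a_minus_def class_minus class_add)

text \<open>The canonical maps of \<open>A\<close> and of the bimodule into the tensor algebra.\<close>

definition scal :: "'a \<Rightarrow> ('a \<times> 'b list \<Rightarrow>\<^sub>0 int) set" where
  "scal a = cl (frag_of (a, []))"

definition gen :: "'b \<Rightarrow> ('a \<times> 'b list \<Rightarrow>\<^sub>0 int) set" where
  "gen m = cl (frag_of (\<one>, [m]))"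

lemma scal_closed [simp]: "a \<in> carrier A \<Longrightarrow> scal a \<in> carrier T"
  and gen_closed [simp]: "m \<in> carrier M \<Longrightarrow> gen m \<in> carrier T"
  by (simp_all add: scal_def gen_def)

lemma scal_hom: "scal \<in> ring_hom A T"
proof (rule ring_hom_memI)
  fix a b assume ab: "a \<in> carrier A" "b \<in> carrier A"
  show "scal (a \<oplus> b) = scal a \<oplus>\<^bsub>T\<^esub> scal b"
    using relation_left[OF ab, of "[]"] ab by (simp add: scal_def class_add class_eq_iff algebra_simps)
  show "scal (a \<otimes> b) = scal a \<otimes>\<^bsub>T\<^esub> scal b"
    using ab by (simp add: scal_def class_mult bil_of)
qed (auto simp: T_one scal_def)

lemma gen_badd: "\<lbrakk>m \<in> carrier M; m' \<in> carrier M\<rbrakk> \<Longrightarrow> gen (badd M m m') = gen m \<oplus>\<^bsub>T\<^esub> gen m'"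
  using relation_badd[of \<one> "[]" "[]" m m'] by (simp add: gen_def class_add class_eq_iff algebra_simps)

lemma gen_lact: "\<lbrakk>a \<in> carrier A; m \<in> carrier M\<rbrakk> \<Longrightarrow> gen (lact M a m) = scal a \<otimes>\<^bsub>T\<^esub> gen m"
  using relation_lact[of \<one> a m "[]"]
  by (simp add: gen_def scal_def class_mult bil_of class_eq_iff[symmetric])

lemma gen_ract: "\<lbrakk>a \<in> carrier A; m \<in> carrier M\<rbrakk> \<Longrightarrow> gen (ract M m a) = gen m \<otimes>\<^bsub>T\<^esub> scal a"
  by (simp add: gen_def scal_def class_mult bil_of)

lemma class_word_prod:
  assumes "a \<in> carrier A" "ms \<in> lists (carrier M)"
  shows "cl (frag_of (a, ms)) = scal a \<otimes>\<^bsub>T\<^esub> foldr (\<lambda>m. (\<otimes>\<^bsub>T\<^esub>) (gen m)) ms \<one>\<^bsub>T\<^esub>"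
proof -
  have "foldr (\<lambda>m. (\<otimes>\<^bsub>T\<^esub>) (gen m)) ms \<one>\<^bsub>T\<^esub> = cl (frag_of (\<one>, ms))"
    using assms(2) by (induction ms) (simp_all add: T_one gen_def class_mult bil_of ract_one)
  then show ?thesis using assms by (simp add: scal_def class_mult bil_of)
qed

text \<open>The tensor algebra is additively generated by the classes of words.\<close>

lemma T_induct [consumes 1, case_names zero diff word]:
  assumes "x \<in> carrier T" "P \<zero>\<^bsub>T\<^esub>"
    "\<And>x y. \<lbrakk>x \<in> carrier T; y \<in> carrier T; P x; P y\<rbrakk> \<Longrightarrow> P (x \<ominus>\<^bsub>T\<^esub> y)"
    "\<And>a ms. \<lbrakk>a \<in> carrier A; ms \<in> lists (carrier M)\<rbrakk> \<Longrightarrow> P (cl (frag_of (a, ms)))"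
  shows "P x"
proof -
  obtain r where r: "Poly_Mapping.keys r \<subseteq> W" "x = cl r" using assms(1) by (rule T_cases)
  from r(1) have "P (cl r)"
  proof (induction r rule: free_induct)
    case (diff x y) then show ?case using assms(3)[of "cl x" "cl y"] by (simp add: class_diff)
  next
    case (of a) then show ?case using assms(4) by (cases a) simp
  qed (use assms(2) T_zero in simp)
  then show ?thesis using r by simp
qed

text \<open>The universal property of the tensor algebra.\<close>

lemma tensor_algebra_lift:
  assumes B: "ring B" and \<phi>: "\<phi> \<in> ring_hom A B" and \<mu>: "\<mu> \<in> carrier M \<rightarrow> carrier B"
    and \<mu>_badd: "\<And>m m'. \<lbrakk>m \<in> carrier M; m' \<in> carrier M\<rbrakk> \<Longrightarrow> \<mu> (badd M m m') = \<mu> m \<oplus>\<^bsub>B\<^esub> \<mu> m'"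
    and \<mu>_lact: "\<And>a m. \<lbrakk>a \<in> carrier A; m \<in> carrier M\<rbrakk> \<Longrightarrow> \<mu> (lact M a m) = \<phi> a \<otimes>\<^bsub>B\<^esub> \<mu> m"
    and \<mu>_ract: "\<And>a m. \<lbrakk>a \<in> carrier A; m \<in> carrier M\<rbrakk> \<Longrightarrow> \<mu> (ract M m a) = \<mu> m \<otimes>\<^bsub>B\<^esub> \<phi> a"
  obtains h where "h \<in> ring_hom T B" "\<And>a. a \<in> carrier A \<Longrightarrow> h (scal a) = \<phi> a"
    "\<And>m. m \<in> carrier M \<Longrightarrow> h (gen m) = \<mu> m"
proof -
  interpret B: ring B by (rule B)
  note ph [simp] = ring_hom_closed[OF \<phi>] ring_hom_mult[OF \<phi>] ring_hom_add[OF \<phi>] ring_hom_one[OF \<phi>]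
  have mu [simp]: "\<mu> m \<in> carrier B" if "m \<in> carrier M" for m using \<mu> that by auto
  define v where "v = (\<lambda>ms. foldr (\<lambda>m. (\<otimes>\<^bsub>B\<^esub>) (\<mu> m)) ms \<one>\<^bsub>B\<^esub>)"
  have v_nil [simp]: "v [] = \<one>\<^bsub>B\<^esub>" and v_cons [simp]: "v (m # ms) = \<mu> m \<otimes>\<^bsub>B\<^esub> v ms" for m ms
    by (simp_all add: v_def)
  have v_closed [simp]: "v ms \<in> carrier B" if "ms \<in> lists (carrier M)" for ms
    using that by (induction ms) auto
  have v_app: "v (us @ vs) = v us \<otimes>\<^bsub>B\<^esub> v vs" if "us \<in> lists (carrier M)" "vs \<in> lists (carrier M)" for us vs
    using that by (induction us) (auto simp: B.m_assoc)
  define f where "f = (\<lambda>(a, ms). \<phi> a \<otimes>\<^bsub>B\<^esub> v ms)"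
  have f_eq [simp]: "f (a, ms) = \<phi> a \<otimes>\<^bsub>B\<^esub> v ms" for a ms by (simp add: f_def)
  have f: "f \<in> W \<rightarrow> carrier B"
  proof
    fix u assume "u \<in> W"
    then show "f u \<in> carrier B" by (cases u) simp
  qed
  have f_mult: "f (wm u w) = f u \<otimes>\<^bsub>B\<^esub> f w" if "u \<in> W" "w \<in> W" for u w
    using that by (cases u rule: word_cases; cases w)
      (auto simp: v_app B.m_assoc ract_closed \<mu>_ract)
  have kD: "Poly_Mapping.keys (a - b) \<subseteq> W" if "Poly_Mapping.keys a \<subseteq> W" "Poly_Mapping.keys b \<subseteq> W"
    for a b using that keys_diff[of a b] by blast
  have rel: "frag_lift B f r = \<zero>\<^bsub>B\<^esub>" if "r \<in> R" for r
    using that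
  proof (cases r rule: relation_cases)
    case (left a a' ms)
    then show ?thesis
      by (simp add: B.frag_lift_diff[OF f] kD B.frag_lift_of B.l_distr
           B.add_minus_minus_cancel)
  next
    case (badd a us m m' vs)
    then show ?thesis
      by (simp add: B.frag_lift_diff[OF f] kD B.frag_lift_of B.l_distr B.r_distr v_app
           \<mu>_badd badd_closed B.add_minus_minus_cancel)
  next
    case (lact a b m vs)
    then show ?thesis
      by (simp add: B.frag_lift_diff[OF f] kD B.frag_lift_of v_app \<mu>_lact lact_closed B.m_assoc
           B.minus_self)
  next
    case (ract a b us m m' vs)
    then show ?thesis
      by (simp add: B.frag_lift_diff[OF f] kD B.frag_lift_of v_app \<mu>_lact \<mu>_ract lact_closed
           ract_closed B.m_assoc B.minus_self)
  qed
  define h where "h = (\<lambda>P. the_elem (frag_lift B f ` P))"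
  have h: "h (cl r) = frag_lift B f r" if "Poly_Mapping.keys r \<subseteq> W" for r
    unfolding h_def ta_class_def ta_null_def
    by (rule frag_lift_coset[OF B.abelian_group_axioms f relations_carrier rel that])
  have hw: "h (cl (frag_of (a, ms))) = \<phi> a \<otimes>\<^bsub>B\<^esub> v ms"
    if "a \<in> carrier A" "ms \<in> lists (carrier M)" for a ms
    using that by (simp add: h B.frag_lift_of)
  have lift_mult: "frag_lift B f (bil x y) = frag_lift B f x \<otimes>\<^bsub>B\<^esub> frag_lift B f y"
    if x: "Poly_Mapping.keys x \<subseteq> W" and y: "Poly_Mapping.keys y \<subseteq> W" for x y
    using x
  proof (induction x rule: free_induct)
    case zero
    show ?case using B.frag_lift_closed[OF f y] by (simp add: bil_zero_left B.frag_lift_zero)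
  next
    case (diff a b)
    then show ?case
      using y by (simp add: bil_diff_left B.frag_lift_diff[OF f] bil_keys B.frag_lift_closed[OF f]
          B.l_distr B.l_minus a_minus_def)
  next
    case u: (of u)
    then have fu: "f u \<in> carrier B" using f by auto
    from y show ?case
    proof (induction y rule: free_induct)
      case zero
      show ?case using fu by (simp add: bil_zero_right B.frag_lift_zero B.frag_lift_of)
    next
      case (diff a b)
      then show ?case
        using u fu by (simp add: bil_diff_right B.frag_lift_diff[OF f] bil_keys B.frag_lift_closed[OF f]
            B.r_distr B.r_minus a_minus_def B.frag_lift_of)
    next
      case (of w)
      then have "f w \<in> carrier B" using f by auto
      with fu of u f_mult[of u w] show ?case
        by (simp add: bil_of B.frag_lift_of)
    qed
  qed
  have "h \<in> ring_hom T B"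
  proof (rule ring_hom_memI)
    fix x y assume "x \<in> carrier T" "y \<in> carrier T"
    then show "h (x \<otimes>\<^bsub>T\<^esub> y) = h x \<otimes>\<^bsub>B\<^esub> h y" "h (x \<oplus>\<^bsub>T\<^esub> y) = h x \<oplus>\<^bsub>B\<^esub> h y"
      by (auto elim!: T_cases simp: class_mult class_add h bil_keys lift_mult B.frag_lift_add[OF f]
          keys_add_words)
  next
    fix x assume "x \<in> carrier T"
    then show "h x \<in> carrier B" by (auto elim!: T_cases simp: h B.frag_lift_closed[OF f])
  next
    show "h \<one>\<^bsub>T\<^esub> = \<one>\<^bsub>B\<^esub>" by (simp add: T_one hw)
  qed
  then show thesis
    by (rule that) (simp_all add: scal_def gen_def hw)
qed

end

section \<open>The bimodule of one-forms\<close>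

context assoc_algebra begin

abbreviation "S2 \<equiv> carrier A \<times> carrier A"
abbreviation "tc \<equiv> tensor_class K A"
abbreviation "Nt \<equiv> tensor_null K A"
abbreviation "M \<equiv> one_forms K A"

text \<open>On representatives of \<open>A \<otimes> A\<close>: the multiplication map, and the actions of \<open>A\<close> on the outer
  left and the outer right.\<close>

definition mult_frag :: "('c \<times> 'c \<Rightarrow>\<^sub>0 int) \<Rightarrow> 'c" where
  "mult_frag = frag_lift A (\<lambda>u. fst u \<otimes>\<^bsub>A\<^esub> snd u)"

definition left_frag :: "'c \<Rightarrow> ('c \<times> 'c \<Rightarrow>\<^sub>0 int) \<Rightarrow> ('c \<times> 'c \<Rightarrow>\<^sub>0 int)" where
  "left_frag a = frag_extend (\<lambda>(x, y). frag_of (a \<otimes>\<^bsub>A\<^esub> x, y))"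

definition right_frag :: "'c \<Rightarrow> ('c \<times> 'c \<Rightarrow>\<^sub>0 int) \<Rightarrow> ('c \<times> 'c \<Rightarrow>\<^sub>0 int)" where
  "right_frag a = frag_extend (\<lambda>(x, y). frag_of (x, y \<otimes>\<^bsub>A\<^esub> a))"

lemma tensor_relation_cases:
  assumes "r \<in> tensor_relations K A"
  obtains (left) a a' b where "r = frag_of (a \<oplus>\<^bsub>A\<^esub> a', b) - frag_of (a, b) - frag_of (a', b)"
      "a \<in> carrier A" "a' \<in> carrier A" "b \<in> carrier A"
  | (right) a b b' where "r = frag_of (a, b \<oplus>\<^bsub>A\<^esub> b') - frag_of (a, b) - frag_of (a, b')"
      "a \<in> carrier A" "b \<in> carrier A" "b' \<in> carrier A"
  | (scalar) c a b where "r = frag_of (c \<odot>\<^bsub>A\<^esub> a, b) - frag_of (a, c \<odot>\<^bsub>A\<^esub> b)"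
      "c \<in> carrier K" "a \<in> carrier A" "b \<in> carrier A"
  using assms unfolding tensor_relations_def by blast

lemma tensor_relations_carrier: "tensor_relations K A \<subseteq> carrier (tensor_free A)"
proof
  fix r assume "r \<in> tensor_relations K A"
  then show "r \<in> carrier (tensor_free A)"
    by (cases r rule: tensor_relation_cases; simp; intro order.trans[OF keys_diff] Un_least) auto
qed

lemma tensor_relation_left: "\<lbrakk>a \<in> carrier A; a' \<in> carrier A; b \<in> carrier A\<rbrakk>
    \<Longrightarrow> frag_of (a \<oplus>\<^bsub>A\<^esub> a', b) - frag_of (a, b) - frag_of (a', b) \<in> Nt"
  and tensor_relation_right: "\<lbrakk>a \<in> carrier A; b \<in> carrier A; b' \<in> carrier A\<rbrakk>
    \<Longrightarrow> frag_of (a, b \<oplus>\<^bsub>A\<^esub> b') - frag_of (a, b) - frag_of (a, b') \<in> Nt"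
  and tensor_relation_scalar: "\<lbrakk>c \<in> carrier K; a \<in> carrier A; b \<in> carrier A\<rbrakk>
    \<Longrightarrow> frag_of (c \<odot>\<^bsub>A\<^esub> a, b) - frag_of (a, c \<odot>\<^bsub>A\<^esub> b) \<in> Nt"
  unfolding tensor_null_def tensor_relations_def by (rule generate.incl; blast)+

lemmas tensor_null_add = generate_free_add[where R = "tensor_relations K A" and S = S2, folded tensor_null_def]
  and tensor_null_minus = generate_free_minus[OF tensor_relations_carrier, folded tensor_null_def]
  and tensor_null_diff = generate_free_diff[OF tensor_relations_carrier, folded tensor_null_def]

lemma tensor_null_zero: "0 \<in> Nt"
  unfolding tensor_null_def by (rule generate_free_zero)

lemma tensor_class_eq_iff: "tc r = tc s \<longleftrightarrow> r - s \<in> Nt"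
  unfolding tensor_class_def tensor_null_def by (rule free_coset_eq_iff[OF tensor_relations_carrier])

lemma tensor_class_add: "monoid.mult (tensor_square K A) (tc r) (tc s) = tc (r + s)"
  using free_coset_mult[of S2 "tensor_relations K A" r s]
  by (simp add: tensor_square_def FactGroup_def tensor_class_def tensor_null_def)

lemma tensor_square_carrier: "carrier (tensor_square K A) = tc ` {r. Poly_Mapping.keys r \<subseteq> S2}"
  by (auto simp: tensor_square_def FactGroup_def RCOSETS_def tensor_class_def free_Abelian_group_def)

lemma keys_diff_subset: "\<lbrakk>Poly_Mapping.keys x \<subseteq> V; Poly_Mapping.keys y \<subseteq> V\<rbrakk> \<Longrightarrow> Poly_Mapping.keys (x - y) \<subseteq> V"
  and keys_add_subset: "\<lbrakk>Poly_Mapping.keys x \<subseteq> V; Poly_Mapping.keys y \<subseteq> V\<rbrakk> \<Longrightarrow> Poly_Mapping.keys (x + y) \<subseteq> V"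
  using keys_diff[of x y] keys_add[of x y] by blast+

lemma mult_fun: "(\<lambda>u. fst u \<otimes>\<^bsub>A\<^esub> snd u) \<in> S2 \<rightarrow> carrier A"
  by auto

lemmas mult_frag_add = M.frag_lift_add[OF mult_fun, folded mult_frag_def]
  and mult_frag_diff = M.frag_lift_diff[OF mult_fun, folded mult_frag_def]
  and mult_frag_closed = M.frag_lift_closed[OF mult_fun, folded mult_frag_def]

lemma mult_frag_zero [simp]: "mult_frag 0 = \<zero>\<^bsub>A\<^esub>"
  by (simp add: mult_frag_def M.frag_lift_zero)

lemma mult_frag_of [simp]: "\<lbrakk>x \<in> carrier A; y \<in> carrier A\<rbrakk> \<Longrightarrow> mult_frag (frag_of (x, y)) = x \<otimes>\<^bsub>A\<^esub> y"
  by (simp add: mult_frag_def M.frag_lift_of)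

lemma mult_map_class:
  assumes "Poly_Mapping.keys r \<subseteq> S2"
  shows "mult_map A (tc r) = mult_frag r"
proof -
  have "mult_frag r = \<zero>\<^bsub>A\<^esub>" if "r \<in> tensor_relations K A" for r
    using that
    by (cases r rule: tensor_relation_cases)
       (simp_all add: mult_frag_diff keys_diff_subset A.l_distr A.r_distr smult_mult_left smult_mult_right
        M.minus_self M.add_minus_minus_cancel)
  then show ?thesis
    unfolding mult_map_def frag_lift_def[symmetric] tensor_class_def tensor_null_def mult_frag_def
    by (intro frag_lift_coset[OF M.abelian_group_axioms mult_fun tensor_relations_carrier _ assms])
qed

lemma ext_simps [simp]:
  "left_frag a 0 = 0" "right_frag a 0 = 0" "left_frag a (x - y) = left_frag a x - left_frag a y" "right_frag a (x - y) = right_frag a x - right_frag a y"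
  "left_frag a (x + y) = left_frag a x + left_frag a y" "right_frag a (x + y) = right_frag a x + right_frag a y"
  "left_frag a (frag_of (u, v)) = frag_of (a \<otimes>\<^bsub>A\<^esub> u, v)" "right_frag a (frag_of (u, v)) = frag_of (u, v \<otimes>\<^bsub>A\<^esub> a)"
  by (simp_all add: left_frag_def right_frag_def frag_extend_diff frag_extend_add)

lemma ext_keys:
  assumes "a \<in> carrier A" "Poly_Mapping.keys r \<subseteq> S2"
  shows "Poly_Mapping.keys (left_frag a r) \<subseteq> S2" "Poly_Mapping.keys (right_frag a r) \<subseteq> S2"
  unfolding left_frag_def right_frag_def by (rule frag_extend_keys[OF assms(2)]; use assms(1) in auto)+

lemma ext_null:
  assumes a: "a \<in> carrier A" and n: "n \<in> Nt"
  shows "left_frag a n \<in> Nt" "right_frag a n \<in> Nt"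
proof -
  have l: "left_frag a r \<in> Nt" if "r \<in> tensor_relations K A" for r
    using that a
    by (cases r rule: tensor_relation_cases)
       (simp_all add: A.r_distr smult_mult_right tensor_relation_left tensor_relation_right
        tensor_relation_scalar)
  have r: "right_frag a r \<in> Nt" if "r \<in> tensor_relations K A" for r
    using that a
    by (cases r rule: tensor_relation_cases)
       (simp_all add: A.l_distr smult_mult_left tensor_relation_left tensor_relation_right
        tensor_relation_scalar)
  show "left_frag a n \<in> Nt" "right_frag a n \<in> Nt"
    using frag_extend_generate[OF tensor_relations_carrier tensor_relations_carrier _ n[unfolded tensor_null_def]]
      l r unfolding left_frag_def right_frag_def tensor_null_def by blast+
qed

lemma lact_class: "a \<in> carrier A \<Longrightarrow> lact M a (tc r) = tc (left_frag a r)"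
  and ract_class: "a \<in> carrier A \<Longrightarrow> ract M (tc r) a = tc (right_frag a r)"
  unfolding one_forms_def tensor_class_def[of K A r] bimodule.simps left_frag_def[symmetric] right_frag_def[symmetric]
  by (subst the_elem_free_coset; simp add: tensor_null_zero tensor_class_eq_iff ext_null)+

lemma badd_class: "badd M (tc r) (tc s) = tc (r + s)"
  by (simp add: one_forms_def tensor_class_add)

lemma M_carrier: "carrier M = tc ` {r. Poly_Mapping.keys r \<subseteq> S2 \<and> mult_frag r = \<zero>\<^bsub>A\<^esub>}"
  by (auto simp: one_forms_def tensor_square_carrier mult_map_class)

lemma M_closed [simp]: "\<lbrakk>Poly_Mapping.keys r \<subseteq> S2; mult_frag r = \<zero>\<^bsub>A\<^esub>\<rbrakk> \<Longrightarrow> tc r \<in> carrier M"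
  by (auto simp: M_carrier)

lemma M_cases:
  assumes "m \<in> carrier M"
  obtains r where "Poly_Mapping.keys r \<subseteq> S2" "mult_frag r = \<zero>\<^bsub>A\<^esub>" "m = tc r"
  using assms by (auto simp: M_carrier)

lemma mult_frag_ext:
  assumes a: "a \<in> carrier A" and r: "Poly_Mapping.keys r \<subseteq> S2"
  shows "mult_frag (left_frag a r) = a \<otimes>\<^bsub>A\<^esub> mult_frag r \<and> mult_frag (right_frag a r) = mult_frag r \<otimes>\<^bsub>A\<^esub> a"
  using r
proof (induction r rule: free_induct)
  case (diff x y)
  then show ?case
    using a by (simp add: mult_frag_diff ext_keys mult_frag_closed A.l_distr A.r_distr a_minus_def A.l_minus A.r_minus)
qed (use a in \<open>auto simp: A.m_assoc\<close>)

lemma right_frag_one: "Poly_Mapping.keys r \<subseteq> S2 \<Longrightarrow> right_frag \<one>\<^bsub>A\<^esub> r = r"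
  by (induction r rule: free_induct) auto

lemma right_frag_rext: "\<lbrakk>Poly_Mapping.keys r \<subseteq> S2; a \<in> carrier A; b \<in> carrier A\<rbrakk>
    \<Longrightarrow> right_frag b (right_frag a r) = right_frag (a \<otimes>\<^bsub>A\<^esub> b) r"
  by (induction r rule: free_induct) (auto simp: A.m_assoc)

lemma right_frag_lext: "Poly_Mapping.keys r \<subseteq> S2 \<Longrightarrow> right_frag b (left_frag a r) = left_frag a (right_frag b r)"
  by (induction r rule: free_induct) auto

lemma right_frag_add:
  assumes r: "Poly_Mapping.keys r \<subseteq> S2" and ab: "a \<in> carrier A" "b \<in> carrier A"
  shows "right_frag (a \<oplus>\<^bsub>A\<^esub> b) r - (right_frag a r + right_frag b r) \<in> Nt"
  using r
proof (induction r rule: free_induct)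
  case (diff x y)
  from tensor_null_diff[OF diff.IH] show ?case by (simp add: algebra_simps)
next
  case (of u)
  then show ?case
    using tensor_relation_right[of "fst u" "snd u \<otimes>\<^bsub>A\<^esub> a" "snd u \<otimes>\<^bsub>A\<^esub> b"] ab
    by (cases u) (auto simp: A.r_distr algebra_simps)
qed (simp add: tensor_null_zero)

lemma one_forms_bimodule: "word_bimodule A M"
proof unfold_locales
qed (auto elim!: M_cases simp: badd_class lact_class ract_class ext_keys mult_frag_ext mult_frag_add keys_add_subset
       right_frag_one right_frag_rext right_frag_lext tensor_class_eq_iff[THEN iffD2, OF right_frag_add])

sublocale \<Omega>: word_bimodule A M
  by (rule one_forms_bimodule)

lemma exact_class: "exact_one_form K A a = tc (frag_of (a, \<one>\<^bsub>A\<^esub>) - frag_of (\<one>\<^bsub>A\<^esub>, a))"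
  by (simp add: exact_one_form_def)

lemma exact_closed [simp]: "a \<in> carrier A \<Longrightarrow> exact_one_form K A a \<in> carrier M"
  unfolding exact_class by (rule M_closed) (auto simp: mult_frag_diff keys_diff_subset M.minus_self)

lemma exact_add:
  assumes "a \<in> carrier A" "b \<in> carrier A"
  shows "exact_one_form K A (a \<oplus>\<^bsub>A\<^esub> b) = badd M (exact_one_form K A a) (exact_one_form K A b)"
  using tensor_null_diff[OF tensor_relation_left[of a b "\<one>\<^bsub>A\<^esub>"] tensor_relation_right[of "\<one>\<^bsub>A\<^esub>" a b]] assms
  by (simp add: exact_class badd_class tensor_class_eq_iff algebra_simps)

text \<open>The Leibniz rule, which holds already for the chosen representatives.\<close>

lemma exact_mult:
  assumes "a \<in> carrier A" "b \<in> carrier A"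
  shows "exact_one_form K A (a \<otimes>\<^bsub>A\<^esub> b)
    = badd M (lact M a (exact_one_form K A b)) (ract M (exact_one_form K A a) b)"
  using assms by (simp add: exact_class badd_class lact_class ract_class)

lemma exact_scalar:
  assumes "c \<in> carrier K"
  shows "exact_one_form K A (c \<odot>\<^bsub>A\<^esub> \<one>\<^bsub>A\<^esub>) = tc 0"
  using tensor_relation_scalar[OF assms, of "\<one>\<^bsub>A\<^esub>" "\<one>\<^bsub>A\<^esub>"]
  by (simp add: exact_class tensor_class_eq_iff)

text \<open>The bimodule map induced by a derivation \<open>\<delta>\<close> along \<open>\<phi>\<close> is the restriction of
  \<open>x \<otimes> y \<mapsto> \<delta> x \<phi> y\<close>, which is a map of left modules only on the kernel of the multiplication.\<close>

lemma one_forms_lift: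
  fixes B :: "('z, 'w) ring_scheme"
  assumes B: "ring B" and \<phi>: "\<phi> \<in> ring_hom A B" and \<delta>: "\<delta> \<in> carrier A \<rightarrow> carrier B"
    and \<delta>_add: "\<And>a b. \<lbrakk>a \<in> carrier A; b \<in> carrier A\<rbrakk> \<Longrightarrow> \<delta> (a \<oplus>\<^bsub>A\<^esub> b) = \<delta> a \<oplus>\<^bsub>B\<^esub> \<delta> b"
    and \<delta>_mult: "\<And>a b. \<lbrakk>a \<in> carrier A; b \<in> carrier A\<rbrakk>
      \<Longrightarrow> \<delta> (a \<otimes>\<^bsub>A\<^esub> b) = \<phi> a \<otimes>\<^bsub>B\<^esub> \<delta> b \<oplus>\<^bsub>B\<^esub> \<delta> a \<otimes>\<^bsub>B\<^esub> \<phi> b"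
    and \<delta>_scalar: "\<And>c. c \<in> carrier K \<Longrightarrow> \<delta> (c \<odot>\<^bsub>A\<^esub> \<one>\<^bsub>A\<^esub>) = \<zero>\<^bsub>B\<^esub>"
  obtains \<mu> where "\<mu> \<in> carrier M \<rightarrow> carrier B"
    "\<And>m m'. \<lbrakk>m \<in> carrier M; m' \<in> carrier M\<rbrakk> \<Longrightarrow> \<mu> (badd M m m') = \<mu> m \<oplus>\<^bsub>B\<^esub> \<mu> m'"
    "\<And>a m. \<lbrakk>a \<in> carrier A; m \<in> carrier M\<rbrakk> \<Longrightarrow> \<mu> (lact M a m) = \<phi> a \<otimes>\<^bsub>B\<^esub> \<mu> m"
    "\<And>a m. \<lbrakk>a \<in> carrier A; m \<in> carrier M\<rbrakk> \<Longrightarrow> \<mu> (ract M m a) = \<mu> m \<otimes>\<^bsub>B\<^esub> \<phi> a"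
    "\<And>a. a \<in> carrier A \<Longrightarrow> \<mu> (exact_one_form K A a) = \<delta> a"
proof -
  interpret B: ring B by (rule B)
  note ph [simp] = ring_hom_closed[OF \<phi>] ring_hom_mult[OF \<phi>] ring_hom_add[OF \<phi>] ring_hom_one[OF \<phi>]
  have de [simp]: "\<delta> a \<in> carrier B" if "a \<in> carrier A" for a using \<delta> that by auto
  have \<delta>_smult: "\<delta> (c \<odot>\<^bsub>A\<^esub> a) = \<delta> a \<otimes>\<^bsub>B\<^esub> \<phi> (c \<odot>\<^bsub>A\<^esub> \<one>\<^bsub>A\<^esub>)"
    if "c \<in> carrier K" "a \<in> carrier A" for c a
  proof -
    have "c \<odot>\<^bsub>A\<^esub> a = a \<otimes>\<^bsub>A\<^esub> (c \<odot>\<^bsub>A\<^esub> \<one>\<^bsub>A\<^esub>)" using that by (simp add: smult_mult_right)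
    then show ?thesis using that by (simp add: \<delta>_mult \<delta>_scalar)
  qed
  have \<phi>_smult: "\<phi> (c \<odot>\<^bsub>A\<^esub> a) = \<phi> (c \<odot>\<^bsub>A\<^esub> \<one>\<^bsub>A\<^esub>) \<otimes>\<^bsub>B\<^esub> \<phi> a"
    if "c \<in> carrier K" "a \<in> carrier A" for c a
  proof -
    have "c \<odot>\<^bsub>A\<^esub> a = (c \<odot>\<^bsub>A\<^esub> \<one>\<^bsub>A\<^esub>) \<otimes>\<^bsub>A\<^esub> a" using that by (simp add: smult_mult_left)
    then show ?thesis using that by (simp only: ph smult_closed A.one_closed)
  qed
  define f where "f = (\<lambda>(x, y). \<delta> x \<otimes>\<^bsub>B\<^esub> \<phi> y)"
  have f_eq [simp]: "f (x, y) = \<delta> x \<otimes>\<^bsub>B\<^esub> \<phi> y" for x y by (simp add: f_def)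
  have f: "f \<in> S2 \<rightarrow> carrier B" by auto
  have rel: "frag_lift B f r = \<zero>\<^bsub>B\<^esub>" if "r \<in> tensor_relations K A" for r
    using that
  proof (cases r rule: tensor_relation_cases)
    case (scalar c a b)
    then show ?thesis
      by (simp add: B.frag_lift_diff[OF f] keys_diff_subset B.frag_lift_of \<delta>_smult[of c a] \<phi>_smult[of c b]
          B.m_assoc B.minus_self)
  qed (simp_all add: B.frag_lift_diff[OF f] keys_diff_subset B.frag_lift_of B.l_distr B.r_distr
         \<delta>_add B.add_minus_minus_cancel)
  define \<mu> where "\<mu> = (\<lambda>P. the_elem (frag_lift B f ` P))"
  have \<mu>: "\<mu> (tc r) = frag_lift B f r" if "Poly_Mapping.keys r \<subseteq> S2" for r
    unfolding \<mu>_def tensor_class_def tensor_null_def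
    by (rule frag_lift_coset[OF B.abelian_group_axioms f tensor_relations_carrier rel that])
  note cl = B.frag_lift_closed[OF f]
  have l: "frag_lift B f (left_frag a r) = \<phi> a \<otimes>\<^bsub>B\<^esub> frag_lift B f r \<oplus>\<^bsub>B\<^esub> \<delta> a \<otimes>\<^bsub>B\<^esub> \<phi> (mult_frag r)"
    if a: "a \<in> carrier A" and r: "Poly_Mapping.keys r \<subseteq> S2" for a r
    using r
  proof (induction r rule: free_induct)
    case zero
    have "\<phi> \<zero>\<^bsub>A\<^esub> = \<zero>\<^bsub>B\<^esub>" using ring_hom_zero[OF \<phi> A.ring_axioms B] .
    then show ?case using a by (simp add: B.frag_lift_zero)
  next
    case (diff x y)
    have "\<phi> (\<ominus>\<^bsub>A\<^esub> b) = \<ominus>\<^bsub>B\<^esub> \<phi> b" if "b \<in> carrier A" for b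
      using ring_hom_minus[OF A.ring_axioms B \<phi> that] .
    with diff show ?case
      using a by (simp add: B.frag_lift_diff[OF f] ext_keys mult_frag_diff mult_frag_closed cl a_minus_def
          B.r_distr B.r_minus B.minus_add B.a_ac)
  next
    case (of u)
    then show ?case
      using a by (cases u) (auto simp: B.frag_lift_of \<delta>_mult B.l_distr B.m_assoc)
  qed
  have r: "frag_lift B f (right_frag a r) = frag_lift B f r \<otimes>\<^bsub>B\<^esub> \<phi> a"
    if a: "a \<in> carrier A" and r: "Poly_Mapping.keys r \<subseteq> S2" for a r
    using r
  proof (induction r rule: free_induct)
    case (diff x y)
    then show ?case
      using a by (simp add: B.frag_lift_diff[OF f] ext_keys cl a_minus_def B.l_distr B.l_minus)
  next
    case (of u)
    then show ?case using a by (cases u) (auto simp: B.frag_lift_of B.m_assoc)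
  qed (use a in \<open>simp add: B.frag_lift_zero\<close>)
  have \<phi>0: "\<phi> \<zero>\<^bsub>A\<^esub> = \<zero>\<^bsub>B\<^esub>" using ring_hom_zero[OF \<phi> A.ring_axioms B] .
  have \<delta>1: "\<delta> \<one>\<^bsub>A\<^esub> = \<zero>\<^bsub>B\<^esub>"
    using \<delta>_scalar[of "\<one>\<^bsub>K\<^esub>"] by simp
  show thesis
  proof (rule that)
    show "\<mu> \<in> carrier M \<rightarrow> carrier B" by (auto elim!: M_cases simp: \<mu> cl)
    fix m m' a assume m: "m \<in> carrier M"
    show "\<mu> (badd M m m') = \<mu> m \<oplus>\<^bsub>B\<^esub> \<mu> m'" if "m' \<in> carrier M"
      using m that by (auto elim!: M_cases simp: \<mu> badd_class keys_add_subset B.frag_lift_add[OF f])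
    show "\<mu> (lact M a m) = \<phi> a \<otimes>\<^bsub>B\<^esub> \<mu> m" if "a \<in> carrier A"
      using m that by (auto elim!: M_cases simp: \<mu> lact_class ext_keys l \<phi>0 cl)
    show "\<mu> (ract M m a) = \<mu> m \<otimes>\<^bsub>B\<^esub> \<phi> a" if "a \<in> carrier A"
      using m that by (auto elim!: M_cases simp: \<mu> ract_class ext_keys r)
  next
    fix a assume "a \<in> carrier A"
    then show "\<mu> (exact_one_form K A a) = \<delta> a"
      by (simp add: exact_class \<mu> keys_diff_subset B.frag_lift_diff[OF f] B.frag_lift_of \<delta>1 a_minus_def)
  qed
qed

end

section \<open>The algebra of noncommutative forms\<close>

text \<open>Upper triangular two by two matrices; \<open>(p, q, r)\<close> has diagonal entries \<open>p, r\<close> and corner \<open>q\<close>.\<close>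

definition upper_triangular :: "('a, 'm) ring_scheme \<Rightarrow> ('a \<times> 'a \<times> 'a) ring" where
  "upper_triangular R =
    \<lparr>carrier = carrier R \<times> carrier R \<times> carrier R,
     monoid.mult = (\<lambda>(p, q, r) (p', q', r').
       (p \<otimes>\<^bsub>R\<^esub> p', p \<otimes>\<^bsub>R\<^esub> q' \<oplus>\<^bsub>R\<^esub> q \<otimes>\<^bsub>R\<^esub> r', r \<otimes>\<^bsub>R\<^esub> r')),
     monoid.one = (\<one>\<^bsub>R\<^esub>, \<zero>\<^bsub>R\<^esub>, \<one>\<^bsub>R\<^esub>),
     ring.zero = (\<zero>\<^bsub>R\<^esub>, \<zero>\<^bsub>R\<^esub>, \<zero>\<^bsub>R\<^esub>),
     ring.add = (\<lambda>(p, q, r) (p', q', r'). (p \<oplus>\<^bsub>R\<^esub> p', q \<oplus>\<^bsub>R\<^esub> q', r \<oplus>\<^bsub>R\<^esub> r'))\<rparr>"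

lemma (in ring) upper_triangular_ring: "ring (upper_triangular R)"
proof (rule ringI)
  show "abelian_group (upper_triangular R)"
  proof (rule abelian_groupI)
    fix x assume "x \<in> carrier (upper_triangular R)"
    then show "\<exists>y\<in>carrier (upper_triangular R). y \<oplus>\<^bsub>upper_triangular R\<^esub> x = \<zero>\<^bsub>upper_triangular R\<^esub>"
      by (intro bexI[of _ "(\<ominus> fst x, \<ominus> fst (snd x), \<ominus> snd (snd x))"])
         (auto simp: upper_triangular_def l_neg)
  qed (auto simp: upper_triangular_def a_ac)
  show "Group.monoid (upper_triangular R)"
    by (rule monoidI) (auto simp: upper_triangular_def m_assoc l_distr r_distr a_assoc)
qed (auto simp: upper_triangular_def l_distr r_distr a_ac)

context assoc_algebra begin

abbreviation "Om \<equiv> nc_forms K A"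

abbreviation form_mult :: "'c form \<Rightarrow> 'c form \<Rightarrow> 'c form" (infixl "\<bullet>" 70) where
  "form_mult \<equiv> monoid.mult Om"

abbreviation "\<iota> \<equiv> \<lambda>a. zero_form K A a"

text \<open>The form \<open>da\<^sub>1 \<dots> da\<^sub>n\<close>.\<close>

abbreviation "exact_prod \<equiv> basic_form K A \<one>\<^bsub>A\<^esub>"

text \<open>The form \<open>da\<close>. It is kept folded, since \<open>exact_prod as\<close> is split into factors
  \<open>dd a\<close> by rewriting.\<close>

definition dd :: "'c \<Rightarrow> 'c form" where
  "dd a = exact_prod [a]"

lemma nc_forms_ring: "ring Om"
  unfolding nc_forms_def by (rule \<Omega>.tensor_algebra_ring)

sublocale F: ring Om by (rule nc_forms_ring)

lemma zero_form_scal: "\<iota> a = \<Omega>.scal a"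
  by (simp add: basic_form_def \<Omega>.scal_def)

lemma dd_gen: "dd a = \<Omega>.gen (exact_one_form K A a)"
  by (simp add: dd_def basic_form_def \<Omega>.gen_def)

lemma dd_closed [simp]: "a \<in> carrier A \<Longrightarrow> dd a \<in> carrier Om"
  by (simp add: dd_gen nc_forms_def)

lemma basic_closed [simp]:
  assumes "a \<in> carrier A" "as \<in> lists (carrier A)"
  shows "basic_form K A a as \<in> carrier Om"
proof -
  have "map (exact_one_form K A) as \<in> lists (carrier M)" using assms(2) by (induction as) auto
  then show ?thesis unfolding basic_form_def nc_forms_def using assms(1) by (intro \<Omega>.class_closed) simp
qed

lemma zero_form_hom: "\<iota> \<in> ring_hom A Om"
  using \<Omega>.scal_hom by (simp add: zero_form_scal[abs_def] nc_forms_def)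

lemmas zero_form_add = ring_hom_add[OF zero_form_hom]
  and zero_form_mult = ring_hom_mult[OF zero_form_hom]
  and zero_form_zero = ring_hom_zero[OF zero_form_hom A.ring_axioms nc_forms_ring]
  and zero_form_one = ring_hom_one[OF zero_form_hom]
  and zero_form_minus = ring_hom_minus[OF A.ring_axioms nc_forms_ring zero_form_hom]

lemma dd_add: "\<lbrakk>a \<in> carrier A; b \<in> carrier A\<rbrakk> \<Longrightarrow> dd (a \<oplus>\<^bsub>A\<^esub> b) = dd a \<oplus>\<^bsub>Om\<^esub> dd b"
  by (simp add: dd_gen exact_add \<Omega>.gen_badd nc_forms_def)

lemma dd_mult: "\<lbrakk>a \<in> carrier A; b \<in> carrier A\<rbrakk>
    \<Longrightarrow> dd (a \<otimes>\<^bsub>A\<^esub> b) = \<iota> a \<bullet> dd b \<oplus>\<^bsub>Om\<^esub> dd a \<bullet> \<iota> b"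
  by (simp add: dd_gen exact_mult zero_form_scal \<Omega>.gen_badd \<Omega>.gen_lact \<Omega>.gen_ract
      \<Omega>.lact_closed \<Omega>.ract_closed nc_forms_def)

lemma gen_zero: "\<Omega>.gen (tc 0) = \<zero>\<^bsub>Om\<^esub>"
proof -
  have m: "tc 0 \<in> carrier M" by simp
  have "\<Omega>.gen (tc 0) \<oplus>\<^bsub>Om\<^esub> \<Omega>.gen (tc 0) = \<Omega>.gen (tc 0)"
    using \<Omega>.gen_badd[OF m m] by (simp add: badd_class nc_forms_def)
  moreover have "\<Omega>.gen (tc 0) \<in> carrier Om" using m by (simp add: nc_forms_def)
  ultimately show ?thesis by (simp add: F.add.l_cancel_one')
qed

lemma dd_scalar: "c \<in> carrier K \<Longrightarrow> dd (c \<odot>\<^bsub>A\<^esub> \<one>\<^bsub>A\<^esub>) = \<zero>\<^bsub>Om\<^esub>"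
  by (simp add: dd_gen exact_scalar gen_zero)

lemma dd_one: "dd \<one>\<^bsub>A\<^esub> = \<zero>\<^bsub>Om\<^esub>"
  using dd_scalar[of "\<one>\<^bsub>K\<^esub>"] by simp

lemma basic_Cons:
  assumes "a \<in> carrier A" "b \<in> carrier A" "as \<in> lists (carrier A)"
  shows "basic_form K A a (b # as) = \<iota> a \<bullet> (dd b \<bullet> exact_prod as)"
proof -
  have m: "map (exact_one_form K A) as \<in> lists (carrier M)" using assms(3) by (induction as) auto
  let ?v = "foldr (\<lambda>m. (\<bullet>) (\<Omega>.gen m)) (map (exact_one_form K A) as) \<one>\<^bsub>Om\<^esub>"
  have 1: "exact_prod as = \<one>\<^bsub>Om\<^esub> \<bullet> ?v"
    using \<Omega>.class_word_prod[OF A.one_closed m]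
    by (simp add: basic_form_def nc_forms_def[symmetric] zero_form_one[unfolded zero_form_scal])
  have "?v \<in> carrier Om" using m unfolding nc_forms_def
    by (induction as) (auto intro: ring.ring_simprules(5,6)[OF \<Omega>.tensor_algebra_ring])
  with 1 have "exact_prod as = ?v" by simp
  moreover have "basic_form K A a (b # as) = \<iota> a \<bullet> (dd b \<bullet> ?v)"
    using \<Omega>.class_word_prod[OF assms(1), of "map (exact_one_form K A) (b # as)"] m assms
    by (simp add: basic_form_def[of K A a "b # as"] nc_forms_def[symmetric] zero_form_scal dd_gen)
  ultimately show ?thesis by simp
qed

lemma basic_unit_Cons:
  assumes "b \<in> carrier A" "as \<in> lists (carrier A)"
  shows "exact_prod (b # as) = dd b \<bullet> exact_prod as"
  using assms by (simp add: basic_Cons zero_form_one)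

lemma basic_mult:
  assumes "a \<in> carrier A" "as \<in> lists (carrier A)"
  shows "basic_form K A a as = \<iota> a \<bullet> exact_prod as"
  using assms by (cases as) (auto simp: basic_Cons basic_unit_Cons zero_form_one)

lemma basic_snoc:
  assumes "a \<in> carrier A" "b \<in> carrier A" "as \<in> lists (carrier A)"
  shows "basic_form K A a (as @ [b]) = basic_form K A a as \<bullet> dd b"
proof -
  have "exact_prod (as @ [b]) = exact_prod as \<bullet> dd b"
    using assms(3) by (induction as) (use assms in \<open>auto simp: basic_unit_Cons zero_form_one F.m_assoc\<close>)
  then show ?thesis
    using assms basic_mult[of a "as @ [b]"] basic_mult[of a as] by (simp add: F.m_assoc)
qed

text \<open>The additive span of the forms \<open>a\<^sub>0 da\<^sub>1 \<dots> da\<^sub>n\<close>; it turns out to be the space of all forms of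
  degree \<open>n\<close> (\<open>deg_eq_bspan\<close>).\<close>

definition bspan :: "nat \<Rightarrow> 'c form set" where
  "bspan n = F.aspan {basic_form K A a as | a as. a \<in> carrier A \<and> as \<in> lists (carrier A) \<and> length as = n}"

lemma basics_carrier:
  "{basic_form K A a as | a as. a \<in> carrier A \<and> as \<in> lists (carrier A) \<and> length as = n} \<subseteq> carrier Om"
  by (blast intro: basic_closed)

lemmas bspan_incl = F.aspan_incl[OF basics_carrier, folded bspan_def]
  and bspan_minus = F.aspan_minus[OF basics_carrier, folded bspan_def]
  and bspan_diff = F.aspan_diff[OF basics_carrier, folded bspan_def]

lemma bspan_zero: "\<zero>\<^bsub>Om\<^esub> \<in> bspan n"
  by (simp add: bspan_def F.aspan_zero)

lemma bspan_add: "\<lbrakk>x \<in> bspan n; y \<in> bspan n\<rbrakk> \<Longrightarrow> x \<oplus>\<^bsub>Om\<^esub> y \<in> bspan n"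
  by (simp add: bspan_def F.aspan_add)

lemma bspan_basic: "\<lbrakk>a \<in> carrier A; as \<in> lists (carrier A)\<rbrakk> \<Longrightarrow> basic_form K A a as \<in> bspan (length as)"
  unfolding bspan_def by (rule generate.incl) blast

lemma bspan_induct [consumes 1, case_names zero basic add minus]:
  assumes "x \<in> bspan n" "P \<zero>\<^bsub>Om\<^esub>"
    and "\<And>a as. \<lbrakk>a \<in> carrier A; as \<in> lists (carrier A); length as = n\<rbrakk> \<Longrightarrow> P (basic_form K A a as)"
    and "\<And>x y. \<lbrakk>x \<in> carrier Om; y \<in> carrier Om; P x; P y\<rbrakk> \<Longrightarrow> P (x \<oplus>\<^bsub>Om\<^esub> y)"
    and "\<And>x. \<lbrakk>x \<in> carrier Om; P x\<rbrakk> \<Longrightarrow> P (\<ominus>\<^bsub>Om\<^esub> x)"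
  shows "P x"
  using assms(1)[unfolded bspan_def] basics_carrier
  by (induction rule: F.aspan_induct) (use assms in auto)

lemma bspan_mult_dd:
  assumes x: "x \<in> bspan n" and b: "b \<in> carrier A"
  shows "x \<bullet> dd b \<in> bspan (Suc n)"
  using x
proof (induction rule: bspan_induct)
  case (basic a as)
  then show ?case using bspan_basic[of a "as @ [b]"] b by (simp add: basic_snoc)
qed (use b in \<open>auto simp: bspan_zero F.l_distr F.l_minus bspan_add bspan_minus\<close>)

text \<open>By the Leibniz rule \<open>(dc) b = d(cb) - c db\<close>, applied from the right end of the form.\<close>

lemma bspan_mult_zero_form:
  assumes x: "x \<in> bspan n" and b: "b \<in> carrier A"
  shows "x \<bullet> \<iota> b \<in> bspan n"
proof -
  have "basic_form K A a as \<bullet> \<iota> b \<in> bspan (length as)"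
    if "as \<in> lists (carrier A)" "b \<in> carrier A" "a \<in> carrier A" for a as b
    using that
  proof (induction as arbitrary: b rule: rev_induct)
    case Nil
    then show ?case using bspan_basic[of "a \<otimes>\<^bsub>A\<^esub> b" "[]"] by (simp add: zero_form_mult)
  next
    case (snoc c as)
    have "dd c \<bullet> \<iota> b = dd (c \<otimes>\<^bsub>A\<^esub> b) \<ominus>\<^bsub>Om\<^esub> \<iota> c \<bullet> dd b"
      using snoc.prems by (simp add: dd_mult a_minus_def F.a_ac F.r_neg)
    then have "basic_form K A a (as @ [c]) \<bullet> \<iota> b =
      basic_form K A a as \<bullet> dd (c \<otimes>\<^bsub>A\<^esub> b)
        \<ominus>\<^bsub>Om\<^esub> basic_form K A a as \<bullet> \<iota> c \<bullet> dd b"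
      using snoc.prems by (simp add: basic_snoc F.m_assoc a_minus_def F.r_distr F.r_minus)
    then show ?case
      using snoc bspan_mult_dd[OF bspan_basic] bspan_mult_dd[OF snoc.IH]
      by (simp add: bspan_diff)
  qed
  with b have bas: "basic_form K A a as \<bullet> \<iota> b \<in> bspan n"
    if "as \<in> lists (carrier A)" "a \<in> carrier A" "length as = n" for a as
    using that by blast
  from x show ?thesis
    by (induction rule: bspan_induct)
       (use b bas in \<open>auto simp: bspan_zero F.l_distr F.l_minus bspan_add bspan_minus\<close>)
qed

text \<open>Since \<open>x dy = xy \<otimes> 1 - x \<otimes> y\<close>, the element \<open>\<Sum> x\<^sub>i \<otimes> y\<^sub>i\<close> with \<open>\<Sum> x\<^sub>i y\<^sub>i = 0\<close> is
  \<open>- \<Sum> x\<^sub>i dy\<^sub>i\<close>. The map \<open>split_frag\<close> sends the generator \<open>x \<otimes> y\<close> to a representative of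
  \<open>x dy\<close>.\<close>

definition split_frag :: "('c \<times> 'c \<Rightarrow>\<^sub>0 int) \<Rightarrow> ('c \<times> 'c \<Rightarrow>\<^sub>0 int)" where
  "split_frag = frag_extend (\<lambda>(x, y). frag_of (x \<otimes>\<^bsub>A\<^esub> y, \<one>\<^bsub>A\<^esub>) - frag_of (x, y))"

lemma split_frag_simps [simp]:
  "split_frag 0 = 0" "split_frag (r - s) = split_frag r - split_frag s"
  "split_frag (frag_of (x, y)) = frag_of (x \<otimes>\<^bsub>A\<^esub> y, \<one>\<^bsub>A\<^esub>) - frag_of (x, y)"
  by (simp_all add: split_frag_def frag_extend_diff)

lemma tensor_null_left_diff:
  assumes "a \<in> carrier A" "b \<in> carrier A"
  shows "frag_of (a \<ominus>\<^bsub>A\<^esub> b, \<one>\<^bsub>A\<^esub>) - (frag_of (a, \<one>\<^bsub>A\<^esub>) - frag_of (b, \<one>\<^bsub>A\<^esub>)) \<in> Nt"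
proof -
  have "(a \<ominus>\<^bsub>A\<^esub> b) \<oplus>\<^bsub>A\<^esub> b = a" using assms by (simp add: a_minus_def M.a_assoc M.l_neg)
  then show ?thesis
    using tensor_null_minus[OF tensor_relation_left[of "a \<ominus>\<^bsub>A\<^esub> b" b "\<one>\<^bsub>A\<^esub>"]] assms
    by (simp add: algebra_simps)
qed

text \<open>Modulo the tensor relations, \<open>split_frag r = mult_frag r \<otimes> 1 - r\<close>.\<close>

lemma split_frag_null:
  assumes r: "Poly_Mapping.keys r \<subseteq> S2"
  shows "split_frag r + r - frag_of (mult_frag r, \<one>\<^bsub>A\<^esub>) \<in> Nt"
  using r
proof (induction r rule: free_induct)
  case zero
  show ?case using tensor_null_minus[OF tensor_null_left_diff[of "\<zero>\<^bsub>A\<^esub>" "\<zero>\<^bsub>A\<^esub>"]]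
    by (simp add: M.minus_self)
next
  case (diff x y)
  from tensor_null_diff[OF tensor_null_diff[OF diff.IH] tensor_null_left_diff[OF mult_frag_closed mult_frag_closed],
      OF diff.hyps]
  show ?case using diff.hyps by (simp add: mult_frag_diff algebra_simps)
next
  case (of u)
  then show ?case by (cases u) (simp add: tensor_null_zero)
qed

lemma split_frag_span:
  assumes r: "Poly_Mapping.keys r \<subseteq> S2"
  shows "Poly_Mapping.keys (split_frag r) \<subseteq> S2 \<and> mult_frag (split_frag r) = \<zero>\<^bsub>A\<^esub> \<and> \<Omega>.gen (tc (split_frag r)) \<in> bspan 1"
  using r
proof (induction r rule: free_induct)
  case zero
  show ?case by (simp add: gen_zero bspan_zero)
next
  case (diff x y)
  then have k: "Poly_Mapping.keys (split_frag x - split_frag y) \<subseteq> S2" by (simp add: keys_diff_subset)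
  with diff have m: "mult_frag (split_frag x - split_frag y) = \<zero>\<^bsub>A\<^esub>" by (simp add: mult_frag_diff M.minus_self)
  have c: "\<Omega>.gen (tc r) \<in> carrier Om" if "Poly_Mapping.keys r \<subseteq> S2" "mult_frag r = \<zero>\<^bsub>A\<^esub>" for r
    using that by (simp add: nc_forms_def)
  have "\<Omega>.gen (tc (split_frag x - split_frag y)) \<oplus>\<^bsub>Om\<^esub> \<Omega>.gen (tc (split_frag y)) = \<Omega>.gen (tc (split_frag x))"
    using \<Omega>.gen_badd[of "tc (split_frag x - split_frag y)" "tc (split_frag y)"] diff k m
    by (simp add: badd_class nc_forms_def)
  then have "\<Omega>.gen (tc (split_frag x - split_frag y)) = \<Omega>.gen (tc (split_frag x)) \<ominus>\<^bsub>Om\<^esub> \<Omega>.gen (tc (split_frag y))"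
    using c[OF k m] c[of "split_frag y"] c[of "split_frag x"] diff
    by (simp add: F.minus_eq F.add.inv_solve_right)
  then show ?case using diff k m by (simp add: bspan_diff)
next
  case (of u)
  then obtain x y where u: "u = (x, y)" "x \<in> carrier A" "y \<in> carrier A" by (cases u) auto
  have "lact M x (exact_one_form K A y) = tc (frag_of (x \<otimes>\<^bsub>A\<^esub> y, \<one>\<^bsub>A\<^esub>) - frag_of (x, y))"
    using u by (simp add: exact_class lact_class)
  moreover have "\<Omega>.gen (lact M x (exact_one_form K A y)) = basic_form K A x [y]"
    using u by (simp add: \<Omega>.gen_lact zero_form_scal[symmetric] dd_gen[symmetric] dd_def nc_forms_def[symmetric]
        basic_mult[of x "[y]"])
  ultimately show ?case
    using u bspan_basic[of x "[y]"] by (simp add: mult_frag_diff keys_diff_subset M.minus_self)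
qed

lemma gen_span:
  assumes "m \<in> carrier M"
  shows "\<Omega>.gen m \<in> bspan 1"
proof -
  obtain r where r: "Poly_Mapping.keys r \<subseteq> S2" "mult_frag r = \<zero>\<^bsub>A\<^esub>" "m = tc r"
    using assms by (rule M_cases)
  have "mult_frag (- r) = \<zero>\<^bsub>A\<^esub>" using mult_frag_diff[of 0 r] r by (simp add: M.minus_self)
  moreover have "frag_of (\<zero>\<^bsub>A\<^esub>, \<one>\<^bsub>A\<^esub>) \<in> Nt"
    using tensor_null_minus[OF tensor_null_left_diff[of "\<zero>\<^bsub>A\<^esub>" "\<zero>\<^bsub>A\<^esub>"]] tensor_null_left_diff[of "\<zero>\<^bsub>A\<^esub>" "\<zero>\<^bsub>A\<^esub>"]
    by (simp add: M.minus_self)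
  ultimately have "split_frag (- r) - r \<in> Nt"
    using tensor_null_add[OF split_frag_null[of "- r"]] r by (fastforce simp: algebra_simps)
  then have "tc r = tc (split_frag (- r))" by (metis tensor_class_eq_iff)
  then show ?thesis using split_frag_span[of "- r"] r by simp
qed

lemma word_span:
  assumes "ms \<in> lists (carrier M)" "a \<in> carrier A"
  shows "\<Omega>.cl (frag_of (a, ms)) \<in> bspan (length ms)"
  using assms
proof (induction ms rule: rev_induct)
  case Nil
  then show ?case using bspan_basic[of a "[]"] by (simp add: basic_form_def)
next
  case (snoc m ms)
  then have IH: "\<Omega>.cl (frag_of (a, ms)) \<in> bspan (length ms)" by simp
  have "x \<bullet> g \<in> bspan (Suc n)" if x: "x \<in> bspan n" and g: "g \<in> bspan 1" for x g n
    using g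
  proof (induction rule: bspan_induct)
    case (basic a as)
    then obtain b where b: "as = [b]" "b \<in> carrier A" by (cases as) auto
    have "x \<bullet> basic_form K A a as = (x \<bullet> \<iota> a) \<bullet> dd b"
      using b basic bspan_incl[OF x] by (simp add: basic_mult[of a "[b]"] F.m_assoc flip: dd_def)
    then show ?case using bspan_mult_dd[OF bspan_mult_zero_form[OF x]] b basic by simp
  qed (use bspan_incl[OF x] in \<open>auto simp: bspan_zero F.r_distr F.r_minus bspan_add bspan_minus\<close>)
  from this[OF IH gen_span[of m]] snoc.prems
  have "\<Omega>.cl (frag_of (a, ms)) \<bullet> \<Omega>.gen m \<in> bspan (length (ms @ [m]))" by simp
  moreover have "\<Omega>.cl (frag_of (a, ms)) \<bullet> \<Omega>.gen m = \<Omega>.cl (frag_of (a, ms @ [m]))"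
    using snoc.prems
    by (cases ms rule: rev_cases)
       (auto simp: nc_forms_def \<Omega>.gen_def \<Omega>.class_mult \<Omega>.bil_of \<Omega>.ract_one)
  ultimately show ?case by simp
qed

lemma deg_eq_bspan: "nc_forms_deg K A n = bspan n"
proof
  have words: "{(a, ms). (a, ms) \<in> \<Omega>.W \<and> length ms = n} \<subseteq> \<Omega>.W" by auto
  have deg: "nc_forms_deg K A n = \<Omega>.cl ` {r. Poly_Mapping.keys r \<subseteq> {(a, ms) \<in> \<Omega>.W. length ms = n}}"
    by (auto simp: nc_forms_deg_def tensor_power_def free_Abelian_group_def)
  show "nc_forms_deg K A n \<subseteq> bspan n"
  proof
    fix x assume "x \<in> nc_forms_deg K A n"
    then obtain r where r: "Poly_Mapping.keys r \<subseteq> {(a, ms) \<in> \<Omega>.W. length ms = n}" "x = \<Omega>.cl r"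
      unfolding deg by auto
    from r(1) have "\<Omega>.cl r \<in> bspan n"
    proof (induction r rule: free_induct)
      case zero
      show ?case using bspan_zero by (simp add: nc_forms_def \<Omega>.T_zero)
    next
      case (diff x y)
      then have "\<Omega>.cl (x - y) = \<Omega>.cl x \<ominus>\<^bsub>Om\<^esub> \<Omega>.cl y"
        unfolding nc_forms_def using words by (intro \<Omega>.class_diff[symmetric]) blast+
      then show ?case using diff by (simp add: bspan_diff)
    next
      case (of u)
      then show ?case using word_span by auto
    qed
    then show "x \<in> bspan n" using r by simp
  qed
  show "bspan n \<subseteq> nc_forms_deg K A n"
  proof
    fix x assume "x \<in> bspan n"
    then show "x \<in> nc_forms_deg K A n"
    proof (induction rule: bspan_induct)
      case zero
      show ?case unfolding deg by (intro image_eqI[of _ _ 0]) (auto simp: nc_forms_def \<Omega>.T_zero)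
    next
      case (basic a as)
      have "map (exact_one_form K A) as \<in> lists (carrier M)" using basic(2) by (induction as) auto
      then show ?case unfolding deg basic_form_def using basic by (intro imageI) auto
    next
      case (add x y)
      then obtain r s where rs: "Poly_Mapping.keys r \<subseteq> {(a, ms) \<in> \<Omega>.W. length ms = n}" "x = \<Omega>.cl r"
        "Poly_Mapping.keys s \<subseteq> {(a, ms) \<in> \<Omega>.W. length ms = n}" "y = \<Omega>.cl s"
        unfolding deg by auto
      then show ?case unfolding deg using keys_add_subset[OF rs(1,3)]
        by (intro image_eqI[of _ _ "r + s"]) (auto simp: nc_forms_def \<Omega>.class_add)
    next
      case (minus x)
      then obtain r where r: "Poly_Mapping.keys r \<subseteq> {(a, ms) \<in> \<Omega>.W. length ms = n}" "x = \<Omega>.cl r"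
        unfolding deg by auto
      have "\<ominus>\<^bsub>Om\<^esub> \<Omega>.cl r = \<Omega>.cl (- r)"
        unfolding nc_forms_def using r(1) words by (intro \<Omega>.class_minus) blast
      then show ?case unfolding deg using r
        by (intro image_eqI[of _ _ "- r"]) auto
    qed
  qed
qed

lemma forms_induct [consumes 1, case_names basic add minus]:
  assumes x: "x \<in> carrier Om"
    and basic: "\<And>a as. \<lbrakk>a \<in> carrier A; as \<in> lists (carrier A)\<rbrakk> \<Longrightarrow> P (basic_form K A a as)"
    and add: "\<And>x y. \<lbrakk>x \<in> carrier Om; y \<in> carrier Om; P x; P y\<rbrakk> \<Longrightarrow> P (x \<oplus>\<^bsub>Om\<^esub> y)"
    and minus: "\<And>x. \<lbrakk>x \<in> carrier Om; P x\<rbrakk> \<Longrightarrow> P (\<ominus>\<^bsub>Om\<^esub> x)"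
  shows "P x"
proof -
  have 0: "P \<zero>\<^bsub>Om\<^esub>" using basic[of "\<zero>\<^bsub>A\<^esub>" "[]"] by (simp add: zero_form_zero)
  from x[unfolded nc_forms_def] have "x \<in> carrier Om \<and> P x"
  proof (induction rule: \<Omega>.T_induct)
    case zero then show ?case using 0 by (simp add: nc_forms_def[symmetric])
  next
    case (diff x y)
    then show ?case using add minus by (simp add: nc_forms_def[symmetric] F.minus_eq)
  next
    case (word a ms)
    from word_span[OF word(2,1)] show ?case
      using bspan_incl[OF word_span[OF word(2,1)]]
      by (induction rule: bspan_induct) (use 0 basic add minus in auto)
  qed
  then show ?thesis ..
qed

text \<open>Forms are the universal ring under \<open>A\<close> with a derivation from \<open>A\<close> that kills the scalars.\<close>

lemma forms_lift:
  fixes B :: "('z, 'w) ring_scheme"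
  assumes B: "ring B" and \<phi>: "\<phi> \<in> ring_hom A B" and \<delta>: "\<delta> \<in> carrier A \<rightarrow> carrier B"
    and \<delta>_add: "\<And>a b. \<lbrakk>a \<in> carrier A; b \<in> carrier A\<rbrakk> \<Longrightarrow> \<delta> (a \<oplus>\<^bsub>A\<^esub> b) = \<delta> a \<oplus>\<^bsub>B\<^esub> \<delta> b"
    and \<delta>_mult: "\<And>a b. \<lbrakk>a \<in> carrier A; b \<in> carrier A\<rbrakk>
      \<Longrightarrow> \<delta> (a \<otimes>\<^bsub>A\<^esub> b) = \<phi> a \<otimes>\<^bsub>B\<^esub> \<delta> b \<oplus>\<^bsub>B\<^esub> \<delta> a \<otimes>\<^bsub>B\<^esub> \<phi> b"
    and \<delta>_scalar: "\<And>c. c \<in> carrier K \<Longrightarrow> \<delta> (c \<odot>\<^bsub>A\<^esub> \<one>\<^bsub>A\<^esub>) = \<zero>\<^bsub>B\<^esub>"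
  obtains h where "h \<in> ring_hom Om B" "\<And>a. a \<in> carrier A \<Longrightarrow> h (\<iota> a) = \<phi> a"
    "\<And>a. a \<in> carrier A \<Longrightarrow> h (dd a) = \<delta> a"
proof -
  obtain \<mu> where \<mu>: "\<mu> \<in> carrier M \<rightarrow> carrier B"
    "\<And>m m'. \<lbrakk>m \<in> carrier M; m' \<in> carrier M\<rbrakk> \<Longrightarrow> \<mu> (badd M m m') = \<mu> m \<oplus>\<^bsub>B\<^esub> \<mu> m'"
    "\<And>a m. \<lbrakk>a \<in> carrier A; m \<in> carrier M\<rbrakk> \<Longrightarrow> \<mu> (lact M a m) = \<phi> a \<otimes>\<^bsub>B\<^esub> \<mu> m"
    "\<And>a m. \<lbrakk>a \<in> carrier A; m \<in> carrier M\<rbrakk> \<Longrightarrow> \<mu> (ract M m a) = \<mu> m \<otimes>\<^bsub>B\<^esub> \<phi> a"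
    "\<And>a. a \<in> carrier A \<Longrightarrow> \<mu> (exact_one_form K A a) = \<delta> a"
    by (rule one_forms_lift[OF B \<phi> \<delta> \<delta>_add \<delta>_mult \<delta>_scalar]; (assumption | rule that))
  obtain h where "h \<in> ring_hom \<Omega>.T B" "\<And>a. a \<in> carrier A \<Longrightarrow> h (\<Omega>.scal a) = \<phi> a"
    "\<And>m. m \<in> carrier M \<Longrightarrow> h (\<Omega>.gen m) = \<mu> m"
    by (rule \<Omega>.tensor_algebra_lift[OF B \<phi> \<mu>(1-4)]; (assumption | rule that))
  then show thesis
    using \<mu>(5) by (intro that[of h]) (auto simp: nc_forms_def zero_form_scal dd_gen)
qed

end

section \<open>Super-derivations of forms\<close>

context assoc_algebra begin

text \<open>Additive maps of forms, without a condition outside the carrier; the maps \<open>d\<close> and \<open>i\<^bsub>\<theta>\<^esub>\<close>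
  are moreover extensional.\<close>

definition additive :: "('c form \<Rightarrow> 'c form) \<Rightarrow> bool" where
  "additive D \<longleftrightarrow> D \<in> carrier Om \<rightarrow> carrier Om \<and>
     (\<forall>x\<in>carrier Om. \<forall>y\<in>carrier Om. D (x \<oplus>\<^bsub>Om\<^esub> y) = D x \<oplus>\<^bsub>Om\<^esub> D y)"

lemma additive_closed: "\<lbrakk>additive D; x \<in> carrier Om\<rbrakk> \<Longrightarrow> D x \<in> carrier Om"
  and additive_add: "\<lbrakk>additive D; x \<in> carrier Om; y \<in> carrier Om\<rbrakk> \<Longrightarrow> D (x \<oplus>\<^bsub>Om\<^esub> y) = D x \<oplus>\<^bsub>Om\<^esub> D y"
  by (auto simp: additive_def)

lemma additive_zero: assumes D: "additive D" shows "D \<zero>\<^bsub>Om\<^esub> = \<zero>\<^bsub>Om\<^esub>"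
proof -
  have "D \<zero>\<^bsub>Om\<^esub> \<oplus>\<^bsub>Om\<^esub> D \<zero>\<^bsub>Om\<^esub> = D \<zero>\<^bsub>Om\<^esub>"
    using additive_add[OF D, of "\<zero>\<^bsub>Om\<^esub>" "\<zero>\<^bsub>Om\<^esub>"] by simp
  then show ?thesis using additive_closed[OF D] by (simp add: F.add.l_cancel_one')
qed

lemma additive_minus:
  assumes D: "additive D" and x: "x \<in> carrier Om"
  shows "D (\<ominus>\<^bsub>Om\<^esub> x) = \<ominus>\<^bsub>Om\<^esub> D x"
proof -
  have "D (\<ominus>\<^bsub>Om\<^esub> x) \<oplus>\<^bsub>Om\<^esub> D x = \<zero>\<^bsub>Om\<^esub>"
    using additive_add[OF D, of "\<ominus>\<^bsub>Om\<^esub> x" x] x additive_zero[OF D] by (simp add: F.l_neg)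
  then show ?thesis using additive_closed[OF D] x by (simp add: F.minus_equality)
qed

lemma additive_diff:
  "\<lbrakk>additive D; x \<in> carrier Om; y \<in> carrier Om\<rbrakk> \<Longrightarrow> D (x \<ominus>\<^bsub>Om\<^esub> y) = D x \<ominus>\<^bsub>Om\<^esub> D y"
  by (simp add: a_minus_def additive_add additive_minus)

lemma additive_maps_iff: "D \<in> additive_maps Om \<longleftrightarrow> additive D \<and> D \<in> extensional (carrier Om)"
  by (auto simp: additive_maps_def additive_def hom_def)

lemma additive_restrict: "additive D \<Longrightarrow> additive (restrict D (carrier Om))"
  by (auto simp: additive_def Pi_iff)

lemma additive_eqI:
  assumes "additive D" "additive E"
    and "\<And>a as. \<lbrakk>a \<in> carrier A; as \<in> lists (carrier A)\<rbrakk> \<Longrightarrow>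
      D (\<iota> a \<bullet> exact_prod as) = E (\<iota> a \<bullet> exact_prod as)"
    and "x \<in> carrier Om"
  shows "D x = E x"
  using assms(4)
proof (induction rule: forms_induct)
  case (basic a as)
  then show ?case using assms(3) basic_mult[of a as] by simp
qed (simp_all add: additive_add[OF assms(1)] additive_add[OF assms(2)]
        additive_minus[OF assms(1)] additive_minus[OF assms(2)])

text \<open>Induction along multiplication by \<open>a\<close> and \<open>da\<close> from the left.\<close>

lemma additive_eq_zeroI:
  assumes T: "additive T" and one: "T \<one>\<^bsub>Om\<^esub> = \<zero>\<^bsub>Om\<^esub>"
    and z: "\<And>a x. \<lbrakk>a \<in> carrier A; x \<in> carrier Om; T x = \<zero>\<^bsub>Om\<^esub>\<rbrakk> \<Longrightarrow> T (\<iota> a \<bullet> x) = \<zero>\<^bsub>Om\<^esub>"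
    and d: "\<And>a x. \<lbrakk>a \<in> carrier A; x \<in> carrier Om; T x = \<zero>\<^bsub>Om\<^esub>\<rbrakk> \<Longrightarrow> T (dd a \<bullet> x) = \<zero>\<^bsub>Om\<^esub>"
    and x: "x \<in> carrier Om"
  shows "T x = \<zero>\<^bsub>Om\<^esub>"
proof -
  have 1: "T (exact_prod as) = \<zero>\<^bsub>Om\<^esub>" if "as \<in> lists (carrier A)" for as
    using that by (induction as) (auto simp: zero_form_one one basic_unit_Cons d)
  have 2: "additive (\<lambda>_. \<zero>\<^bsub>Om\<^esub>)" by (simp add: additive_def)
  show ?thesis
    by (rule additive_eqI[OF T 2 _ x]) (simp add: z 1)
qed

text \<open>The sign \<open>(-1)\<^bsup>n\<^esup>\<close> acting on forms.\<close>

definition sg :: "nat \<Rightarrow> 'c form \<Rightarrow> 'c form" where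
  "sg n x = (if even n then x else \<ominus>\<^bsub>Om\<^esub> x)"

lemma add_pow_sign:
  assumes "x \<in> carrier Om"
  shows "add_pow Om ((-1::int) ^ n) x = sg n x"
  using F.add.int_pow_neg[OF assms, of 1] F.add.int_pow_1[OF assms]
  by (cases "even n") (simp_all add: sg_def)

lemma sg_closed [simp]: "x \<in> carrier Om \<Longrightarrow> sg n x \<in> carrier Om"
  by (simp add: sg_def)

text \<open>A super-derivation of odd degree is the corner of a homomorphism from forms to upper
  triangular matrices. It can be prescribed by its values \<open>\<epsilon>\<close> on functions and \<open>\<eta>\<close> on exact
  one-forms, subject to additivity, to the two Leibniz rules, and to the vanishing of \<open>\<epsilon>\<close> at one and
  of \<open>\<eta>\<close> on scalars.\<close>

lemma superderivation_exists:
  assumes \<epsilon>: "\<And>a. a \<in> carrier A \<Longrightarrow> \<epsilon> a \<in> carrier Om"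
    and \<epsilon>_add: "\<And>a b. \<lbrakk>a \<in> carrier A; b \<in> carrier A\<rbrakk> \<Longrightarrow> \<epsilon> (a \<oplus>\<^bsub>A\<^esub> b) = \<epsilon> a \<oplus>\<^bsub>Om\<^esub> \<epsilon> b"
    and \<epsilon>_mult: "\<And>a b. \<lbrakk>a \<in> carrier A; b \<in> carrier A\<rbrakk> \<Longrightarrow>
      \<epsilon> (a \<otimes>\<^bsub>A\<^esub> b) = \<iota> a \<bullet> \<epsilon> b \<oplus>\<^bsub>Om\<^esub> \<epsilon> a \<bullet> \<iota> b"
    and \<epsilon>_one: "\<epsilon> \<one>\<^bsub>A\<^esub> = \<zero>\<^bsub>Om\<^esub>"
    and \<eta>: "\<And>a. a \<in> carrier A \<Longrightarrow> \<eta> a \<in> carrier Om"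
    and \<eta>_add: "\<And>a b. \<lbrakk>a \<in> carrier A; b \<in> carrier A\<rbrakk> \<Longrightarrow> \<eta> (a \<oplus>\<^bsub>A\<^esub> b) = \<eta> a \<oplus>\<^bsub>Om\<^esub> \<eta> b"
    and \<eta>_mult: "\<And>a b. \<lbrakk>a \<in> carrier A; b \<in> carrier A\<rbrakk> \<Longrightarrow>
      \<eta> (a \<otimes>\<^bsub>A\<^esub> b) = (\<iota> a \<bullet> \<eta> b \<oplus>\<^bsub>Om\<^esub> \<epsilon> a \<bullet> dd b)
        \<oplus>\<^bsub>Om\<^esub> (\<ominus>\<^bsub>Om\<^esub> dd a \<bullet> \<epsilon> b \<oplus>\<^bsub>Om\<^esub> \<eta> a \<bullet> \<iota> b)"
    and \<eta>_scalar: "\<And>c. c \<in> carrier K \<Longrightarrow> \<eta> (c \<odot>\<^bsub>A\<^esub> \<one>\<^bsub>A\<^esub>) = \<zero>\<^bsub>Om\<^esub>"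
  obtains D where "additive D"
    "\<And>a. a \<in> carrier A \<Longrightarrow> D (\<iota> a) = \<epsilon> a"
    "\<And>a. a \<in> carrier A \<Longrightarrow> D (dd a) = \<eta> a"
    "\<And>p x y. \<lbrakk>x \<in> bspan p; y \<in> carrier Om\<rbrakk> \<Longrightarrow> D (x \<bullet> y) = D x \<bullet> y \<oplus>\<^bsub>Om\<^esub> sg p (x \<bullet> D y)"
proof -
  let ?U = "upper_triangular Om"
  have U: "ring ?U" by (rule F.upper_triangular_ring)
  define \<phi> where "\<phi> = (\<lambda>a. (\<iota> a, \<epsilon> a, \<iota> a))"
  define \<delta> where "\<delta> = (\<lambda>a. (\<ominus>\<^bsub>Om\<^esub> dd a, \<eta> a, dd a))"
  have \<phi>: "\<phi> \<in> ring_hom A ?U"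
    by (rule ring_hom_memI)
       (auto simp: \<phi>_def upper_triangular_def \<epsilon> \<epsilon>_add \<epsilon>_mult \<epsilon>_one zero_form_add zero_form_mult zero_form_one)
  have \<delta>: "\<delta> \<in> carrier A \<rightarrow> carrier ?U" by (auto simp: \<delta>_def upper_triangular_def \<eta>)
  have \<delta>_add: "\<delta> (a \<oplus>\<^bsub>A\<^esub> b) = \<delta> a \<oplus>\<^bsub>?U\<^esub> \<delta> b" if "a \<in> carrier A" "b \<in> carrier A" for a b
    using that by (simp add: \<delta>_def upper_triangular_def \<eta>_add dd_add F.minus_add)
  have \<delta>_mult: "\<delta> (a \<otimes>\<^bsub>A\<^esub> b) = \<phi> a \<otimes>\<^bsub>?U\<^esub> \<delta> b \<oplus>\<^bsub>?U\<^esub> \<delta> a \<otimes>\<^bsub>?U\<^esub> \<phi> b"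
    if "a \<in> carrier A" "b \<in> carrier A" for a b
    using that by (simp add: \<delta>_def \<phi>_def upper_triangular_def \<eta>_mult dd_mult F.minus_add F.l_minus F.r_minus)
  have \<delta>_scalar: "\<delta> (c \<odot>\<^bsub>A\<^esub> \<one>\<^bsub>A\<^esub>) = \<zero>\<^bsub>?U\<^esub>" if "c \<in> carrier K" for c
    using that by (simp add: \<delta>_def upper_triangular_def \<eta>_scalar dd_scalar)
  obtain h where h: "h \<in> ring_hom Om ?U" "\<And>a. a \<in> carrier A \<Longrightarrow> h (\<iota> a) = \<phi> a"
    "\<And>a. a \<in> carrier A \<Longrightarrow> h (dd a) = \<delta> a"
    by (rule forms_lift[OF U \<phi> \<delta> \<delta>_add \<delta>_mult \<delta>_scalar]; (assumption | rule that))
  define s where "s = (\<lambda>x. fst (h x))"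
  define D where "D = (\<lambda>x. fst (snd (h x)))"
  define t where "t = (\<lambda>x. snd (snd (h x)))"
  have hx: "h x = (s x, D x, t x)" for x by (simp add: s_def D_def t_def)
  have cl: "s x \<in> carrier Om" "D x \<in> carrier Om" "t x \<in> carrier Om" if "x \<in> carrier Om" for x
    using ring_hom_closed[OF h(1) that] by (auto simp: hx upper_triangular_def)
  have add: "s (x \<oplus>\<^bsub>Om\<^esub> y) = s x \<oplus>\<^bsub>Om\<^esub> s y" "D (x \<oplus>\<^bsub>Om\<^esub> y) = D x \<oplus>\<^bsub>Om\<^esub> D y"
    "t (x \<oplus>\<^bsub>Om\<^esub> y) = t x \<oplus>\<^bsub>Om\<^esub> t y"
    if "x \<in> carrier Om" "y \<in> carrier Om" for x y
    using ring_hom_add[OF h(1) that] by (auto simp: hx upper_triangular_def)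
  have mult: "s (x \<bullet> y) = s x \<bullet> s y" "t (x \<bullet> y) = t x \<bullet> t y"
    "D (x \<bullet> y) = s x \<bullet> D y \<oplus>\<^bsub>Om\<^esub> D x \<bullet> t y"
    if "x \<in> carrier Om" "y \<in> carrier Om" for x y
    using ring_hom_mult[OF h(1) that] by (auto simp: hx upper_triangular_def)
  have val: "s (\<iota> a) = \<iota> a" "t (\<iota> a) = \<iota> a"
    "D (\<iota> a) = \<epsilon> a" "s (dd a) = \<ominus>\<^bsub>Om\<^esub> dd a" "t (dd a) = dd a" "D (dd a) = \<eta> a"
    if "a \<in> carrier A" for a
    using h(2,3)[OF that] by (auto simp: hx \<phi>_def \<delta>_def)
  have sadd: "additive s" and tadd: "additive t" and Dadd: "additive D"
    using cl add by (auto simp: additive_def)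
  have s1: "s (exact_prod as) = sg (length as) (exact_prod as)"
    and t1: "t (exact_prod as) = exact_prod as" if "as \<in> lists (carrier A)" for as
    using that by (induction as) (auto simp: val mult basic_unit_Cons sg_def F.l_minus F.r_minus)
  have "t x = x" if "x \<in> carrier Om" for x
    by (rule additive_eqI[OF tadd _ _ that]) (auto simp: additive_def mult val t1)
  moreover have "s x = sg p x" if "x \<in> bspan p" for x p
    using that
  proof (induction rule: bspan_induct)
    case (basic a as)
    then show ?case by (simp add: basic_mult[of a as] mult val s1) (simp add: sg_def F.r_minus)
  qed (auto simp: additive_zero[OF sadd] add additive_minus[OF sadd] sg_def F.minus_add)
  ultimately show thesis
    using mult(3) bspan_incl cl
    by (intro that[OF Dadd]) (auto simp: val sg_def F.l_minus F.a_comm)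
qed

lemma zero_form_deg: "a \<in> carrier A \<Longrightarrow> \<iota> a \<in> bspan 0"
  using bspan_basic[of a "[]"] by simp

lemma dd_deg: "a \<in> carrier A \<Longrightarrow> dd a \<in> bspan 1"
  using bspan_basic[of "\<one>\<^bsub>A\<^esub>" "[a]"] by (simp add: dd_def)

lemma zero_form_mult_deg:
  assumes a: "a \<in> carrier A" and x: "x \<in> bspan n"
  shows "\<iota> a \<bullet> x \<in> bspan n"
  using x
proof (induction rule: bspan_induct)
  case (basic b as)
  then have "\<iota> a \<bullet> basic_form K A b as = basic_form K A (a \<otimes>\<^bsub>A\<^esub> b) as"
    using a by (simp add: basic_mult[of b as] basic_mult[of "a \<otimes>\<^bsub>A\<^esub> b" as] zero_form_mult F.m_assoc)
  then show ?case using a basic bspan_basic[of "a \<otimes>\<^bsub>A\<^esub> b" as] by simp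
qed (use a in \<open>auto simp: bspan_zero F.r_distr F.r_minus bspan_add bspan_minus\<close>)

lemma dd_mult_deg:
  assumes a: "a \<in> carrier A" and x: "x \<in> bspan n"
  shows "dd a \<bullet> x \<in> bspan (Suc n)"
  using x
proof (induction rule: bspan_induct)
  case (basic b as)
  have "dd a \<bullet> \<iota> b = dd (a \<otimes>\<^bsub>A\<^esub> b) \<ominus>\<^bsub>Om\<^esub> \<iota> a \<bullet> dd b"
    using a basic by (simp add: dd_mult a_minus_def F.a_ac F.r_neg)
  then have "dd a \<bullet> basic_form K A b as =
      dd (a \<otimes>\<^bsub>A\<^esub> b) \<bullet> exact_prod as
        \<ominus>\<^bsub>Om\<^esub> \<iota> a \<bullet> dd b \<bullet> exact_prod as"
    using a basic
    by (simp add: basic_mult[of b as] F.m_assoc[symmetric] a_minus_def F.l_distr F.l_minus)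
  then have "dd a \<bullet> basic_form K A b as =
      exact_prod ((a \<otimes>\<^bsub>A\<^esub> b) # as) \<ominus>\<^bsub>Om\<^esub> basic_form K A a (b # as)"
    using a basic by (simp add: basic_unit_Cons basic_Cons[of a] F.m_assoc)
  then show ?case
    using a basic bspan_basic[of "\<one>\<^bsub>A\<^esub>" "(a \<otimes>\<^bsub>A\<^esub> b) # as"] bspan_basic[of a "b # as"]
    by (simp add: bspan_diff)
qed (use a in \<open>auto simp: bspan_zero F.r_distr F.r_minus bspan_add bspan_minus\<close>)

subsection \<open>The differential\<close>

abbreviation "d \<equiv> ext_d K A"

lemma ext_d_spec:
  "additive d" "a \<in> carrier A \<Longrightarrow> d (\<iota> a) = dd a"
  "\<lbrakk>a \<in> carrier A; as \<in> lists (carrier A)\<rbrakk> \<Longrightarrow> d (basic_form K A a as) = exact_prod (a # as)"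
  "\<lbrakk>x \<in> bspan p; y \<in> carrier Om\<rbrakk> \<Longrightarrow> d (x \<bullet> y) = d x \<bullet> y \<oplus>\<^bsub>Om\<^esub> sg p (x \<bullet> d y)"
proof -
  obtain D where D: "additive D"
    "\<And>a. a \<in> carrier A \<Longrightarrow> D (\<iota> a) = dd a"
    "\<And>a. a \<in> carrier A \<Longrightarrow> D (dd a) = \<zero>\<^bsub>Om\<^esub>"
    "\<And>p x y. \<lbrakk>x \<in> bspan p; y \<in> carrier Om\<rbrakk> \<Longrightarrow> D (x \<bullet> y) = D x \<bullet> y \<oplus>\<^bsub>Om\<^esub> sg p (x \<bullet> D y)"
    by (rule superderivation_exists[of dd "\<lambda>_. \<zero>\<^bsub>Om\<^esub>"])
       (auto simp: dd_add dd_mult dd_one F.l_minus F.r_neg)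
  have 1: "D (exact_prod as) = \<zero>\<^bsub>Om\<^esub>" if "as \<in> lists (carrier A)" for as
    using that by (induction as) (auto simp: D dd_one basic_unit_Cons D(4)[OF dd_deg] sg_def)
  have 2: "D (basic_form K A a as) = exact_prod (a # as)" if "a \<in> carrier A" "as \<in> lists (carrier A)" for a as
    using that by (simp add: basic_mult[of a as] D(4)[OF zero_form_deg] 1 sg_def D(2) basic_unit_Cons)
  let ?D = "restrict D (carrier Om)"
  have "d = ?D"
    unfolding ext_d_def
  proof (rule the_equality)
    show *: "?D \<in> additive_maps Om \<and> (\<forall>a\<in>carrier A. \<forall>as\<in>lists (carrier A).
        ?D (basic_form K A a as) = exact_prod (a # as))"
      using D(1) 2 by (simp add: additive_maps_iff additive_restrict)
    fix E assume E: "E \<in> additive_maps Om \<and> (\<forall>a\<in>carrier A. \<forall>as\<in>lists (carrier A).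
        E (basic_form K A a as) = exact_prod (a # as))"
    show "E = ?D"
    proof (rule extensionalityI)
      fix x assume x: "x \<in> carrier Om"
      show "E x = ?D x"
      proof (rule additive_eqI[OF _ _ _ x])
        show "additive E" "additive ?D" using E * by (auto simp only: additive_maps_iff)
        show "E (\<iota> a \<bullet> exact_prod as)
            = ?D (\<iota> a \<bullet> exact_prod as)"
          if "a \<in> carrier A" "as \<in> lists (carrier A)" for a as
          using E * that basic_mult[OF that] by metis
      qed
    qed (use E in \<open>auto simp: additive_maps_iff\<close>)
  qed
  then have dD: "d x = D x" if "x \<in> carrier Om" for x using that by simp
  show "additive d" using \<open>d = ?D\<close> additive_restrict[OF D(1)] by simp
  show "a \<in> carrier A \<Longrightarrow> d (\<iota> a) = dd a" by (simp add: dD D(2))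
  show "\<lbrakk>a \<in> carrier A; as \<in> lists (carrier A)\<rbrakk> \<Longrightarrow> d (basic_form K A a as) = exact_prod (a # as)"
    by (simp add: dD 2)
  show "\<lbrakk>x \<in> bspan p; y \<in> carrier Om\<rbrakk> \<Longrightarrow> d (x \<bullet> y) = d x \<bullet> y \<oplus>\<^bsub>Om\<^esub> sg p (x \<bullet> d y)"
    using bspan_incl by (simp add: dD D(4))
qed

lemmas d_additive = ext_d_spec(1)
  and d_zero_form = ext_d_spec(2)
  and d_basic = ext_d_spec(3)
  and d_leibniz = ext_d_spec(4)
  and d_closed [simp] = additive_closed[OF ext_d_spec(1)]

lemma d_deg:
  assumes "x \<in> bspan n"
  shows "d x \<in> bspan (Suc n)"
  using assms
proof (induction rule: bspan_induct)
  case (basic a as)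
  then show ?case using bspan_basic[of "\<one>\<^bsub>A\<^esub>" "a # as"] by (simp add: d_basic)
qed (auto simp: additive_zero[OF d_additive] additive_add[OF d_additive]
       additive_minus[OF d_additive] bspan_zero bspan_add bspan_minus)

lemma d_dd: "a \<in> carrier A \<Longrightarrow> d (dd a) = \<zero>\<^bsub>Om\<^esub>"
  using d_basic[of "\<one>\<^bsub>A\<^esub>" "[a]"] by (simp add: dd_def[symmetric] basic_unit_Cons dd_one zero_form_one)

lemma d_zero_form_mult: "\<lbrakk>a \<in> carrier A; x \<in> carrier Om\<rbrakk>
    \<Longrightarrow> d (\<iota> a \<bullet> x) = dd a \<bullet> x \<oplus>\<^bsub>Om\<^esub> \<iota> a \<bullet> d x"
  by (simp add: d_leibniz[OF zero_form_deg] d_zero_form sg_def)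

lemma d_dd_mult: "\<lbrakk>a \<in> carrier A; x \<in> carrier Om\<rbrakk> \<Longrightarrow> d (dd a \<bullet> x) = \<ominus>\<^bsub>Om\<^esub> (dd a \<bullet> d x)"
  by (simp add: d_leibniz[OF dd_deg] d_dd sg_def)

lemma d_d: "x \<in> carrier Om \<Longrightarrow> d (d x) = \<zero>\<^bsub>Om\<^esub>"
proof (rule additive_eq_zeroI[of "\<lambda>x. d (d x)"])
  show "additive (\<lambda>x. d (d x))"
    using additive_add[OF d_additive] by (auto simp: additive_def)
  show "d (d \<one>\<^bsub>Om\<^esub>) = \<zero>\<^bsub>Om\<^esub>"
    using d_zero_form[of "\<one>\<^bsub>A\<^esub>"] by (simp add: zero_form_one dd_one additive_zero[OF d_additive])
qed (auto simp: d_zero_form_mult d_dd_mult additive_add[OF d_additive] additive_minus[OF d_additive] F.l_neg)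

subsection \<open>Contraction\<close>

abbreviation "Der \<equiv> derivations K A"
abbreviation "con \<equiv> contraction K A"

lemma Der_closed [simp]: "\<lbrakk>\<theta> \<in> Der; a \<in> carrier A\<rbrakk> \<Longrightarrow> \<theta> a \<in> carrier A"
  and Der_add: "\<lbrakk>\<theta> \<in> Der; a \<in> carrier A; b \<in> carrier A\<rbrakk> \<Longrightarrow> \<theta> (a \<oplus>\<^bsub>A\<^esub> b) = \<theta> a \<oplus>\<^bsub>A\<^esub> \<theta> b"
  and Der_smult: "\<lbrakk>\<theta> \<in> Der; c \<in> carrier K; a \<in> carrier A\<rbrakk> \<Longrightarrow> \<theta> (c \<odot>\<^bsub>A\<^esub> a) = c \<odot>\<^bsub>A\<^esub> \<theta> a"
  and Der_mult: "\<lbrakk>\<theta> \<in> Der; a \<in> carrier A; b \<in> carrier A\<rbrakk>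
    \<Longrightarrow> \<theta> (a \<otimes>\<^bsub>A\<^esub> b) = \<theta> a \<otimes>\<^bsub>A\<^esub> b \<oplus>\<^bsub>A\<^esub> a \<otimes>\<^bsub>A\<^esub> \<theta> b"
  by (auto simp: derivations_def)

lemma Der_one: assumes \<theta>: "\<theta> \<in> Der" shows "\<theta> \<one>\<^bsub>A\<^esub> = \<zero>\<^bsub>A\<^esub>"
proof -
  have "\<theta> \<one>\<^bsub>A\<^esub> = \<theta> \<one>\<^bsub>A\<^esub> \<oplus>\<^bsub>A\<^esub> \<theta> \<one>\<^bsub>A\<^esub>" using Der_mult[OF \<theta>, of "\<one>\<^bsub>A\<^esub>" "\<one>\<^bsub>A\<^esub>"] \<theta> by simp
  then show ?thesis using \<theta> by (metis M.add.l_cancel_one' Der_closed A.one_closed)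
qed

text \<open>Consequences of the conditions that define contraction; they apply to any candidate, and thus
  also give uniqueness.\<close>

lemma superderivation_basic:
  assumes D: "additive D" "\<And>p x y. \<lbrakk>x \<in> bspan p; y \<in> carrier Om\<rbrakk>
      \<Longrightarrow> D (x \<bullet> y) = D x \<bullet> y \<oplus>\<^bsub>Om\<^esub> sg p (x \<bullet> D y)"
    and D0: "\<And>a. a \<in> carrier A \<Longrightarrow> D (\<iota> a) = \<zero>\<^bsub>Om\<^esub>"
    and D1: "\<And>a. a \<in> carrier A \<Longrightarrow> D (dd a) = \<iota> (\<theta> a)"
    and \<theta>: "\<And>a. a \<in> carrier A \<Longrightarrow> \<theta> a \<in> carrier A"
  shows "\<lbrakk>a \<in> carrier A; x \<in> carrier Om\<rbrakk> \<Longrightarrow> D (\<iota> a \<bullet> x) = \<iota> a \<bullet> D x"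
    and "\<lbrakk>a \<in> carrier A; x \<in> carrier Om\<rbrakk>
      \<Longrightarrow> D (dd a \<bullet> x) = \<iota> (\<theta> a) \<bullet> x \<ominus>\<^bsub>Om\<^esub> dd a \<bullet> D x"
    and "x \<in> bspan 0 \<Longrightarrow> D x = \<zero>\<^bsub>Om\<^esub>"
    and "x \<in> bspan (Suc n) \<Longrightarrow> D x \<in> bspan n"
proof -
  note cl [simp] = additive_closed[OF D(1)]
  show z: "D (\<iota> a \<bullet> x) = \<iota> a \<bullet> D x"
    if "a \<in> carrier A" "x \<in> carrier Om" for a x
    using that by (simp add: D(2)[OF zero_form_deg] D0 sg_def)
  show dx: "D (dd a \<bullet> x) = \<iota> (\<theta> a) \<bullet> x \<ominus>\<^bsub>Om\<^esub> dd a \<bullet> D x"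
    if "a \<in> carrier A" "x \<in> carrier Om" for a x
    using that by (simp add: D(2)[OF dd_deg] D1 sg_def a_minus_def)
  show "D x = \<zero>\<^bsub>Om\<^esub>" if "x \<in> bspan 0" for x
    using that
    by (induction rule: bspan_induct)
       (auto simp: additive_zero[OF D(1)] additive_add[OF D(1)] additive_minus[OF D(1)] D0)
  have b: "D (exact_prod as) \<in> bspan (length as - 1)" if "as \<in> lists (carrier A)" for as
    using that
  proof (induction as)
    case step: (Cons a as)
    have "dd a \<bullet> D (exact_prod as) \<in> bspan (length as)"
    proof (cases as)
      case Nil
      then show ?thesis using D0[of "\<one>\<^bsub>A\<^esub>"] step bspan_zero by simp
    next
      case (Cons b bs)
      then show ?thesis using dd_mult_deg[of a _ "length bs"] step by simp
    qed
    moreover have "\<iota> (\<theta> a) \<bullet> exact_prod as \<in> bspan (length as)"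
      using step \<theta> by (intro zero_form_mult_deg bspan_basic) auto
    ultimately show ?case using step by (simp add: basic_unit_Cons dx bspan_diff)
  qed (use D0[of "\<one>\<^bsub>A\<^esub>"] bspan_zero in simp)
  show "D x \<in> bspan n" if "x \<in> bspan (Suc n)" for x n
    using that
  proof (induction rule: bspan_induct)
    case (basic a as)
    then show ?case using b[of as] by (simp add: basic_mult[of a as] z zero_form_mult_deg)
  qed (auto simp: additive_zero[OF D(1)] additive_add[OF D(1)] additive_minus[OF D(1)]
         bspan_zero bspan_add bspan_minus)
qed

lemma contraction_spec:
  assumes \<theta>: "\<theta> \<in> Der"
  shows con_additive: "additive (con \<theta>)"
    and con_zero_form: "\<And>a. a \<in> carrier A \<Longrightarrow> con \<theta> (\<iota> a) = \<zero>\<^bsub>Om\<^esub>"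
    and con_dd: "\<And>a. a \<in> carrier A \<Longrightarrow> con \<theta> (dd a) = \<iota> (\<theta> a)"
    and con_leibniz: "\<And>p x y. \<lbrakk>x \<in> bspan p; y \<in> carrier Om\<rbrakk>
      \<Longrightarrow> con \<theta> (x \<bullet> y) = con \<theta> x \<bullet> y \<oplus>\<^bsub>Om\<^esub> sg p (x \<bullet> con \<theta> y)"
proof -
  obtain D where D: "additive D"
    "\<And>a. a \<in> carrier A \<Longrightarrow> D (\<iota> a) = \<zero>\<^bsub>Om\<^esub>"
    "\<And>a. a \<in> carrier A \<Longrightarrow> D (dd a) = \<iota> (\<theta> a)"
    "\<And>p x y. \<lbrakk>x \<in> bspan p; y \<in> carrier Om\<rbrakk> \<Longrightarrow> D (x \<bullet> y) = D x \<bullet> y \<oplus>\<^bsub>Om\<^esub> sg p (x \<bullet> D y)"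
    by (rule superderivation_exists[of "\<lambda>_. \<zero>\<^bsub>Om\<^esub>" "\<lambda>a. \<iota> (\<theta> a)"])
       (use \<theta> in \<open>auto simp: Der_add Der_mult Der_smult Der_one zero_form_add zero_form_mult
          zero_form_zero F.a_comm\<close>)
  have \<theta>cl: "\<And>a. a \<in> carrier A \<Longrightarrow> \<theta> a \<in> carrier A" using \<theta> by simp
  note basic = superderivation_basic[OF D(1) D(4) D(2) D(3) \<theta>cl]
  let ?D = "restrict D (carrier Om)"
  define P where "P = (\<lambda>E. E \<in> superderivations_m1 K A \<and>
     (\<forall>a \<in> carrier A. E (\<iota> a) = \<zero>\<^bsub>Om\<^esub>) \<and>
     (\<forall>a \<in> carrier A. E (dd a) = \<iota> (\<theta> a)))"
  have con: "con \<theta> = The P" by (simp add: contraction_def P_def dd_def)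
  have 1: "P ?D"
    using additive_restrict[OF D(1)] D(2,3,4) basic(3,4) bspan_incl additive_closed[OF D(1)]
    by (simp add: P_def superderivations_m1_def additive_maps_iff deg_eq_bspan add_pow_sign)
  have uniq: "E = ?D" if E: "P E" for E
  proof -
    have E': "additive E" "E \<in> extensional (carrier Om)"
      "\<And>p x y. \<lbrakk>x \<in> bspan p; y \<in> carrier Om\<rbrakk> \<Longrightarrow> E (x \<bullet> y) = E x \<bullet> y \<oplus>\<^bsub>Om\<^esub> sg p (x \<bullet> E y)"
      "\<And>a. a \<in> carrier A \<Longrightarrow> E (\<iota> a) = \<zero>\<^bsub>Om\<^esub>"
      "\<And>a. a \<in> carrier A \<Longrightarrow> E (dd a) = \<iota> (\<theta> a)"
      using E bspan_incl additive_closed[of E]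
      by (simp_all add: P_def superderivations_m1_def additive_maps_iff deg_eq_bspan add_pow_sign)
    note E_basic = superderivation_basic[OF E'(1,3,4,5) \<theta>cl]
    have "E (exact_prod as) = D (exact_prod as)" if "as \<in> lists (carrier A)" for as
      using that by (induction as) (auto simp: D(2) E'(4) basic_unit_Cons basic(2) E_basic(2))
    then have "E x = D x" if "x \<in> carrier Om" for x
      by (rule_tac additive_eqI[OF E'(1) D(1) _ that]) (simp add: basic(1) E_basic(1))
    then show ?thesis
      using E'(2) by (intro extensionalityI[of E "carrier Om" ?D]) simp_all
  qed
  have eq: "con \<theta> = ?D" unfolding con by (rule the_equality[of P, OF 1 uniq])
  show "additive (con \<theta>)" using eq additive_restrict[OF D(1)] by simp
  show "\<And>a. a \<in> carrier A \<Longrightarrow> con \<theta> (\<iota> a) = \<zero>\<^bsub>Om\<^esub>"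
    "\<And>a. a \<in> carrier A \<Longrightarrow> con \<theta> (dd a) = \<iota> (\<theta> a)"
    "\<And>p x y. \<lbrakk>x \<in> bspan p; y \<in> carrier Om\<rbrakk>
      \<Longrightarrow> con \<theta> (x \<bullet> y) = con \<theta> x \<bullet> y \<oplus>\<^bsub>Om\<^esub> sg p (x \<bullet> con \<theta> y)"
    using bspan_incl by (simp_all add: eq D(2,3,4))
qed

lemma con_closed [simp]: "\<lbrakk>\<theta> \<in> Der; x \<in> carrier Om\<rbrakk> \<Longrightarrow> con \<theta> x \<in> carrier Om"
  using additive_closed[OF con_additive] by blast

lemma con_one: "\<theta> \<in> Der \<Longrightarrow> con \<theta> \<one>\<^bsub>Om\<^esub> = \<zero>\<^bsub>Om\<^esub>"
  using con_zero_form[of \<theta> "\<one>\<^bsub>A\<^esub>"] by (simp add: zero_form_one)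

lemma
  assumes \<theta>: "\<theta> \<in> Der"
  shows con_zero_form_mult: "\<lbrakk>a \<in> carrier A; x \<in> carrier Om\<rbrakk>
      \<Longrightarrow> con \<theta> (\<iota> a \<bullet> x) = \<iota> a \<bullet> con \<theta> x"
    and con_dd_mult: "\<lbrakk>a \<in> carrier A; x \<in> carrier Om\<rbrakk>
      \<Longrightarrow> con \<theta> (dd a \<bullet> x) = \<iota> (\<theta> a) \<bullet> x \<ominus>\<^bsub>Om\<^esub> dd a \<bullet> con \<theta> x"
    and con_deg_0: "x \<in> bspan 0 \<Longrightarrow> con \<theta> x = \<zero>\<^bsub>Om\<^esub>"
    and con_deg_Suc: "x \<in> bspan (Suc n) \<Longrightarrow> con \<theta> x \<in> bspan n"
proof -
  note s = superderivation_basic[OF con_additive[OF \<theta>] con_leibniz[OF \<theta>] con_zero_form[OF \<theta>]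
      con_dd[OF \<theta>] Der_closed[OF \<theta>]]
  show "\<lbrakk>a \<in> carrier A; x \<in> carrier Om\<rbrakk>
      \<Longrightarrow> con \<theta> (\<iota> a \<bullet> x) = \<iota> a \<bullet> con \<theta> x"
    by (rule s(1))
  show "\<lbrakk>a \<in> carrier A; x \<in> carrier Om\<rbrakk>
      \<Longrightarrow> con \<theta> (dd a \<bullet> x) = \<iota> (\<theta> a) \<bullet> x \<ominus>\<^bsub>Om\<^esub> dd a \<bullet> con \<theta> x"
    by (rule s(2))
  show "x \<in> bspan 0 \<Longrightarrow> con \<theta> x = \<zero>\<^bsub>Om\<^esub>" by (rule s(3))
  show "x \<in> bspan (Suc n) \<Longrightarrow> con \<theta> x \<in> bspan n" by (rule s(4))
qed

lemmas con_add = additive_add[OF con_additive]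
  and con_minus = additive_minus[OF con_additive]
  and con_diff = additive_diff[OF con_additive]
  and con_zero = additive_zero[OF con_additive]
  and d_add = additive_add[OF d_additive]
  and d_diff = additive_diff[OF d_additive]
  and d_zero = additive_zero[OF d_additive]

end

section \<open>Cartan calculus\<close>

context assoc_algebra begin

lemma additive_compose: "\<lbrakk>additive D; additive E\<rbrakk> \<Longrightarrow> additive (\<lambda>x. D (E x))"
  by (auto simp: additive_def Pi_iff)

lemma additive_sum: "\<lbrakk>additive D; additive E\<rbrakk> \<Longrightarrow> additive (\<lambda>x. D x \<oplus>\<^bsub>Om\<^esub> E x)"
  by (auto simp: additive_def Pi_iff F.a_ac)

lemma additive_difference: "\<lbrakk>additive D; additive E\<rbrakk> \<Longrightarrow> additive (\<lambda>x. D x \<ominus>\<^bsub>Om\<^esub> E x)"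
  by (auto simp: additive_def Pi_iff a_minus_def F.minus_add F.a_ac)

lemma con_con_self:
  assumes \<theta>: "\<theta> \<in> Der" and x: "x \<in> carrier Om"
  shows "con \<theta> (con \<theta> x) = \<zero>\<^bsub>Om\<^esub>"
proof (rule additive_eq_zeroI[OF _ _ _ _ x])
  show "additive (\<lambda>x. con \<theta> (con \<theta> x))" by (rule additive_compose[OF con_additive[OF \<theta>] con_additive[OF \<theta>]])
  fix a x assume ax: "a \<in> carrier A" "x \<in> carrier Om" and "con \<theta> (con \<theta> x) = \<zero>\<^bsub>Om\<^esub>"
  then show "con \<theta> (con \<theta> (\<iota> a \<bullet> x)) = \<zero>\<^bsub>Om\<^esub>"
    "con \<theta> (con \<theta> (dd a \<bullet> x)) = \<zero>\<^bsub>Om\<^esub>"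
    using \<theta> by (simp_all add: con_zero_form_mult con_dd_mult con_diff F.minus_self F.minus_zero_right)
qed (use \<theta> in \<open>simp add: con_one con_zero\<close>)

lemma con_sum:
  assumes \<theta>: "\<theta> \<in> Der" and \<eta>: "\<eta> \<in> Der" and \<zeta>: "\<zeta> \<in> Der"
    and eq: "\<And>a. a \<in> carrier A \<Longrightarrow> \<zeta> a = \<theta> a \<oplus>\<^bsub>A\<^esub> \<eta> a" and x: "x \<in> carrier Om"
  shows "con \<zeta> x = con \<theta> x \<oplus>\<^bsub>Om\<^esub> con \<eta> x"
proof -
  have "con \<zeta> x \<ominus>\<^bsub>Om\<^esub> (con \<theta> x \<oplus>\<^bsub>Om\<^esub> con \<eta> x) = \<zero>\<^bsub>Om\<^esub>"
  proof (rule additive_eq_zeroI[OF _ _ _ _ x])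
    show "additive (\<lambda>x. con \<zeta> x \<ominus>\<^bsub>Om\<^esub> (con \<theta> x \<oplus>\<^bsub>Om\<^esub> con \<eta> x))"
      by (intro additive_difference additive_sum con_additive \<theta> \<eta> \<zeta>)
    fix a x assume ax: "a \<in> carrier A" "x \<in> carrier Om"
      and "con \<zeta> x \<ominus>\<^bsub>Om\<^esub> (con \<theta> x \<oplus>\<^bsub>Om\<^esub> con \<eta> x) = \<zero>\<^bsub>Om\<^esub>"
    then have eqx: "con \<zeta> x = con \<theta> x \<oplus>\<^bsub>Om\<^esub> con \<eta> x" using \<theta> \<eta> \<zeta> by simp
    have eqz: "\<iota> (\<zeta> a) = \<iota> (\<theta> a) \<oplus>\<^bsub>Om\<^esub> \<iota> (\<eta> a)"
      using ax \<theta> \<eta> by (simp add: eq zero_form_add)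
    have cl: "dd a \<in> carrier Om" "\<iota> a \<in> carrier Om" "\<iota> (\<theta> a) \<in> carrier Om"
      "\<iota> (\<eta> a) \<in> carrier Om" "con \<theta> x \<in> carrier Om" "con \<eta> x \<in> carrier Om"
      using ax \<theta> \<eta> by simp_all
    show
      "con \<zeta> (\<iota> a \<bullet> x) \<ominus>\<^bsub>Om\<^esub> (con \<theta> (\<iota> a \<bullet> x) \<oplus>\<^bsub>Om\<^esub> con \<eta> (\<iota> a \<bullet> x)) = \<zero>\<^bsub>Om\<^esub>"
      "con \<zeta> (dd a \<bullet> x) \<ominus>\<^bsub>Om\<^esub> (con \<theta> (dd a \<bullet> x) \<oplus>\<^bsub>Om\<^esub> con \<eta> (dd a \<bullet> x)) = \<zero>\<^bsub>Om\<^esub>"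
      using ax cl
      unfolding con_zero_form_mult[OF \<theta> ax] con_zero_form_mult[OF \<eta> ax] con_zero_form_mult[OF \<zeta> ax]
        con_dd_mult[OF \<theta> ax] con_dd_mult[OF \<eta> ax] con_dd_mult[OF \<zeta> ax] eqx eqz
      by algebra+
  qed (use \<theta> \<eta> \<zeta> in \<open>simp add: con_one con_zero\<close>)
  then show ?thesis using \<theta> \<eta> \<zeta> x by simp
qed

abbreviation "Lie \<equiv> lie_derivative K A"

lemma lie_closed [simp]: "\<lbrakk>\<theta> \<in> Der; x \<in> carrier Om\<rbrakk> \<Longrightarrow> Lie \<theta> x \<in> carrier Om"
  by (simp add: lie_derivative_def)

lemma lie_additive: "\<theta> \<in> Der \<Longrightarrow> additive (Lie \<theta>)"
  unfolding lie_derivative_def[abs_def]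
  by (intro additive_sum additive_compose[OF d_additive con_additive] additive_compose[OF con_additive d_additive])

lemma lie_zero_form_mult:
  assumes \<theta>: "\<theta> \<in> Der" and ax: "a \<in> carrier A" "x \<in> carrier Om"
  shows "Lie \<theta> (\<iota> a \<bullet> x)
    = \<iota> (\<theta> a) \<bullet> x \<oplus>\<^bsub>Om\<^esub> \<iota> a \<bullet> Lie \<theta> x"
proof -
  have cl: "dd a \<in> carrier Om" "\<iota> a \<in> carrier Om" "\<iota> (\<theta> a) \<in> carrier Om"
    "con \<theta> x \<in> carrier Om" "d x \<in> carrier Om" "d (con \<theta> x) \<in> carrier Om" "con \<theta> (d x) \<in> carrier Om"
    using ax \<theta> by simp_all
  then show ?thesis
    using \<theta> ax
    by (simp add: lie_derivative_def con_zero_form_mult d_zero_form_mult con_add con_dd_mult) (use cl ax in algebra)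
qed

lemma lie_dd_mult:
  assumes \<theta>: "\<theta> \<in> Der" and ax: "a \<in> carrier A" "x \<in> carrier Om"
  shows "Lie \<theta> (dd a \<bullet> x)
    = dd (\<theta> a) \<bullet> x \<oplus>\<^bsub>Om\<^esub> dd a \<bullet> Lie \<theta> x"
proof -
  have cl: "dd a \<in> carrier Om" "dd (\<theta> a) \<in> carrier Om" "\<iota> (\<theta> a) \<in> carrier Om"
    "con \<theta> x \<in> carrier Om" "d x \<in> carrier Om" "d (con \<theta> x) \<in> carrier Om" "con \<theta> (d x) \<in> carrier Om"
    using ax \<theta> by simp_all
  then show ?thesis
    using \<theta> ax
    by (simp add: lie_derivative_def con_dd_mult d_dd_mult d_zero_form_mult d_diff con_minus) (use cl ax in algebra)
qed

lemma commutator_Der: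
  assumes \<theta>: "\<theta> \<in> Der" and \<eta>: "\<eta> \<in> Der"
  shows "derivation_commutator A \<theta> \<eta> \<in> Der"
  unfolding derivations_def
proof (intro CollectI conjI ballI)
  let ?c = "derivation_commutator A \<theta> \<eta>"
  show "?c \<in> carrier A \<rightarrow>\<^sub>E carrier A"
    using \<theta> \<eta> by (auto simp: derivation_commutator_def)
  fix x y assume xy: "x \<in> carrier A" "y \<in> carrier A"
  then have cl: "\<theta> x \<in> carrier A" "\<eta> x \<in> carrier A" "\<theta> y \<in> carrier A" "\<eta> y \<in> carrier A"
    "\<theta> (\<eta> x) \<in> carrier A" "\<eta> (\<theta> x) \<in> carrier A" "\<theta> (\<eta> y) \<in> carrier A" "\<eta> (\<theta> y) \<in> carrier A"
    using \<theta> \<eta> by simp_all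
  show "?c (x \<oplus>\<^bsub>A\<^esub> y) = ?c x \<oplus>\<^bsub>A\<^esub> ?c y"
    using xy cl \<theta> \<eta> by (simp add: derivation_commutator_def Der_add) (use cl xy in algebra)
  show "?c (x \<otimes>\<^bsub>A\<^esub> y) = ?c x \<otimes>\<^bsub>A\<^esub> y \<oplus>\<^bsub>A\<^esub> x \<otimes>\<^bsub>A\<^esub> ?c y"
    using xy cl \<theta> \<eta> by (simp add: derivation_commutator_def Der_add Der_mult) (use cl xy in algebra)
next
  fix c x assume cx: "c \<in> carrier K" "x \<in> carrier A"
  then show "derivation_commutator A \<theta> \<eta> (c \<odot>\<^bsub>A\<^esub> x) = c \<odot>\<^bsub>A\<^esub> derivation_commutator A \<theta> \<eta> x"
    using \<theta> \<eta> by (simp add: derivation_commutator_def Der_smult a_minus_def smult_r_distr smult_r_minus)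
qed

lemma con_commutator:
  assumes \<theta>: "\<theta> \<in> Der" and \<eta>: "\<eta> \<in> Der" and x: "x \<in> carrier Om"
  shows "con (derivation_commutator A \<theta> \<eta>) x
    = Lie \<theta> (con \<eta> x) \<ominus>\<^bsub>Om\<^esub> con \<eta> (Lie \<theta> x)"
proof -
  let ?c = "derivation_commutator A \<theta> \<eta>"
  let ?L = "Lie \<theta>"
  have c: "?c \<in> Der" by (rule commutator_Der[OF \<theta> \<eta>])
  have "con ?c x \<ominus>\<^bsub>Om\<^esub> (?L (con \<eta> x) \<ominus>\<^bsub>Om\<^esub> con \<eta> (?L x)) = \<zero>\<^bsub>Om\<^esub>"
  proof (rule additive_eq_zeroI[OF _ _ _ _ x])
    show "additive (\<lambda>x. con ?c x \<ominus>\<^bsub>Om\<^esub> (?L (con \<eta> x) \<ominus>\<^bsub>Om\<^esub> con \<eta> (?L x)))"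
      using \<theta> \<eta> c
      by (intro additive_difference additive_compose[OF con_additive lie_additive]
          additive_compose[OF lie_additive con_additive] con_additive)
    have "?L \<one>\<^bsub>Om\<^esub> = \<zero>\<^bsub>Om\<^esub>"
      using \<theta> d_zero_form[of "\<one>\<^bsub>A\<^esub>"] by (simp add: lie_derivative_def con_one d_zero con_zero dd_one zero_form_one)
    then show "con ?c \<one>\<^bsub>Om\<^esub> \<ominus>\<^bsub>Om\<^esub> (?L (con \<eta> \<one>\<^bsub>Om\<^esub>) \<ominus>\<^bsub>Om\<^esub> con \<eta> (?L \<one>\<^bsub>Om\<^esub>)) = \<zero>\<^bsub>Om\<^esub>"
      using c \<eta> \<theta> by (simp add: con_one con_zero additive_zero[OF lie_additive] a_minus_def)
    fix a x assume ax: "a \<in> carrier A" "x \<in> carrier Om"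
      and "con ?c x \<ominus>\<^bsub>Om\<^esub> (?L (con \<eta> x) \<ominus>\<^bsub>Om\<^esub> con \<eta> (?L x)) = \<zero>\<^bsub>Om\<^esub>"
    then have eq: "con ?c x = ?L (con \<eta> x) \<ominus>\<^bsub>Om\<^esub> con \<eta> (?L x)" using \<theta> \<eta> c by simp
    have cl: "dd a \<in> carrier Om" "\<iota> a \<in> carrier Om" "\<iota> (\<theta> a) \<in> carrier Om"
      "dd (\<theta> a) \<in> carrier Om" "\<iota> (\<eta> a) \<in> carrier Om" "\<iota> (\<theta> (\<eta> a)) \<in> carrier Om"
      "\<iota> (\<eta> (\<theta> a)) \<in> carrier Om" "con \<eta> x \<in> carrier Om" "?L x \<in> carrier Om"
      "?L (con \<eta> x) \<in> carrier Om" "con \<eta> (?L x) \<in> carrier Om"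
      using ax \<theta> \<eta> by simp_all
    show "con ?c (\<iota> a \<bullet> x) \<ominus>\<^bsub>Om\<^esub> (?L (con \<eta> (\<iota> a \<bullet> x))
        \<ominus>\<^bsub>Om\<^esub> con \<eta> (?L (\<iota> a \<bullet> x))) = \<zero>\<^bsub>Om\<^esub>"
      using cl ax \<theta> \<eta> c
      by (simp add: con_zero_form_mult lie_zero_form_mult con_add eq) (use cl ax in algebra)
    have ca: "\<iota> (?c a) = \<iota> (\<theta> (\<eta> a)) \<ominus>\<^bsub>Om\<^esub> \<iota> (\<eta> (\<theta> a))"
      using ax \<theta> \<eta> by (simp add: derivation_commutator_def a_minus_def zero_form_add zero_form_minus)
    show "con ?c (dd a \<bullet> x) \<ominus>\<^bsub>Om\<^esub> (?L (con \<eta> (dd a \<bullet> x))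
        \<ominus>\<^bsub>Om\<^esub> con \<eta> (?L (dd a \<bullet> x))) = \<zero>\<^bsub>Om\<^esub>"
      using cl ax \<theta> \<eta> c
      by (simp add: con_dd_mult lie_zero_form_mult lie_dd_mult con_add additive_diff[OF lie_additive] eq ca)
         (use cl ax in algebra)
  qed
  then show ?thesis using \<theta> \<eta> x c by simp
qed

section \<open>The de Rham complex\<close>

abbreviation "sc \<equiv> supercommutators K A"
abbreviation "SC \<equiv> supercommutator_space K A"
abbreviation "cls \<equiv> dr_class K A"

text \<open>The coefficients \<open>(-1)\<^bsup>pq\<^esup>\<close> as signs.\<close>

lemma sc_alt: "sc = {(x \<bullet> y) \<ominus>\<^bsub>Om\<^esub> sg (p * q) (y \<bullet> x) | p q x y. x \<in> bspan p \<and> y \<in> bspan q}"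
  unfolding supercommutators_def deg_eq_bspan
proof (intro Collect_cong iffI; elim exE conjE)
  fix s p q x y
  assume xy: "x \<in> bspan p" "y \<in> bspan q"
  then have eq: "add_pow Om ((-1::int) ^ (p * q)) (y \<bullet> x) = sg (p * q) (y \<bullet> x)"
    by (intro add_pow_sign F.m_closed bspan_incl)
  show "\<exists>p q x y. s = x \<bullet> y \<ominus>\<^bsub>Om\<^esub> sg (p * q) (y \<bullet> x) \<and> x \<in> bspan p \<and> y \<in> bspan q"
    if "s = x \<bullet> y \<ominus>\<^bsub>Om\<^esub> add_pow Om ((-1::int) ^ (p * q)) (y \<bullet> x)"
    using that xy unfolding eq by blast
  show "\<exists>p q x y. s = x \<bullet> y \<ominus>\<^bsub>Om\<^esub> add_pow Om ((-1::int) ^ (p * q)) (y \<bullet> x) \<and> x \<in> bspan p \<and> y \<in> bspan q"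
    if "s = x \<bullet> y \<ominus>\<^bsub>Om\<^esub> sg (p * q) (y \<bullet> x)"
    using that xy unfolding eq[symmetric] by blast
qed

lemma scI: "\<lbrakk>x \<in> bspan p; y \<in> bspan q\<rbrakk> \<Longrightarrow> (x \<bullet> y) \<ominus>\<^bsub>Om\<^esub> sg (p * q) (y \<bullet> x) \<in> sc"
  unfolding sc_alt by blast

lemma sc_carrier: "sc \<subseteq> carrier Om"
  unfolding sc_alt using bspan_incl by auto

text \<open>The scalar \<open>c\<close> as a form of degree zero.\<close>

definition "scalar c = \<iota> (c \<odot>\<^bsub>A\<^esub> \<one>\<^bsub>A\<^esub>)"

lemma scalar_closed [simp]: "c \<in> carrier K \<Longrightarrow> scalar c \<in> carrier Om"
  by (simp add: scalar_def)

lemma scalar_zero_form: "\<lbrakk>c \<in> carrier K; a \<in> carrier A\<rbrakk> \<Longrightarrow> scalar c \<bullet> \<iota> a = \<iota> (c \<odot>\<^bsub>A\<^esub> a)"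
  by (simp add: scalar_def smult_mult_left flip: zero_form_mult)

lemma scalar_central:
  assumes c: "c \<in> carrier K" and x: "x \<in> carrier Om"
  shows "x \<bullet> scalar c = scalar c \<bullet> x"
proof -
  have z: "\<iota> a \<bullet> scalar c = scalar c \<bullet> \<iota> a" if "a \<in> carrier A" for a
    using that c by (simp add: scalar_def smult_mult_left smult_mult_right flip: zero_form_mult)
  have dz: "dd a \<bullet> scalar c = scalar c \<bullet> dd a" if "a \<in> carrier A" for a
  proof -
    have "(c \<odot>\<^bsub>A\<^esub> \<one>\<^bsub>A\<^esub>) \<otimes>\<^bsub>A\<^esub> a = a \<otimes>\<^bsub>A\<^esub> (c \<odot>\<^bsub>A\<^esub> \<one>\<^bsub>A\<^esub>)"
      using that c by (simp add: smult_mult_left smult_mult_right)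
    then have "dd ((c \<odot>\<^bsub>A\<^esub> \<one>\<^bsub>A\<^esub>) \<otimes>\<^bsub>A\<^esub> a) = dd (a \<otimes>\<^bsub>A\<^esub> (c \<odot>\<^bsub>A\<^esub> \<one>\<^bsub>A\<^esub>))" by (rule arg_cong)
    moreover have "dd ((c \<odot>\<^bsub>A\<^esub> \<one>\<^bsub>A\<^esub>) \<otimes>\<^bsub>A\<^esub> a) = scalar c \<bullet> dd a"
      using dd_mult[of "c \<odot>\<^bsub>A\<^esub> \<one>\<^bsub>A\<^esub>" a] that c by (simp add: dd_scalar scalar_def del: smult_mult_left)
    moreover have "dd (a \<otimes>\<^bsub>A\<^esub> (c \<odot>\<^bsub>A\<^esub> \<one>\<^bsub>A\<^esub>)) = dd a \<bullet> scalar c"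
      using dd_mult[of a "c \<odot>\<^bsub>A\<^esub> \<one>\<^bsub>A\<^esub>"] that c by (simp add: dd_scalar scalar_def)
    ultimately show ?thesis by simp
  qed
  have 1: "exact_prod as \<bullet> scalar c = scalar c \<bullet> exact_prod as"
    if "as \<in> lists (carrier A)" for as
    using that
  proof (induction as)
    case (Cons a as)
    let ?b = "exact_prod as"
    have "(dd a \<bullet> ?b) \<bullet> scalar c = dd a \<bullet> (scalar c \<bullet> ?b)"
      using Cons c by (simp add: F.m_assoc)
    also have "\<dots> = scalar c \<bullet> (dd a \<bullet> ?b)"
      using Cons c by (simp add: dz flip: F.m_assoc)
    finally show ?case using Cons by (simp add: basic_unit_Cons)
  qed (use z in simp)
  show ?thesis
  proof (rule additive_eqI[OF _ _ _ x])
    show "additive (\<lambda>x. x \<bullet> scalar c)" "additive (\<lambda>x. scalar c \<bullet> x)"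
      using c by (auto simp: additive_def F.l_distr F.r_distr)
    fix a as assume a: "a \<in> carrier A" "as \<in> lists (carrier A)"
    let ?b = "exact_prod as"
    have "\<iota> a \<bullet> ?b \<bullet> scalar c = \<iota> a \<bullet> (scalar c \<bullet> ?b)"
      using a c by (simp add: F.m_assoc 1)
    also have "\<dots> = scalar c \<bullet> (\<iota> a \<bullet> ?b)"
      using a c by (simp add: z flip: F.m_assoc)
    finally show "\<iota> a \<bullet> ?b \<bullet> scalar c = scalar c \<bullet> (\<iota> a \<bullet> ?b)" .
  qed
qed

lemma con_smult:
  assumes \<theta>: "\<theta> \<in> Der" and \<zeta>: "\<zeta> \<in> Der" and c: "c \<in> carrier K"
    and eq: "\<And>a. a \<in> carrier A \<Longrightarrow> \<zeta> a = c \<odot>\<^bsub>A\<^esub> \<theta> a" and x: "x \<in> carrier Om"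
  shows "con \<zeta> x = scalar c \<bullet> con \<theta> x"
proof -
  have "con \<zeta> x \<ominus>\<^bsub>Om\<^esub> scalar c \<bullet> con \<theta> x = \<zero>\<^bsub>Om\<^esub>"
  proof (rule additive_eq_zeroI[OF _ _ _ _ x])
    have "additive (\<lambda>x. scalar c \<bullet> x)" using c by (auto simp: additive_def F.r_distr)
    then show "additive (\<lambda>x. con \<zeta> x \<ominus>\<^bsub>Om\<^esub> scalar c \<bullet> con \<theta> x)"
      using \<theta> \<zeta> by (intro additive_difference additive_compose[of "\<lambda>x. scalar c \<bullet> x" "con \<theta>"] con_additive)
    fix a x assume ax: "a \<in> carrier A" "x \<in> carrier Om"
      and "con \<zeta> x \<ominus>\<^bsub>Om\<^esub> scalar c \<bullet> con \<theta> x = \<zero>\<^bsub>Om\<^esub>"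
    then have eqx: "con \<zeta> x = scalar c \<bullet> con \<theta> x" using \<theta> \<zeta> c by simp
    have cl: "dd a \<in> carrier Om" "\<iota> a \<in> carrier Om" "\<iota> (\<theta> a) \<in> carrier Om"
      "con \<theta> x \<in> carrier Om" "scalar c \<in> carrier Om"
      using ax \<theta> c by simp_all
    have z: "\<iota> (\<zeta> a) = scalar c \<bullet> \<iota> (\<theta> a)"
      using ax \<theta> c by (simp add: scalar_zero_form eq)
    have z1: "\<iota> a \<bullet> (scalar c \<bullet> con \<theta> x) = scalar c \<bullet> (\<iota> a \<bullet> con \<theta> x)"
      and z2: "dd a \<bullet> (scalar c \<bullet> con \<theta> x) = scalar c \<bullet> (dd a \<bullet> con \<theta> x)"
      using cl c by (simp_all add: scalar_central[OF c] flip: F.m_assoc)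
    show "con \<zeta> (\<iota> a \<bullet> x) \<ominus>\<^bsub>Om\<^esub> scalar c \<bullet> con \<theta> (\<iota> a \<bullet> x) = \<zero>\<^bsub>Om\<^esub>"
      using ax cl \<theta> \<zeta> by (simp add: con_zero_form_mult eqx z1)
    show "con \<zeta> (dd a \<bullet> x) \<ominus>\<^bsub>Om\<^esub> scalar c \<bullet> con \<theta> (dd a \<bullet> x) = \<zero>\<^bsub>Om\<^esub>"
      using ax cl \<theta> \<zeta> by (simp add: con_dd_mult eqx z z2 a_minus_def F.r_distr F.r_minus F.m_assoc F.r_neg)
  qed (use \<theta> \<zeta> c in \<open>simp add: con_one con_zero\<close>)
  then show ?thesis using \<theta> \<zeta> x c by simp
qed

lemma smult_forms: "c \<odot>\<^bsub>Om\<^esub> x = scalar c \<bullet> x"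
  by (simp add: nc_forms_def tensor_algebra_def scalar_def zero_form_scal \<Omega>.scal_def)

text \<open>Super-commutators are stable under scalars, so their \<open>k\<close>-span is their additive span
  (\<open>SC_aspan\<close>).\<close>

lemma sc_scalar:
  assumes c: "c \<in> carrier K" and s: "s \<in> sc"
  shows "scalar c \<bullet> s \<in> sc"
proof -
  obtain p q x y where xy: "x \<in> bspan p" "y \<in> bspan q" "s = (x \<bullet> y) \<ominus>\<^bsub>Om\<^esub> sg (p * q) (y \<bullet> x)"
    using s unfolding sc_alt by blast
  have cl: "x \<in> carrier Om" "y \<in> carrier Om" "scalar c \<in> carrier Om" using xy bspan_incl c by auto
  have "y \<bullet> (scalar c \<bullet> x) = scalar c \<bullet> (y \<bullet> x)"
    using cl by (simp add: scalar_central[OF c] flip: F.m_assoc)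
  then have "scalar c \<bullet> s = ((scalar c \<bullet> x) \<bullet> y) \<ominus>\<^bsub>Om\<^esub> sg (p * q) (y \<bullet> (scalar c \<bullet> x))"
    using cl xy(3) by (simp add: sg_def a_minus_def F.r_distr F.r_minus F.m_assoc)
  moreover have "scalar c \<bullet> x \<in> bspan p"
    unfolding scalar_def using c xy(1) by (intro zero_form_mult_deg) auto
  ultimately show ?thesis using scI[of "scalar c \<bullet> x" p y q] xy(2) by simp
qed

lemma SC_aspan: "SC = F.aspan sc"
proof -
  have "scalar \<one>\<^bsub>K\<^esub> = \<one>\<^bsub>Om\<^esub>" by (simp add: scalar_def zero_form_one)
  then have "s = scalar \<one>\<^bsub>K\<^esub> \<bullet> s" if "s \<in> sc" for s using sc_carrier that by auto
  then have "{c \<odot>\<^bsub>Om\<^esub> s |c s. c \<in> carrier K \<and> s \<in> sc} = sc"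
    using sc_scalar by (auto simp: smult_forms)
  then show ?thesis by (simp add: supercommutator_space_def kspan_def)
qed

lemmas SC_incl = F.aspan_incl[OF sc_carrier, folded SC_aspan]
  and SC_minus = F.aspan_minus[OF sc_carrier, folded SC_aspan]
  and SC_diff = F.aspan_diff[OF sc_carrier, folded SC_aspan]
  and SC_add = F.aspan_add[where B = sc, folded SC_aspan]
  and SC_zero = F.aspan_zero[where B = sc, folded SC_aspan]

lemma SC_scalar:
  assumes c: "c \<in> carrier K" and x: "x \<in> SC"
  shows "scalar c \<bullet> x \<in> SC"
  using x[unfolded SC_aspan] sc_carrier
proof (induction rule: F.aspan_induct)
  case (base x)
  then show ?case using sc_scalar[OF c] by (simp add: SC_aspan generate.incl)
qed (use c in \<open>auto simp: F.r_distr F.r_minus SC_zero SC_add SC_minus\<close>)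

text \<open>For \<open>|x| = p\<close> and an odd super-derivation, \<open>D[x,y] = [Dx,y] + (-1)\<^bsup>p\<^esup>[x,Dy]\<close>. Only the parity of
  the degree of \<open>D\<close> matters, which covers \<open>d\<close> and \<open>i\<^bsub>\<theta>\<^esub>\<close> at once.\<close>

lemma superderivation_SC:
  assumes D: "additive D"
    and leib: "\<And>p x y. \<lbrakk>x \<in> bspan p; y \<in> carrier Om\<rbrakk>
      \<Longrightarrow> D (x \<bullet> y) = D x \<bullet> y \<oplus>\<^bsub>Om\<^esub> sg p (x \<bullet> D y)"
    and deg: "\<And>p x. x \<in> bspan p \<Longrightarrow> \<exists>q. odd (p + q) \<and> D x \<in> bspan q"
    and x: "x \<in> SC"
  shows "D x \<in> SC"
  using x[unfolded SC_aspan] sc_carrier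
proof (induction rule: F.aspan_induct)
  case (base s)
  then obtain p q x y where xy: "x \<in> bspan p" "y \<in> bspan q" "s = (x \<bullet> y) \<ominus>\<^bsub>Om\<^esub> sg (p * q) (y \<bullet> x)"
    unfolding sc_alt by blast
  obtain p' where p': "odd (p + p')" "D x \<in> bspan p'" using deg xy by blast
  obtain q' where q': "odd (q + q')" "D y \<in> bspan q'" using deg xy by blast
  have cl: "x \<in> carrier Om" "y \<in> carrier Om" "D x \<in> carrier Om" "D y \<in> carrier Om"
    using xy bspan_incl additive_closed[OF D] by auto
  \<comment> \<open>Naming the four products leaves an identity in an abelian group for each pair of parities.\<close>
  define a b c e where "a = x \<bullet> D y" "b = D x \<bullet> y" "c = y \<bullet> D x" "e = D y \<bullet> x"
  note abce = this
  have abcl: "a \<in> carrier Om" "b \<in> carrier Om" "c \<in> carrier Om" "e \<in> carrier Om"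
    using cl by (simp_all add: abce)
  have "D (sg n z) = sg n (D z)" if "z \<in> carrier Om" for n z
    using that by (simp add: sg_def additive_minus[OF D])
  then have "D s = (b \<oplus>\<^bsub>Om\<^esub> sg p a) \<ominus>\<^bsub>Om\<^esub> sg (p * q) (e \<oplus>\<^bsub>Om\<^esub> sg q c)"
    using cl xy by (simp add: additive_diff[OF D] leib abce)
  also have "\<dots> = (b \<ominus>\<^bsub>Om\<^esub> sg (p' * q) c) \<oplus>\<^bsub>Om\<^esub> sg p (a \<ominus>\<^bsub>Om\<^esub> sg (p * q') e)"
    using abcl p'(1) q'(1)
    by (cases "even p"; cases "even q")
       (simp_all add: sg_def a_minus_def F.minus_add F.a_ac)
  finally have Ds: "D s = (b \<ominus>\<^bsub>Om\<^esub> sg (p' * q) c) \<oplus>\<^bsub>Om\<^esub> sg p (a \<ominus>\<^bsub>Om\<^esub> sg (p * q') e)" .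
  have "b \<ominus>\<^bsub>Om\<^esub> sg (p' * q) c \<in> SC" "a \<ominus>\<^bsub>Om\<^esub> sg (p * q') e \<in> SC"
    unfolding SC_aspan using scI[OF p'(2) xy(2)] scI[OF xy(1) q'(2)]
    by (auto simp: abce intro: generate.incl)
  then show ?case unfolding Ds by (auto simp: sg_def SC_add SC_minus)
qed (auto simp: additive_zero[OF D] additive_add[OF D] additive_minus[OF D] SC_zero SC_add SC_minus)

lemma d_SC: "x \<in> SC \<Longrightarrow> d x \<in> SC"
proof (rule superderivation_SC[OF d_additive d_leibniz])
  show "\<exists>q. odd (p + q) \<and> d x \<in> bspan q" if "x \<in> bspan p" for p x
    using d_deg[OF that] by (intro exI[of _ "Suc p"]) simp
qed

lemma con_SC: "\<lbrakk>\<theta> \<in> Der; x \<in> SC\<rbrakk> \<Longrightarrow> con \<theta> x \<in> SC"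
proof (rule superderivation_SC[OF con_additive con_leibniz])
  show "\<exists>q. odd (p + q) \<and> con \<theta> x \<in> bspan q" if "\<theta> \<in> Der" "x \<in> bspan p" for p x
    using that con_deg_0 con_deg_Suc[of \<theta> x "p - 1"] bspan_zero
    by (cases p) (auto intro: exI[of _ "p - 1"] exI[of _ 1])
qed

lemma lie_SC: "\<lbrakk>\<theta> \<in> Der; x \<in> SC\<rbrakk> \<Longrightarrow> Lie \<theta> x \<in> SC"
  by (simp add: lie_derivative_def SC_add con_SC d_SC)

lemma cls_eq_iff: "\<lbrakk>x \<in> carrier Om; y \<in> carrier Om\<rbrakk> \<Longrightarrow> cls x = cls y \<longleftrightarrow> x \<ominus>\<^bsub>Om\<^esub> y \<in> SC"
  unfolding dr_class_def SC_aspan by (rule F.aspan_coset_eq_iff[OF sc_carrier])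

lemma deRham_zero: "\<zero>\<^bsub>deRham K A\<^esub> = cls \<zero>\<^bsub>Om\<^esub>"
  using SC_incl by (force simp: deRham_def quotient_space_def dr_class_def a_r_coset_def')

lemma dr_map_class:
  assumes D: "additive D" and SC: "\<And>x. x \<in> SC \<Longrightarrow> D x \<in> SC" and x: "x \<in> carrier Om"
  shows "dr_map K A D (cls x) = cls (D x)"
  unfolding dr_map_def dr_class_def[of K A x] SC_aspan
proof (rule F.the_elem_coset[OF x])
  fix h assume "h \<in> F.aspan sc"
  then have h: "h \<in> SC" "h \<in> carrier Om" using SC_incl by (auto simp: SC_aspan)
  have "D (h \<oplus>\<^bsub>Om\<^esub> x) \<ominus>\<^bsub>Om\<^esub> D x = D h"
    using h x additive_closed[OF D] by (simp add: additive_add[OF D] a_minus_def F.a_assoc F.r_neg)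
  then show "cls (D (h \<oplus>\<^bsub>Om\<^esub> x)) = cls (D x)"
    using SC[OF h(1)] h x additive_closed[OF D] by (simp add: cls_eq_iff)
qed

lemma dr_d_class: "x \<in> carrier Om \<Longrightarrow> dr_d K A (cls x) = cls (d x)"
  by (rule dr_map_class[OF d_additive d_SC])

lemma dr_contraction_class: "\<lbrakk>\<theta> \<in> Der; x \<in> carrier Om\<rbrakk> \<Longrightarrow> dr_contraction K A \<theta> (cls x) = cls (con \<theta> x)"
  by (rule dr_map_class[OF con_additive con_SC])

lemma dr_lie_class: "\<lbrakk>\<theta> \<in> Der; x \<in> carrier Om\<rbrakk> \<Longrightarrow> dr_lie_derivative K A \<theta> (cls x) = cls (Lie \<theta> x)"
  by (rule dr_map_class[OF lie_additive lie_SC])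

subsection \<open>Functions modulo commutators\<close>

text \<open>Scalar multiples of commutators in \<open>A\<close>; their additive span \<open>CA\<close> is the \<open>k\<close>-space \<open>[A,A]\<close>.\<close>

definition "comms = {c \<odot>\<^bsub>A\<^esub> ((a \<otimes>\<^bsub>A\<^esub> b) \<ominus>\<^bsub>A\<^esub> (b \<otimes>\<^bsub>A\<^esub> a)) | c a b. c \<in> carrier K \<and> a \<in> carrier A \<and> b \<in> carrier A}"

abbreviation "CA \<equiv> M.aspan comms"

lemma comms_carrier: "comms \<subseteq> carrier A"
  by (auto simp: comms_def)

lemma commutator_quotient_alt: "commutator_quotient K A = quotient_space A CA"
proof -
  have "{c \<odot>\<^bsub>A\<^esub> s |c s. c \<in> carrier K \<and> s \<in> {(a \<otimes>\<^bsub>A\<^esub> b) \<ominus>\<^bsub>A\<^esub> (b \<otimes>\<^bsub>A\<^esub> a) | a b. a \<in> carrier A \<and> b \<in> carrier A}} = comms"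
    unfolding comms_def by blast
  then show ?thesis by (simp add: commutator_quotient_def kspan_def)
qed

lemma comms_smult: "\<lbrakk>c \<in> carrier K; s \<in> comms\<rbrakk> \<Longrightarrow> c \<odot>\<^bsub>A\<^esub> s \<in> comms"
  unfolding comms_def
  by (clarsimp simp flip: smult_assoc1) blast

lemma comms_incl:
  assumes "a \<in> carrier A" "b \<in> carrier A"
  shows "(a \<otimes>\<^bsub>A\<^esub> b) \<ominus>\<^bsub>A\<^esub> (b \<otimes>\<^bsub>A\<^esub> a) \<in> CA"
proof -
  have "\<one>\<^bsub>K\<^esub> \<odot>\<^bsub>A\<^esub> ((a \<otimes>\<^bsub>A\<^esub> b) \<ominus>\<^bsub>A\<^esub> (b \<otimes>\<^bsub>A\<^esub> a)) \<in> comms"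
    unfolding comms_def using assms by blast
  then show ?thesis using assms by (simp add: generate.incl)
qed

lemma zero_form_CA:
  assumes "a \<in> CA"
  shows "\<iota> a \<in> SC"
  using assms comms_carrier
proof (induction rule: M.aspan_induct)
  case (base s)
  then obtain c a b where s: "s = c \<odot>\<^bsub>A\<^esub> ((a \<otimes>\<^bsub>A\<^esub> b) \<ominus>\<^bsub>A\<^esub> (b \<otimes>\<^bsub>A\<^esub> a))" "c \<in> carrier K" "a \<in> carrier A" "b \<in> carrier A"
    by (auto simp: comms_def)
  have "\<iota> ((a \<otimes>\<^bsub>A\<^esub> b) \<ominus>\<^bsub>A\<^esub> (b \<otimes>\<^bsub>A\<^esub> a)) \<in> SC"
    using scI[OF zero_form_deg[OF s(3)] zero_form_deg[OF s(4)]] s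
    by (simp add: SC_aspan generate.incl sg_def a_minus_def zero_form_add zero_form_minus zero_form_mult)
  then show ?case using SC_scalar[OF s(2)] s by (simp flip: scalar_zero_form)
qed (auto simp: zero_form_zero zero_form_add zero_form_minus SC_zero SC_add SC_minus)

text \<open>The projection of forms onto their degree zero part is a homomorphism of algebras, so it maps
  super-commutators to commutators; hence \<open>A/[A,A]\<close> embeds into the de Rham complex.\<close>

lemma zero_form_SC_iff:
  assumes a: "a \<in> carrier A"
  shows "\<iota> a \<in> SC \<longleftrightarrow> a \<in> CA"
proof
  obtain h where h: "h \<in> ring_hom Om A" "\<And>a. a \<in> carrier A \<Longrightarrow> h (\<iota> a) = id a"
    "\<And>a. a \<in> carrier A \<Longrightarrow> h (dd a) = \<zero>\<^bsub>A\<^esub>"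
    by (rule forms_lift[OF A.ring_axioms id_ring_hom, of "\<lambda>_. \<zero>\<^bsub>A\<^esub>"]; (assumption | rule that | simp))
  note hs [simp] = ring_hom_closed[OF h(1)]
  have hm: "h (\<ominus>\<^bsub>Om\<^esub> x) = \<ominus>\<^bsub>A\<^esub> h x" if "x \<in> carrier Om" for x
    by (rule ring_hom_minus[OF nc_forms_ring A.ring_axioms h(1) that])
  have h0: "h \<zero>\<^bsub>Om\<^esub> = \<zero>\<^bsub>A\<^esub>" by (rule ring_hom_zero[OF h(1) nc_forms_ring A.ring_axioms])
  have pos: "h x = \<zero>\<^bsub>A\<^esub>" if x: "x \<in> bspan n" and n: "n \<noteq> 0" for x n
    using x
  proof (induction rule: bspan_induct)
    case (basic b as)
    then obtain c cs where as: "as = c # cs" using n by (cases as) auto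
    then show ?case using basic by (simp add: basic_Cons[of b] ring_hom_mult[OF h(1)] h(3))
  qed (auto simp: h0 hm ring_hom_add[OF h(1)])
  assume "\<iota> a \<in> SC"
  then have "h (\<iota> a) \<in> CA"
    unfolding SC_aspan using sc_carrier
  proof (induction rule: F.aspan_induct)
    case (base s)
    then obtain p q x y where xy: "x \<in> bspan p" "y \<in> bspan q" "s = (x \<bullet> y) \<ominus>\<^bsub>Om\<^esub> sg (p * q) (y \<bullet> x)"
      unfolding sc_alt by blast
    have cl: "x \<in> carrier Om" "y \<in> carrier Om" using xy bspan_incl by auto
    show ?case
    proof (cases "p = 0 \<and> q = 0")
      case True
      then show ?thesis
        using xy cl comms_incl[of "h x" "h y"]
        by (simp add: sg_def a_minus_def ring_hom_add[OF h(1)] ring_hom_mult[OF h(1)] hm)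
    next
      case False
      then have "h x = \<zero>\<^bsub>A\<^esub> \<or> h y = \<zero>\<^bsub>A\<^esub>" using pos xy by blast
      then have "h s = \<zero>\<^bsub>A\<^esub>"
        using xy cl
        by (auto simp: sg_def a_minus_def ring_hom_add[OF h(1)] ring_hom_mult[OF h(1)] hm)
      then show ?thesis by (simp add: M.aspan_zero)
    qed
  qed (auto simp: h0 hm ring_hom_add[OF h(1)] M.aspan_zero M.aspan_add M.aspan_minus[OF comms_carrier])
  then show "a \<in> CA" using h(2)[OF a] by simp
qed (rule zero_form_CA)

abbreviation "fcls a \<equiv> CA +>\<^bsub>A\<^esub> a"

lemma fcls_eq_iff: "\<lbrakk>a \<in> carrier A; b \<in> carrier A\<rbrakk> \<Longrightarrow> fcls a = fcls b \<longleftrightarrow> a \<ominus>\<^bsub>A\<^esub> b \<in> CA"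
  by (rule M.aspan_coset_eq_iff[OF comms_carrier])

lemma dr_of_function_class:
  assumes a: "a \<in> carrier A"
  shows "dr_of_function K A (fcls a) = cls (\<iota> a)"
  unfolding dr_of_function_def
proof (rule M.the_elem_coset[OF a])
  fix h assume h: "h \<in> CA"
  then have hc: "h \<in> carrier A" using M.aspan_incl[OF comms_carrier] by blast
  have "\<iota> (h \<oplus>\<^bsub>A\<^esub> a) \<ominus>\<^bsub>Om\<^esub> \<iota> a = \<iota> h"
    using hc a by (simp add: zero_form_add a_minus_def F.a_assoc F.r_neg)
  then show "cls (\<iota> (h \<oplus>\<^bsub>A\<^esub> a)) = cls (\<iota> a)"
    using zero_form_CA[OF h] hc a by (simp add: cls_eq_iff)
qed

lemma dr_of_function_inj:
  assumes "a \<in> carrier A" "b \<in> carrier A"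
  shows "cls (\<iota> a) = cls (\<iota> b) \<longleftrightarrow> fcls a = fcls b"
proof -
  have "\<iota> a \<ominus>\<^bsub>Om\<^esub> \<iota> b = \<iota> (a \<ominus>\<^bsub>A\<^esub> b)"
    using assms by (simp add: a_minus_def zero_form_add zero_form_minus)
  then show ?thesis using assms by (simp add: cls_eq_iff fcls_eq_iff zero_form_SC_iff)
qed

end

section \<open>Quotient modules\<close>

context module begin

lemma aspan_smult:
  assumes B: "B \<subseteq> carrier M" and smult: "\<And>c s. \<lbrakk>c \<in> carrier R; s \<in> B\<rbrakk> \<Longrightarrow> c \<odot>\<^bsub>M\<^esub> s \<in> B"
    and c: "c \<in> carrier R" and x: "x \<in> M.aspan B"
  shows "c \<odot>\<^bsub>M\<^esub> x \<in> M.aspan B"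
  using x B
proof (induction rule: M.aspan_induct)
  case (base s)
  then show ?case using smult c by (simp add: generate.incl)
qed (use c in \<open>auto simp: smult_r_distr smult_r_minus M.aspan_zero M.aspan_add M.aspan_minus[OF B]\<close>)

lemma quotient_space_ops:
  assumes B: "B \<subseteq> carrier M" and smult: "\<And>c s. \<lbrakk>c \<in> carrier R; s \<in> B\<rbrakk> \<Longrightarrow> c \<odot>\<^bsub>M\<^esub> s \<in> B"
  defines "H \<equiv> M.aspan B"
  defines "Q \<equiv> quotient_space M H"
  shows quotient_space_carrier: "carrier Q = (\<lambda>x. H +>\<^bsub>M\<^esub> x) ` carrier M"
    and quotient_space_zero: "\<zero>\<^bsub>Q\<^esub> = H +>\<^bsub>M\<^esub> \<zero>\<^bsub>M\<^esub>"
    and quotient_space_add: "\<lbrakk>x \<in> carrier M; y \<in> carrier M\<rbrakk>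
      \<Longrightarrow> (H +>\<^bsub>M\<^esub> x) \<oplus>\<^bsub>Q\<^esub> (H +>\<^bsub>M\<^esub> y) = H +>\<^bsub>M\<^esub> (x \<oplus>\<^bsub>M\<^esub> y)"
    and quotient_space_smult: "\<lbrakk>c \<in> carrier R; x \<in> carrier M\<rbrakk>
      \<Longrightarrow> c \<odot>\<^bsub>Q\<^esub> (H +>\<^bsub>M\<^esub> x) = H +>\<^bsub>M\<^esub> (c \<odot>\<^bsub>M\<^esub> x)"
proof -
  have Hc: "h \<in> carrier M" if "h \<in> H" for h using M.aspan_incl[OF B] that by (simp add: H_def)
  show "carrier Q = (\<lambda>x. H +>\<^bsub>M\<^esub> x) ` carrier M"
    by (auto simp: Q_def quotient_space_def A_RCOSETS_def')
  show "\<zero>\<^bsub>Q\<^esub> = H +>\<^bsub>M\<^esub> \<zero>\<^bsub>M\<^esub>"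
    using Hc by (force simp: Q_def quotient_space_def a_r_coset_def')
  show "(H +>\<^bsub>M\<^esub> x) \<oplus>\<^bsub>Q\<^esub> (H +>\<^bsub>M\<^esub> y) = H +>\<^bsub>M\<^esub> (x \<oplus>\<^bsub>M\<^esub> y)" if xy: "x \<in> carrier M" "y \<in> carrier M"
  proof
    show "(H +>\<^bsub>M\<^esub> x) \<oplus>\<^bsub>Q\<^esub> (H +>\<^bsub>M\<^esub> y) \<subseteq> H +>\<^bsub>M\<^esub> (x \<oplus>\<^bsub>M\<^esub> y)"
    proof
      fix z assume "z \<in> (H +>\<^bsub>M\<^esub> x) \<oplus>\<^bsub>Q\<^esub> (H +>\<^bsub>M\<^esub> y)"
      then obtain h k where hk: "h \<in> H" "k \<in> H" "z = (h \<oplus>\<^bsub>M\<^esub> x) \<oplus>\<^bsub>M\<^esub> (k \<oplus>\<^bsub>M\<^esub> y)"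
        by (auto simp: Q_def quotient_space_def set_add_def' a_r_coset_def')
      then have "z = (h \<oplus>\<^bsub>M\<^esub> k) \<oplus>\<^bsub>M\<^esub> (x \<oplus>\<^bsub>M\<^esub> y)" using Hc xy by (simp add: M.a_ac)
      then show "z \<in> H +>\<^bsub>M\<^esub> (x \<oplus>\<^bsub>M\<^esub> y)"
        using M.aspan_add[OF hk(1,2)[unfolded H_def]] by (auto simp: H_def a_r_coset_def')
    qed
    show "H +>\<^bsub>M\<^esub> (x \<oplus>\<^bsub>M\<^esub> y) \<subseteq> (H +>\<^bsub>M\<^esub> x) \<oplus>\<^bsub>Q\<^esub> (H +>\<^bsub>M\<^esub> y)"
    proof
      fix z assume "z \<in> H +>\<^bsub>M\<^esub> (x \<oplus>\<^bsub>M\<^esub> y)"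
      then obtain h where h: "h \<in> H" "z = h \<oplus>\<^bsub>M\<^esub> (x \<oplus>\<^bsub>M\<^esub> y)" by (auto simp: a_r_coset_def')
      then have "z = (h \<oplus>\<^bsub>M\<^esub> x) \<oplus>\<^bsub>M\<^esub> (\<zero>\<^bsub>M\<^esub> \<oplus>\<^bsub>M\<^esub> y)" using Hc xy by (simp add: M.a_ac)
      moreover have "\<zero>\<^bsub>M\<^esub> \<in> H" by (simp add: H_def M.aspan_zero)
      ultimately show "z \<in> (H +>\<^bsub>M\<^esub> x) \<oplus>\<^bsub>Q\<^esub> (H +>\<^bsub>M\<^esub> y)"
        using h(1) by (auto simp: Q_def quotient_space_def set_add_def' a_r_coset_def')
    qed
  qed
  show "c \<odot>\<^bsub>Q\<^esub> (H +>\<^bsub>M\<^esub> x) = H +>\<^bsub>M\<^esub> (c \<odot>\<^bsub>M\<^esub> x)" if cx: "c \<in> carrier R" "x \<in> carrier M"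
  proof -
    have "the_elem ((\<lambda>x. H +>\<^bsub>M\<^esub> (c \<odot>\<^bsub>M\<^esub> x)) ` (H +>\<^bsub>M\<^esub> x)) = H +>\<^bsub>M\<^esub> (c \<odot>\<^bsub>M\<^esub> x)"
      unfolding H_def
    proof (rule M.the_elem_coset[OF cx(2)])
      fix h assume h: "h \<in> M.aspan B"
      then have "h \<in> carrier M" using Hc by (simp add: H_def)
      then have "c \<odot>\<^bsub>M\<^esub> (h \<oplus>\<^bsub>M\<^esub> x) \<ominus>\<^bsub>M\<^esub> c \<odot>\<^bsub>M\<^esub> x = c \<odot>\<^bsub>M\<^esub> h"
        using cx by (simp add: smult_r_distr a_minus_def M.a_assoc M.r_neg)
      then show "M.aspan B +>\<^bsub>M\<^esub> (c \<odot>\<^bsub>M\<^esub> (h \<oplus>\<^bsub>M\<^esub> x)) = M.aspan B +>\<^bsub>M\<^esub> (c \<odot>\<^bsub>M\<^esub> x)"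
        using aspan_smult[OF B smult cx(1) h] \<open>h \<in> carrier M\<close> cx
        by (simp add: M.aspan_coset_eq_iff[OF B])
    qed
    then show ?thesis by (simp add: Q_def quotient_space_def)
  qed
qed

lemma quotient_space_module:
  assumes B: "B \<subseteq> carrier M" and smult: "\<And>c s. \<lbrakk>c \<in> carrier R; s \<in> B\<rbrakk> \<Longrightarrow> c \<odot>\<^bsub>M\<^esub> s \<in> B"
  shows "module R (quotient_space M (M.aspan B))"
proof -
  note ops = quotient_space_ops[OF B smult]
  show ?thesis
  proof (rule moduleI)
    show "cring R" by (rule R.is_cring)
    show "abelian_group (quotient_space M (M.aspan B))"
    proof (rule abelian_groupI)
      fix P assume "P \<in> carrier (quotient_space M (M.aspan B))"
      then obtain x where x: "x \<in> carrier M" "P = M.aspan B +>\<^bsub>M\<^esub> x" by (auto simp: ops(1))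
      then show "\<exists>P'\<in>carrier (quotient_space M (M.aspan B)).
          P' \<oplus>\<^bsub>quotient_space M (M.aspan B)\<^esub> P = \<zero>\<^bsub>quotient_space M (M.aspan B)\<^esub>"
        by (intro bexI[of _ "M.aspan B +>\<^bsub>M\<^esub> (\<ominus>\<^bsub>M\<^esub> x)"]) (auto simp: ops M.l_neg)
    qed (auto simp: ops M.a_ac)
  qed (auto simp: ops smult_l_distr smult_r_distr smult_assoc1)
qed

end

section \<open>The Poisson bracket\<close>

context assoc_algebra begin

lemma cls_zero_iff: "x \<in> carrier Om \<Longrightarrow> cls x = cls \<zero>\<^bsub>Om\<^esub> \<longleftrightarrow> x \<in> SC"
  by (simp add: cls_eq_iff F.minus_zero_right)

lemma cls_add_cong:
  assumes "cls x = cls x'" "cls y = cls y'"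
    "x \<in> carrier Om" "x' \<in> carrier Om" "y \<in> carrier Om" "y' \<in> carrier Om"
  shows "cls (x \<oplus>\<^bsub>Om\<^esub> y) = cls (x' \<oplus>\<^bsub>Om\<^esub> y')"
proof -
  have "(x \<oplus>\<^bsub>Om\<^esub> y) \<ominus>\<^bsub>Om\<^esub> (x' \<oplus>\<^bsub>Om\<^esub> y') = (x \<ominus>\<^bsub>Om\<^esub> x') \<oplus>\<^bsub>Om\<^esub> (y \<ominus>\<^bsub>Om\<^esub> y')"
    using assms(3-6) by (simp add: a_minus_def F.minus_add F.a_ac)
  then show ?thesis using assms by (simp add: cls_eq_iff SC_add)
qed

lemma cls_d_cong: "\<lbrakk>cls x = cls y; x \<in> carrier Om; y \<in> carrier Om\<rbrakk> \<Longrightarrow> cls (d x) = cls (d y)"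
  by (metis dr_d_class)

lemma cls_con_cong: "\<lbrakk>\<theta> \<in> Der; cls x = cls y; x \<in> carrier Om; y \<in> carrier Om\<rbrakk> \<Longrightarrow> cls (con \<theta> x) = cls (con \<theta> y)"
  by (metis dr_contraction_class)

lemma cls_scalar_cong:
  assumes "c \<in> carrier K" "cls x = cls y" "x \<in> carrier Om" "y \<in> carrier Om"
  shows "cls (scalar c \<bullet> x) = cls (scalar c \<bullet> y)"
proof -
  have "(scalar c \<bullet> x) \<ominus>\<^bsub>Om\<^esub> (scalar c \<bullet> y) = scalar c \<bullet> (x \<ominus>\<^bsub>Om\<^esub> y)"
    using assms by (simp add: a_minus_def F.r_distr F.r_minus)
  then show ?thesis using assms by (simp add: cls_eq_iff SC_scalar)
qed

lemma dd_smult: "\<lbrakk>c \<in> carrier K; a \<in> carrier A\<rbrakk> \<Longrightarrow> dd (c \<odot>\<^bsub>A\<^esub> a) = scalar c \<bullet> dd a"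
  using dd_mult[of "c \<odot>\<^bsub>A\<^esub> \<one>\<^bsub>A\<^esub>" a] by (simp add: dd_scalar scalar_def smult_mult_left)

text \<open>The vector space operations on derivations.\<close>

definition der_add :: "('c \<Rightarrow> 'c) \<Rightarrow> ('c \<Rightarrow> 'c) \<Rightarrow> 'c \<Rightarrow> 'c" where
  "der_add \<theta> \<eta> = (\<lambda>x\<in>carrier A. \<theta> x \<oplus>\<^bsub>A\<^esub> \<eta> x)"

definition der_smult :: "'a \<Rightarrow> ('c \<Rightarrow> 'c) \<Rightarrow> 'c \<Rightarrow> 'c" where
  "der_smult c \<theta> = (\<lambda>x\<in>carrier A. c \<odot>\<^bsub>A\<^esub> \<theta> x)"

lemma Der_ext: "\<lbrakk>\<theta> \<in> Der; \<eta> \<in> Der; \<And>x. x \<in> carrier A \<Longrightarrow> \<theta> x = \<eta> x\<rbrakk> \<Longrightarrow> \<theta> = \<eta>"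
  by (rule extensionalityI[of _ "carrier A"]) (simp_all only: derivations_def PiE_def mem_Collect_eq Int_iff)

lemma der_add_app [simp]: "x \<in> carrier A \<Longrightarrow> der_add \<theta> \<eta> x = \<theta> x \<oplus>\<^bsub>A\<^esub> \<eta> x"
  and der_smult_app [simp]: "x \<in> carrier A \<Longrightarrow> der_smult c \<theta> x = c \<odot>\<^bsub>A\<^esub> \<theta> x"
  and commutator_app [simp]: "x \<in> carrier A \<Longrightarrow> derivation_commutator A \<theta> \<eta> x = \<theta> (\<eta> x) \<ominus>\<^bsub>A\<^esub> \<eta> (\<theta> x)"
  by (simp_all add: der_add_def der_smult_def derivation_commutator_def)

lemma der_add_Der:
  assumes \<theta>: "\<theta> \<in> Der" and \<eta>: "\<eta> \<in> Der"
  shows "der_add \<theta> \<eta> \<in> Der"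
  unfolding derivations_def
proof (intro CollectI conjI ballI)
  show "der_add \<theta> \<eta> \<in> carrier A \<rightarrow>\<^sub>E carrier A" using \<theta> \<eta> by (auto simp: der_add_def)
qed (use \<theta> \<eta> in \<open>auto simp: Der_add Der_mult Der_smult smult_r_distr M.a_ac A.l_distr A.r_distr\<close>)

lemma der_smult_Der:
  assumes \<theta>: "\<theta> \<in> Der" and c: "c \<in> carrier K"
  shows "der_smult c \<theta> \<in> Der"
  unfolding derivations_def
proof (intro CollectI conjI ballI)
  show "der_smult c \<theta> \<in> carrier A \<rightarrow>\<^sub>E carrier A" using \<theta> c by (auto simp: der_smult_def)
  fix k x assume "k \<in> carrier K" "x \<in> carrier A"
  then show "der_smult c \<theta> (k \<odot>\<^bsub>A\<^esub> x) = k \<odot>\<^bsub>A\<^esub> der_smult c \<theta> x"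
    using c \<theta> by (simp add: Der_smult R.m_comm flip: smult_assoc1)
qed (use \<theta> c in \<open>auto simp: Der_add Der_mult smult_r_distr smult_mult_left smult_mult_right\<close>)

lemma der_zero_Der: "(\<lambda>x\<in>carrier A. \<zero>\<^bsub>A\<^esub>) \<in> Der"
  by (auto simp: derivations_def)

end

context nc_symplectic begin

text \<open>A form of degree two that represents \<open>\<omega>\<close>.\<close>

definition omega_rep :: "'c form" where
  "omega_rep = (SOME x. x \<in> bspan 2 \<and> \<omega> = cls x)"

lemma omega_rep_deg: "omega_rep \<in> bspan 2" and omega_class: "\<omega> = cls omega_rep"
proof -
  have "\<exists>x. x \<in> bspan 2 \<and> \<omega> = cls x"
    using two_form by (auto simp: deRham_deg_def deg_eq_bspan)
  from someI_ex[OF this] show "omega_rep \<in> bspan 2" "\<omega> = cls omega_rep" by (auto simp: omega_rep_def)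
qed

lemma omega_rep_closed [simp]: "omega_rep \<in> carrier Om"
  by (rule bspan_incl[OF omega_rep_deg])

lemmas dr_d_omega = dr_d_class[OF omega_rep_closed, folded omega_class]
  and dr_contraction_omega = dr_contraction_class[OF _ omega_rep_closed, folded omega_class]
  and dr_lie_omega = dr_lie_class[OF _ omega_rep_closed, folded omega_class]

lemma d_omega_rep: "d omega_rep \<in> SC"
  using closed_form by (simp add: dr_d_omega deRham_zero cls_zero_iff)

abbreviation "H a \<equiv> hamiltonian K A \<omega> (fcls a)"

lemma hamiltonian_ex1:
  assumes a: "a \<in> carrier A"
  shows "\<exists>!\<theta>. \<theta> \<in> Der \<and> cls (con \<theta> omega_rep) = cls (dd a)"
proof -
  have bij: "bij_betw (\<lambda>\<theta>. cls (con \<theta> omega_rep)) Der (cls ` bspan 1)"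
  proof -
    have "bij_betw (\<lambda>\<theta>. dr_contraction K A \<theta> \<omega>) Der (deRham_deg K A 1)
        \<longleftrightarrow> bij_betw (\<lambda>\<theta>. cls (con \<theta> omega_rep)) Der (deRham_deg K A 1)"
      by (rule bij_betw_cong) (simp add: dr_contraction_omega)
    then show ?thesis using nondegenerate by (simp add: deRham_deg_def deg_eq_bspan)
  qed
  have "cls (dd a) \<in> cls ` bspan 1" using dd_deg[OF a] by blast
  then have "cls (dd a) \<in> (\<lambda>\<theta>. cls (con \<theta> omega_rep)) ` Der"
    using bij by (simp only: bij_betw_def)
  then obtain \<theta> where \<theta>: "\<theta> \<in> Der" "cls (con \<theta> omega_rep) = cls (dd a)" by force
  show ?thesis
  proof (rule ex1I[of _ \<theta>])
    fix \<eta> assume "\<eta> \<in> Der \<and> cls (con \<eta> omega_rep) = cls (dd a)"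
    with \<theta> show "\<eta> = \<theta>" using bij_betw_imp_inj_on[OF bij] by (auto dest: inj_onD)
  qed (use \<theta> in simp)
qed

lemma hamiltonian_alt:
  assumes a: "a \<in> carrier A"
  shows "H a = (THE \<theta>. \<theta> \<in> Der \<and> cls (con \<theta> omega_rep) = cls (dd a))"
proof -
  have "dr_d K A (dr_of_function K A (fcls a)) = cls (dd a)"
    using a by (simp add: dr_of_function_class dr_d_class d_zero_form)
  then have "(\<theta> \<in> Der \<and> dr_contraction K A \<theta> \<omega> = dr_d K A (dr_of_function K A (fcls a)))
      = (\<theta> \<in> Der \<and> cls (con \<theta> omega_rep) = cls (dd a))" for \<theta>
    by (metis dr_contraction_omega)
  then show ?thesis by (simp only: hamiltonian_def)
qed

lemma H_Der [simp]: "a \<in> carrier A \<Longrightarrow> H a \<in> Der"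
  and H_con: "a \<in> carrier A \<Longrightarrow> cls (con (H a) omega_rep) = cls (dd a)"
  using theI'[OF hamiltonian_ex1, of a] by (auto simp: hamiltonian_alt)

lemma H_unique: "\<lbrakk>a \<in> carrier A; \<theta> \<in> Der; cls (con \<theta> omega_rep) = cls (dd a)\<rbrakk> \<Longrightarrow> H a = \<theta>"
  using hamiltonian_ex1[of a] H_Der[of a] H_con[of a] by blast

lemma H_add:
  assumes ab: "a \<in> carrier A" "b \<in> carrier A"
  shows "H (a \<oplus>\<^bsub>A\<^esub> b) = der_add (H a) (H b)"
proof (rule H_unique)
  have "con (der_add (H a) (H b)) omega_rep = con (H a) omega_rep \<oplus>\<^bsub>Om\<^esub> con (H b) omega_rep"
    by (rule con_sum) (use ab der_add_Der in auto)
  then show "cls (con (der_add (H a) (H b)) omega_rep) = cls (dd (a \<oplus>\<^bsub>A\<^esub> b))"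
    using ab cls_add_cong[OF H_con H_con] by (simp add: dd_add)
qed (use ab der_add_Der in auto)

lemma H_smult:
  assumes ca: "c \<in> carrier K" "a \<in> carrier A"
  shows "H (c \<odot>\<^bsub>A\<^esub> a) = der_smult c (H a)"
proof (rule H_unique)
  have "con (der_smult c (H a)) omega_rep = scalar c \<bullet> con (H a) omega_rep"
    by (rule con_smult[of "H a"]) (use ca der_smult_Der in auto)
  then show "cls (con (der_smult c (H a)) omega_rep) = cls (dd (c \<odot>\<^bsub>A\<^esub> a))"
    using ca cls_scalar_cong[OF _ H_con] by (simp add: dd_smult)
qed (use ca der_smult_Der in auto)

lemma H_symplectic:
  assumes a: "a \<in> carrier A"
  shows "Lie (H a) omega_rep \<in> SC"
proof -
  have "cls (d (con (H a) omega_rep)) = cls (d (dd a))"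
    using a by (intro cls_d_cong[OF H_con]) simp_all
  then have "d (con (H a) omega_rep) \<in> SC" using a by (simp add: d_dd cls_zero_iff)
  then show ?thesis using a d_omega_rep by (simp add: lie_derivative_def SC_add con_SC)
qed

text \<open>The key identity \<open>\<theta>\<^bsub>{f,g}\<^esub> = [\<theta>\<^sub>f, \<theta>\<^sub>g]\<close>: contract \<open>\<omega>\<close> with
  \<open>i\<^bsub>[\<theta>,\<eta>]\<^esub> = L\<^sub>\<theta> i\<^sub>\<eta> - i\<^sub>\<eta> L\<^sub>\<theta>\<close>.\<close>

lemma H_bracket:
  assumes ab: "a \<in> carrier A" "b \<in> carrier A"
  shows "H (H a b) = derivation_commutator A (H a) (H b)"
proof (rule H_unique)
  let ?c = "derivation_commutator A (H a) (H b)"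
  let ?L = "Lie (H a)"
  have H: "H a \<in> Der" "H b \<in> Der" using ab by auto
  show "?c \<in> Der" by (rule commutator_Der[OF H])
  have "?L (dd b) = dd (H a b)"
    using ab H by (simp add: lie_derivative_def con_dd d_dd d_zero_form con_zero)
  moreover have "cls (?L (con (H b) omega_rep)) = cls (?L (dd b))"
    using ab H H_con[of b] by (metis dr_lie_class con_closed dd_closed omega_rep_closed)
  moreover have "cls (?L (con (H b) omega_rep) \<ominus>\<^bsub>Om\<^esub> con (H b) (?L omega_rep)) = cls (?L (con (H b) omega_rep))"
  proof -
    have "con (H b) (?L omega_rep) \<in> SC" using H_symplectic ab con_SC by simp
    moreover have "(u \<ominus>\<^bsub>Om\<^esub> v) \<ominus>\<^bsub>Om\<^esub> u = \<ominus>\<^bsub>Om\<^esub> v" if "u \<in> carrier Om" "v \<in> carrier Om" for u v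
      using that by algebra
    then have "(?L (con (H b) omega_rep) \<ominus>\<^bsub>Om\<^esub> con (H b) (?L omega_rep)) \<ominus>\<^bsub>Om\<^esub> ?L (con (H b) omega_rep) = \<ominus>\<^bsub>Om\<^esub> con (H b) (?L omega_rep)"
      using H by simp
    ultimately show ?thesis using H by (simp add: cls_eq_iff SC_minus)
  qed
  ultimately show "cls (con ?c omega_rep) = cls (dd (H a b))"
    by (simp add: con_commutator[OF H])
qed (use ab in auto)

lemma H_alternating:
  assumes a: "a \<in> carrier A"
  shows "H a a \<in> CA"
proof -
  have "cls (con (H a) (dd a)) = cls (con (H a) (con (H a) omega_rep))"
    using a H_con[OF a] by (intro cls_con_cong) auto
  also have "\<dots> = cls \<zero>\<^bsub>Om\<^esub>" using a by (simp add: con_con_self)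
  finally show ?thesis using a by (simp add: con_dd cls_zero_iff zero_form_SC_iff)
qed

abbreviation "Q \<equiv> commutator_quotient K A"
abbreviation "pb \<equiv> poisson_bracket K A \<omega>"

lemmas Q_ops = quotient_space_ops[OF comms_carrier comms_smult, folded commutator_quotient_alt]

lemma Q_module: "module K Q"
  unfolding commutator_quotient_alt by (rule quotient_space_module[OF comms_carrier comms_smult])

lemma Q_cases:
  assumes "f \<in> carrier Q"
  obtains a where "a \<in> carrier A" "f = fcls a"
  using assms by (auto simp: Q_ops(1))

lemma fcls_closed [simp]: "a \<in> carrier A \<Longrightarrow> fcls a \<in> carrier Q"
  by (auto simp: Q_ops(1))

lemma bracket_class:
  assumes ab: "a \<in> carrier A" "b \<in> carrier A"
  shows "pb (fcls a) (fcls b) = fcls (H a b)"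
  unfolding poisson_bracket_def
proof (rule the_equality)
  have rhs: "dr_contraction K A (H a) (dr_d K A (dr_of_function K A (fcls b))) = cls (\<iota> (H a b))"
    using ab by (simp add: dr_of_function_class dr_d_class d_zero_form dr_contraction_class con_dd)
  show "fcls (H a b) \<in> carrier Q \<and> dr_of_function K A (fcls (H a b)) =
      dr_contraction K A (H a) (dr_d K A (dr_of_function K A (fcls b)))"
    unfolding rhs using ab by (simp add: dr_of_function_class)
  fix h assume "h \<in> carrier Q \<and> dr_of_function K A h =
      dr_contraction K A (H a) (dr_d K A (dr_of_function K A (fcls b)))"
  then have h: "h \<in> carrier Q" "dr_of_function K A h = cls (\<iota> (H a b))" by (simp_all only: rhs)
  then obtain c where "c \<in> carrier A" "h = fcls c" by (auto elim: Q_cases)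
  with h(2) show "h = fcls (H a b)"
    using ab dr_of_function_inj[of c "H a b"] by (simp add: dr_of_function_class)
qed

text \<open>Polarisation of the alternating law.\<close>

lemma bracket_skew:
  assumes "f \<in> carrier Q" "g \<in> carrier Q"
  shows "pb f g \<oplus>\<^bsub>Q\<^esub> pb g f = \<zero>\<^bsub>Q\<^esub>"
proof -
  obtain a b where ab: "a \<in> carrier A" "b \<in> carrier A" "f = fcls a" "g = fcls b"
    using assms by (auto elim!: Q_cases)
  have h: "H a a \<in> CA" "H b b \<in> CA" "der_add (H a) (H b) (a \<oplus>\<^bsub>A\<^esub> b) \<in> CA"
    using H_alternating ab by (auto simp flip: H_add)
  have cl: "H a a \<in> carrier A" "H b b \<in> carrier A" "H a b \<in> carrier A" "H b a \<in> carrier A" using ab by auto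
  have "der_add (H a) (H b) (a \<oplus>\<^bsub>A\<^esub> b) \<ominus>\<^bsub>A\<^esub> H a a \<ominus>\<^bsub>A\<^esub> H b b = H a b \<oplus>\<^bsub>A\<^esub> H b a"
    using ab by (simp add: Der_add) (use cl in algebra)
  then have "H a b \<oplus>\<^bsub>A\<^esub> H b a \<in> CA"
    using M.aspan_diff[OF comms_carrier M.aspan_diff[OF comms_carrier h(3,1)] h(2)] by simp
  then show ?thesis
    using ab by (simp add: bracket_class Q_ops fcls_eq_iff M.minus_zero_right)
qed

lemma poisson_lie_algebra: "lie_algebra K Q pb"
proof -
  interpret Q: module K Q by (rule Q_module)
  have bc [simp]: "pb f g \<in> carrier Q" if "f \<in> carrier Q" "g \<in> carrier Q" for f g
    using that by (auto elim!: Q_cases simp: bracket_class)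
  have skew: "pb f g = \<ominus>\<^bsub>Q\<^esub> pb g f" if "f \<in> carrier Q" "g \<in> carrier Q" for f g
    using bracket_skew[OF that] that by (simp add: Q.M.minus_equality)
  have add_right: "pb f (g \<oplus>\<^bsub>Q\<^esub> h) = pb f g \<oplus>\<^bsub>Q\<^esub> pb f h"
    if "f \<in> carrier Q" "g \<in> carrier Q" "h \<in> carrier Q" for f g h
    using that by (auto elim!: Q_cases simp: Q_ops bracket_class Der_add)
  have zero_right: "pb f \<zero>\<^bsub>Q\<^esub> = \<zero>\<^bsub>Q\<^esub>" if "f \<in> carrier Q" for f
    using add_right[OF that, of "\<zero>\<^bsub>Q\<^esub>" "\<zero>\<^bsub>Q\<^esub>"] that
    by (simp add: Q.M.add.l_cancel_one')
  have minus_right: "pb f (\<ominus>\<^bsub>Q\<^esub> g) = \<ominus>\<^bsub>Q\<^esub> pb f g" if "f \<in> carrier Q" "g \<in> carrier Q" for f g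
    using add_right[OF that(1), of "\<ominus>\<^bsub>Q\<^esub> g" g] that zero_right[OF that(1)]
    by (simp add: Q.M.l_neg Q.M.minus_equality)
  \<comment> \<open>The Jacobi identity in Leibniz form is \<open>\<theta>\<^bsub>{f,g}\<^esub> = [\<theta>\<^bsub>f\<^esub>, \<theta>\<^bsub>g\<^esub>]\<close> applied to \<open>h\<close>.\<close>
  have leib: "pb (pb f g) h \<oplus>\<^bsub>Q\<^esub> pb g (pb f h) = pb f (pb g h)"
    if fgh: "f \<in> carrier Q" "g \<in> carrier Q" "h \<in> carrier Q" for f g h
  proof -
    obtain a b c where abc: "a \<in> carrier A" "b \<in> carrier A" "c \<in> carrier A"
      "f = fcls a" "g = fcls b" "h = fcls c"
      using fgh by (auto elim!: Q_cases)
    then show ?thesis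
      by (simp add: bracket_class H_bracket Q_ops a_minus_def M.a_assoc M.l_neg)
  qed
  show ?thesis
  proof (intro lie_algebra.intro lie_algebra_axioms.intro)
    show "module K Q" by (rule Q_module)
    show "field K" by (rule K.field_axioms)
    fix x y z assume xyz: "x \<in> carrier Q" "y \<in> carrier Q" "z \<in> carrier Q"
    show "pb (x \<oplus>\<^bsub>Q\<^esub> y) z = pb x z \<oplus>\<^bsub>Q\<^esub> pb y z"
      using xyz by (auto elim!: Q_cases simp: Q_ops bracket_class H_add)
    have "pb z (pb x y) = \<ominus>\<^bsub>Q\<^esub> pb (pb x y) z" using xyz by (intro skew) auto
    moreover have "pb y (pb z x) = \<ominus>\<^bsub>Q\<^esub> pb y (pb x z)"
      using xyz by (simp add: skew[of z x] minus_right)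
    ultimately show "pb x (pb y z) \<oplus>\<^bsub>Q\<^esub> pb y (pb z x) \<oplus>\<^bsub>Q\<^esub> pb z (pb x y) = \<zero>\<^bsub>Q\<^esub>"
      using xyz leib[OF xyz, symmetric]
      by (simp add: Q.M.a_assoc Q.M.r_neg Q.M.r_neg1 Q.M.r_neg2 Q.M.a_lcomm)
  next
    fix x y assume "x \<in> carrier Q" "y \<in> carrier Q"
    then show "pb x y \<in> carrier Q" by simp
  next
    fix c x y assume "c \<in> carrier K" "x \<in> carrier Q" "y \<in> carrier Q"
    then show "pb (c \<odot>\<^bsub>Q\<^esub> x) y = c \<odot>\<^bsub>Q\<^esub> pb x y" "pb x (c \<odot>\<^bsub>Q\<^esub> y) = c \<odot>\<^bsub>Q\<^esub> pb x y"
      by (auto elim!: Q_cases simp: Q_ops bracket_class H_smult Der_smult)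
  next
    fix x assume "x \<in> carrier Q"
    then obtain a where "a \<in> carrier A" "x = fcls a" by (rule Q_cases)
    then show "pb x x = \<zero>\<^bsub>Q\<^esub>"
      using H_alternating[of a] by (simp add: Q_ops bracket_class fcls_eq_iff M.minus_zero_right)
  qed (rule add_right)
qed

subsection \<open>Symplectic derivations\<close>

abbreviation "Sy \<equiv> symplectic_derivations K A \<omega>"

text \<open>Since \<open>\<omega>\<close> is closed, \<open>L\<^bsub>\<theta>\<^esub>\<omega> = 0\<close> means that \<open>i\<^bsub>\<theta>\<^esub>\<omega>\<close> is closed.\<close>

lemma lie_omega_rep_iff: "\<theta> \<in> Der \<Longrightarrow> Lie \<theta> omega_rep \<in> SC \<longleftrightarrow> d (con \<theta> omega_rep) \<in> SC"
proof
  assume \<theta>: "\<theta> \<in> Der"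
  then have c: "con \<theta> (d omega_rep) \<in> SC" using d_omega_rep by (simp add: con_SC)
  show "Lie \<theta> omega_rep \<in> SC" if "d (con \<theta> omega_rep) \<in> SC"
    using that c by (simp add: lie_derivative_def SC_add)
  assume "Lie \<theta> omega_rep \<in> SC"
  from SC_diff[OF this c] show "d (con \<theta> omega_rep) \<in> SC"
    using \<theta> by (simp add: lie_derivative_def a_minus_def F.a_assoc F.r_neg)
qed

lemma Sy_carrier: "\<theta> \<in> carrier Sy \<longleftrightarrow> \<theta> \<in> Der \<and> d (con \<theta> omega_rep) \<in> SC"
  by (cases "\<theta> \<in> Der")
     (simp_all add: symplectic_derivations_def dr_lie_omega deRham_zero cls_zero_iff lie_omega_rep_iff)

lemma Sy_ops: "\<theta> \<oplus>\<^bsub>Sy\<^esub> \<eta> = der_add \<theta> \<eta>" "c \<odot>\<^bsub>Sy\<^esub> \<theta> = der_smult c \<theta>" "\<zero>\<^bsub>Sy\<^esub> = (\<lambda>x\<in>carrier A. \<zero>\<^bsub>A\<^esub>)"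
  by (simp_all add: symplectic_derivations_def der_add_def der_smult_def)

lemma Sy_Der [simp]: "\<theta> \<in> carrier Sy \<Longrightarrow> \<theta> \<in> Der"
  by (simp add: Sy_carrier)

lemma Sy_ext: "\<lbrakk>\<theta> \<in> carrier Sy; \<eta> \<in> carrier Sy; \<And>x. x \<in> carrier A \<Longrightarrow> \<theta> x = \<eta> x\<rbrakk> \<Longrightarrow> \<theta> = \<eta>"
  by (rule Der_ext) auto

lemma H_Sy: "a \<in> carrier A \<Longrightarrow> H a \<in> carrier Sy"
  using H_symplectic by (simp add: Sy_carrier lie_omega_rep_iff)

lemma Sy_add: assumes "\<theta> \<in> carrier Sy" "\<eta> \<in> carrier Sy" shows "der_add \<theta> \<eta> \<in> carrier Sy"
proof -
  have D: "\<theta> \<in> Der" "\<eta> \<in> Der" "der_add \<theta> \<eta> \<in> Der" using assms der_add_Der by auto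
  have "con (der_add \<theta> \<eta>) omega_rep = con \<theta> omega_rep \<oplus>\<^bsub>Om\<^esub> con \<eta> omega_rep" by (rule con_sum[OF D]) auto
  then show ?thesis using assms D by (simp add: Sy_carrier d_add SC_add)
qed

lemma Sy_smult: assumes "\<theta> \<in> carrier Sy" and c: "c \<in> carrier K" shows "der_smult c \<theta> \<in> carrier Sy"
proof -
  have D: "\<theta> \<in> Der" "der_smult c \<theta> \<in> Der" using assms der_smult_Der by auto
  have "con (der_smult c \<theta>) omega_rep = scalar c \<bullet> con \<theta> omega_rep" by (rule con_smult[OF D c]) auto
  moreover have "d (scalar c \<bullet> con \<theta> omega_rep) = scalar c \<bullet> d (con \<theta> omega_rep)"
    using c D by (simp add: scalar_def d_zero_form_mult dd_scalar)
  ultimately show ?thesis using assms D by (simp add: Sy_carrier SC_scalar)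
qed

lemma Sy_zero: "(\<lambda>x\<in>carrier A. \<zero>\<^bsub>A\<^esub>) \<in> carrier Sy"
proof -
  let ?z = "\<lambda>x\<in>carrier A. \<zero>\<^bsub>A\<^esub>"
  have "con ?z omega_rep = con ?z omega_rep \<oplus>\<^bsub>Om\<^esub> con ?z omega_rep"
    by (rule con_sum) (use der_zero_Der in auto)
  then have "con ?z omega_rep = \<zero>\<^bsub>Om\<^esub>" using der_zero_Der by (metis F.add.l_cancel_one' con_closed omega_rep_closed)
  then show ?thesis using der_zero_Der by (simp add: Sy_carrier d_zero SC_zero)
qed

lemma Sy_commutator:
  assumes "\<theta> \<in> carrier Sy" "\<eta> \<in> carrier Sy"
  shows "derivation_commutator A \<theta> \<eta> \<in> carrier Sy"
proof -
  have D: "\<theta> \<in> Der" "\<eta> \<in> Der" using assms by auto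
  let ?L = "Lie \<theta>"
  have S: "d (con \<theta> omega_rep) \<in> SC" "d (con \<eta> omega_rep) \<in> SC" using assms Sy_carrier by blast+
  then have 1: "con \<eta> (?L omega_rep) \<in> SC" using D by (intro con_SC) (simp_all only: lie_omega_rep_iff)
  have "d (?L (con \<eta> omega_rep)) = d (con \<theta> (d (con \<eta> omega_rep)))"
    using D by (simp add: lie_derivative_def d_add d_d)
  also have "\<dots> \<in> SC" by (intro d_SC con_SC D S)
  finally show ?thesis
    using D 1 commutator_Der[OF D]
    by (simp add: Sy_carrier con_commutator d_diff SC_diff d_SC)
qed

lemma Sy_module: "module K Sy"
proof (rule moduleI)
  show "cring K" by (rule R.is_cring)
  show "abelian_group Sy"
  proof (rule abelian_groupI)
    fix \<theta> assume \<theta>: "\<theta> \<in> carrier Sy"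
    show "\<exists>\<eta>\<in>carrier Sy. \<eta> \<oplus>\<^bsub>Sy\<^esub> \<theta> = \<zero>\<^bsub>Sy\<^esub>"
    proof (intro bexI)
      show n: "der_smult (\<ominus>\<^bsub>K\<^esub> \<one>\<^bsub>K\<^esub>) \<theta> \<in> carrier Sy" using \<theta> by (intro Sy_smult) auto
      show "der_smult (\<ominus>\<^bsub>K\<^esub> \<one>\<^bsub>K\<^esub>) \<theta> \<oplus>\<^bsub>Sy\<^esub> \<theta> = \<zero>\<^bsub>Sy\<^esub>"
        unfolding Sy_ops
        by (rule Sy_ext) (use \<theta> n Sy_add Sy_zero in \<open>auto simp: smult_l_minus M.l_neg\<close>)
    qed
  next
    fix x y z assume xyz: "x \<in> carrier Sy" "y \<in> carrier Sy" "z \<in> carrier Sy"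
    show "x \<oplus>\<^bsub>Sy\<^esub> y \<oplus>\<^bsub>Sy\<^esub> z = x \<oplus>\<^bsub>Sy\<^esub> (y \<oplus>\<^bsub>Sy\<^esub> z)"
      unfolding Sy_ops by (rule Sy_ext) (use xyz Sy_add in \<open>auto simp: M.a_assoc\<close>)
  next
    fix x y assume xy: "x \<in> carrier Sy" "y \<in> carrier Sy"
    show "x \<oplus>\<^bsub>Sy\<^esub> y \<in> carrier Sy" unfolding Sy_ops using xy by (rule Sy_add)
    show "x \<oplus>\<^bsub>Sy\<^esub> y = y \<oplus>\<^bsub>Sy\<^esub> x"
      unfolding Sy_ops by (rule Sy_ext) (use xy Sy_add in \<open>auto simp: M.a_comm\<close>)
  next
    fix x assume x: "x \<in> carrier Sy"
    show "\<zero>\<^bsub>Sy\<^esub> \<oplus>\<^bsub>Sy\<^esub> x = x"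
      unfolding Sy_ops by (rule Sy_ext) (use x Sy_add Sy_zero in auto)
  qed (simp add: Sy_ops Sy_zero)
next
  fix a b x assume abx: "a \<in> carrier K" "b \<in> carrier K" "x \<in> carrier Sy"
  show "a \<odot>\<^bsub>Sy\<^esub> x \<in> carrier Sy" unfolding Sy_ops using abx by (intro Sy_smult)
  show "(a \<oplus>\<^bsub>K\<^esub> b) \<odot>\<^bsub>Sy\<^esub> x = a \<odot>\<^bsub>Sy\<^esub> x \<oplus>\<^bsub>Sy\<^esub> b \<odot>\<^bsub>Sy\<^esub> x"
    unfolding Sy_ops by (rule Sy_ext) (use abx Sy_add Sy_smult in \<open>auto simp: smult_l_distr\<close>)
  show "a \<otimes>\<^bsub>K\<^esub> b \<odot>\<^bsub>Sy\<^esub> x = a \<odot>\<^bsub>Sy\<^esub> (b \<odot>\<^bsub>Sy\<^esub> x)"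
    unfolding Sy_ops by (rule Sy_ext) (use abx Sy_smult in \<open>auto simp: smult_assoc1\<close>)
next
  fix a x y assume axy: "a \<in> carrier K" "x \<in> carrier Sy" "y \<in> carrier Sy"
  show "a \<odot>\<^bsub>Sy\<^esub> (x \<oplus>\<^bsub>Sy\<^esub> y) = a \<odot>\<^bsub>Sy\<^esub> x \<oplus>\<^bsub>Sy\<^esub> a \<odot>\<^bsub>Sy\<^esub> y"
    unfolding Sy_ops by (rule Sy_ext) (use axy Sy_add Sy_smult in \<open>auto simp: smult_r_distr\<close>)
next
  fix x assume x: "x \<in> carrier Sy"
  show "\<one>\<^bsub>K\<^esub> \<odot>\<^bsub>Sy\<^esub> x = x"
    unfolding Sy_ops by (rule Sy_ext) (use x Sy_smult in auto)
qed

lemma symplectic_lie_algebra: "lie_algebra K Sy (derivation_commutator A)"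
proof (intro lie_algebra.intro lie_algebra_axioms.intro)
  show "module K Sy" by (rule Sy_module)
  show "field K" by (rule K.field_axioms)
  let ?b = "derivation_commutator A"
  fix x y assume xy: "x \<in> carrier Sy" "y \<in> carrier Sy"
  show "?b x y \<in> carrier Sy" using xy by (rule Sy_commutator)
  show "?b (c \<odot>\<^bsub>Sy\<^esub> x) y = c \<odot>\<^bsub>Sy\<^esub> ?b x y" "?b x (c \<odot>\<^bsub>Sy\<^esub> y) = c \<odot>\<^bsub>Sy\<^esub> ?b x y" if c: "c \<in> carrier K" for c
    unfolding Sy_ops
    by (rule Sy_ext; use xy c Sy_smult Sy_commutator in
        \<open>auto simp: Der_smult a_minus_def smult_r_distr smult_r_minus\<close>)+
  fix z assume z: "z \<in> carrier Sy"
  have cl: "u (v a) \<in> carrier A" "u (v (t a)) \<in> carrier A" "u a \<in> carrier A"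
    if "u \<in> carrier Sy" "v \<in> carrier Sy" "t \<in> carrier Sy" "a \<in> carrier A" for u v t a
    using that by auto
  note cls = cl[OF xy z] cl[OF xy(1) z xy(2)] cl[OF xy(2,1) z] cl[OF xy(2) z xy(1)] cl[OF z xy] cl[OF z xy(2,1)]
  show "?b (x \<oplus>\<^bsub>Sy\<^esub> y) z = ?b x z \<oplus>\<^bsub>Sy\<^esub> ?b y z"
    unfolding Sy_ops
  proof (rule Sy_ext)
    fix a assume a: "a \<in> carrier A"
    show "?b (der_add x y) z a = der_add (?b x z) (?b y z) a"
      using a xy z by (simp add: Der_add) (use cls[OF a] a in algebra)
  qed (use xy z Sy_add Sy_commutator in auto)
  show "?b x (y \<oplus>\<^bsub>Sy\<^esub> z) = ?b x y \<oplus>\<^bsub>Sy\<^esub> ?b x z"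
    unfolding Sy_ops
  proof (rule Sy_ext)
    fix a assume a: "a \<in> carrier A"
    show "?b x (der_add y z) a = der_add (?b x y) (?b x z) a"
      using a xy z by (simp add: Der_add) (use cls[OF a] a in algebra)
  qed (use xy z Sy_add Sy_commutator in auto)
  show "?b x (?b y z) \<oplus>\<^bsub>Sy\<^esub> ?b y (?b z x) \<oplus>\<^bsub>Sy\<^esub> ?b z (?b x y) = \<zero>\<^bsub>Sy\<^esub>"
    unfolding Sy_ops
  proof (rule Sy_ext)
    fix a assume a: "a \<in> carrier A"
    have m: "u (p \<ominus>\<^bsub>A\<^esub> q) = u p \<ominus>\<^bsub>A\<^esub> u q" if "u \<in> carrier Sy" "p \<in> carrier A" "q \<in> carrier A" for u p q
    proof -
      have "u (p \<ominus>\<^bsub>A\<^esub> q) \<oplus>\<^bsub>A\<^esub> u q = u p"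
        using Der_add[of u "p \<ominus>\<^bsub>A\<^esub> q" q] that by (simp add: a_minus_def M.a_assoc M.l_neg)
      then show ?thesis
        using that M.add.inv_solve_right[of "u (p \<ominus>\<^bsub>A\<^esub> q)" "u p" "u q"] by (simp add: a_minus_def)
    qed
    show "der_add (der_add (?b x (?b y z)) (?b y (?b z x))) (?b z (?b x y)) a = (\<lambda>x\<in>carrier A. \<zero>\<^bsub>A\<^esub>) a"
      using a xy z by (simp add: m) (use cls[OF a] a in algebra)
  qed (use xy z Sy_add Sy_commutator Sy_zero in auto)
next
  fix x assume x: "x \<in> carrier Sy"
  show "derivation_commutator A x x = \<zero>\<^bsub>Sy\<^esub>"
    unfolding Sy_ops by (rule Sy_ext) (use x Sy_commutator Sy_zero in \<open>auto simp: M.minus_self\<close>)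
qed

lemma hamiltonian_lie_hom:
  "lie_algebra_hom K Q pb Sy (derivation_commutator A) (hamiltonian K A \<omega>)"
proof (intro lie_algebra_hom.intro lie_algebra_hom_axioms.intro)
  show "lie_algebra K Q pb" by (rule poisson_lie_algebra)
  show "lie_algebra K Sy (derivation_commutator A)" by (rule symplectic_lie_algebra)
qed (auto elim!: Q_cases simp: Q_ops Sy_ops H_Sy H_add H_smult bracket_class H_bracket)

end

theorem theorem14p1p4:
  fixes K :: "('k, 'r) ring_scheme" and A :: "('k, 'a, 'm) module_scheme" and \<omega> :: "'a form set"
  assumes "algebraically_closed K"
    and "\<forall>n::nat. n > 0 \<longrightarrow> add_pow K n \<one>\<^bsub>K\<^esub> \<noteq> \<zero>\<^bsub>K\<^esub>"
    and "nc_symplectic K A \<omega>"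
  shows "lie_algebra K (commutator_quotient K A) (poisson_bracket K A \<omega>)
    \<and> lie_algebra_hom K (commutator_quotient K A) (poisson_bracket K A \<omega>)
        (symplectic_derivations K A \<omega>) (derivation_commutator A) (hamiltonian K A \<omega>)"
  using nc_symplectic.poisson_lie_algebra[OF assms(3)] nc_symplectic.hamiltonian_lie_hom[OF assms(3)]
  by blast

end
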